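(* Let $M$ be the rank one Heisenberg (free boson) vertex operator algebra. Then $$Z_M^{(2)}(\tau_1,\tau_2,\epsilon)=\frac{Z_M^{(1)}(\tau_1)Z_M^{(1)}(\tau_2)}{\prod_{N\in\mathcal R}(1-\zeta(N))^{1/2}},$$ where $\mathcal R$ is the set of isomorphism classes of rotationless chequered cycles and $\zeta(N)$ is the weight of the chequered cycle $N$.
   Context: **Heisenberg VOA.** $M$ is the vertex operator algebra (VOA) of central charge $c=1$ generated by a weight one vector $a$ with modes satisfying $[a(m),a(n)]=m\,\delta_{m,-n}$, with Fock basis $a(-1)^{e_1}\cdots a(-p)^{e_p}\mathbf 1$ and conformal vector $\omega=\frac12 a(-1)^2\mathbf 1$. **Square bracket VOA.** For a VOA $V$ of central charge $c$, Zhu's isomorphic VOA $(V,Y[\,,\,],\mathbf 1,\tilde\omega)$ has $Y[v,z]=\sum_n v[n]z^{-n-1}=Y(e^{zL(0)}v,e^z-1)$, $\tilde\omega=\omega-\frac c{24}\mathbf 1$, $Y[\tilde\omega,z]=\sum_n L[n]z^{-n-2}$, $V_{[k]}=\{v: L[0]v=kv\}$. The Li-Zamolodchikov (LiZ) metric of a VOA is the unique nondegenerate bilinear form with $\langle Y(b,z)u,v\rangle=\langle u,Y(e^{zL(1)}(-z^{-2})^{L(0)}b,z^{-1})v\rangle$ and $\langle\mathbf 1,\mathbf 1\rangle=1$; $\langle\,,\rangle_{\rm sq}$ is the LiZ metric of the square bracket VOA. **Genus one and two functions.** $o(v)=v(\mathrm{wt}(v)-1)$ for homogeneous $v$, extended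 linearly; $Z_V^{(1)}(v,\tau)=\mathrm{Tr}_V(o(v)q^{L(0)-c/24})$, $q=e^{2\pi i \tau}$, and $Z_V^{(1)}(\tau)=Z_V^{(1)}(\mathbf 1,\tau)$. The genus two partition function is, a priori, the formal power series in $\epsilon$ (with coefficients functions of $\tau_1,\tau_2\in\mathbb H_1$, the upper half-plane) $$Z_V^{(2)}(\tau_1,\tau_2,\epsilon)=\sum_{n\ge0}\epsilon^n\sum_{u\in V_{[n]}}Z_V^{(1)}(u,\tau_1)Z_V^{(1)}(\bar u,\tau_2),$$ the inner sum being over any basis $\{u\}$ of $V_{[n]}$ with dual basis $\{\bar u\}$ with respect to $\langle\,,\rangle_{\rm sq}$. **Edge weights.** $E_k(\tau)=0$ for $k$ odd and $E_k(\tau)=-\frac{B_k}{k!}+\frac{2}{(k-1)!}\sum_{n\ge1}\sigma_{k-1}(n)q^n$ for $k\geq 2$ even; $C(k,l,\tau)=(-1)^{k+1}\frac{(k+l-1)!}{(k-1)!(l-1)!}E_{k+l}(\tau)$; $A_a(k,l)=\frac{\epsilon^{(k+l)/2}}{\sqrt{kl}}C(k,l,\tau_a)$ for $a=1,2$ and $k,l\ge1$. **Chequered cycles.** A chequered cycle is a (clockwise) oriented polygon with $2n$ nodes ($n\ge1$), with nodes labeled by arbitrary positive integers and edges labeled $1$ or $2$ so that edge labels alternate around the polygon. Isomorphisms preserve orientation and the labels of nodes and edges. A chequered cycle is rotationless if it has no non-trivial rotation (orientation-preserving automorphism) preserving the labels of nodes and edges. The weight is $\zeta(N)=\prod_E\zeta(E)$,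 product over the edges $E$ of $N$, where an edge with label $a$ directed from a node labeled $k$ to a node labeled $l$ has weight $A_a(k,l)$. Since $\zeta(N)$ is $\epsilon$ to the power of the sum of the node labels times a function of $\tau_1,\tau_2$, the product is well defined as a formal power series in $\epsilon$ with constant term $1$. *)

theory Defs
  imports
    "HOL-Analysis.Analysis"
    "HOL-Library.Groups_Big_Fun"
    "HOL-Computational_Algebra.Formal_Laurent_Series"
begin

section \<open>Vertex operator algebras\<close>

text \<open>
  The underlying vector space is the whole type; \<open>mode V v n\<close> is the operator \<open>v(n)\<close>,
  the coefficient of \<open>z\<^sup>-\<^sup>n\<^sup>-\<^sup>1\<close> in \<open>Y(v,z)\<close>. \<open>Sum_any\<close> is only ever applied to families
  that, in a vertex operator algebra, have finite support.
\<close>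

record 'v vertex_structure =
  smult :: "complex \<Rightarrow> 'v \<Rightarrow> 'v"
  mode :: "'v \<Rightarrow> int \<Rightarrow> 'v \<Rightarrow> 'v"
  vacuum :: 'v
  conformal :: 'v
  central_charge :: complex

definition Lop :: "'v vertex_structure \<Rightarrow> int \<Rightarrow> 'v \<Rightarrow> 'v" where
  "Lop V n = mode V (conformal V) (n + 1)"

definition weight_space :: "'v vertex_structure \<Rightarrow> int \<Rightarrow> 'v set" where
  "weight_space V k = {v. Lop V 0 v = smult V (of_int k) v}"

locale vertex_operator_algebra =
  fixes V :: "'v::ab_group_add vertex_structure"
  assumes vector_space: "vector_space (smult V)"
    and mode_linear_left: "Vector_Spaces.linear (smult V) (smult V) (\<lambda>v. mode V v n w)"
    and mode_linear_right: "Vector_Spaces.linear (smult V) (smult V) (mode V v n)"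
    and truncation: "\<exists>N. \<forall>n\<ge>N. mode V v n w = 0"
    and vacuum: "mode V (vacuum V) n v = (if n = -1 then v else 0)"
    and creation: "mode V v (-1) (vacuum V) = v" "n \<ge> 0 \<Longrightarrow> mode V v n (vacuum V) = 0"
    and borcherds_identity:
      "Sum_any (\<lambda>i::nat. smult V (of_int m gchoose i) (mode V (mode V u (l + int i) v) (m + n - int i) w)) =
       Sum_any (\<lambda>i::nat. smult V ((-1) ^ i * (of_int l gchoose i))
         (mode V u (m + l - int i) (mode V v (n + int i) w)
          - smult V ((-1) powi l) (mode V v (n + l - int i) (mode V u (m + int i) w))))"
    and virasoro:
      "Lop V m (Lop V n v) - Lop V n (Lop V m v) =
       smult V (of_int (m - n)) (Lop V (m + n) v)
       + (if m + n = 0 then smult V (of_int (m ^ 3 - m) / 12 * central_charge V) v else 0)"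
    and translation: "mode V (Lop V (-1) v) n w = smult V (- of_int n) (mode V v (n - 1) w)"
    and grading_spans: "module.span (smult V) (\<Union>k. weight_space V k) = UNIV"
    and finite_dimensional: "\<exists>S. finite S \<and> weight_space V k \<subseteq> module.span (smult V) S"
    and bounded_below: "\<exists>K. \<forall>k<K. weight_space V k = {0}"

definition is_basis_of :: "'v::ab_group_add vertex_structure \<Rightarrow> 'v set \<Rightarrow> 'v set \<Rightarrow> bool" where
  "is_basis_of V W S \<longleftrightarrow> \<not> module.dependent (smult V) S \<and> module.span (smult V) S = W"

text \<open>
  \<open>fock_vector V a [n\<^sub>1, \<dots>, n\<^sub>r] = a(-n\<^sub>1) \<dots> a(-n\<^sub>r) 1\<close>. The weakly increasing lists of positive
  integers index the Fock vectors \<open>a(-1)\<^sup>e\<^sup>1 \<dots> a(-p)\<^sup>e\<^sup>p 1\<close>.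
\<close>

definition fock_vector :: "'v vertex_structure \<Rightarrow> 'v \<Rightarrow> nat list \<Rightarrow> 'v" where
  "fock_vector V a ns = foldr (\<lambda>n w. mode V a (- int n) w) ns (vacuum V)"

definition fock_indices :: "nat list set" where
  "fock_indices = {ns. sorted ns \<and> 0 \<notin> set ns}"

locale heisenberg_voa = vertex_operator_algebra V
  for V :: "'v::ab_group_add vertex_structure" +
  fixes a :: 'v
  assumes central_charge_one: "central_charge V = 1"
    and generator_weight: "a \<in> weight_space V 1"
    and heisenberg_commutator:
      "mode V a m (mode V a n v) - mode V a n (mode V a m v) =
       (if m = - n then smult V (of_int m) v else 0)"
    and fock_inj: "inj_on (fock_vector V a) fock_indices"
    and fock_basis: "is_basis_of V UNIV (fock_vector V a ` fock_indices)"
    and conformal_eq: "conformal V = smult V (1/2) (mode V a (-1) (mode V a (-1) (vacuum V)))"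

section \<open>The square bracket structure and the Li-Zamolodchikov metric\<close>

text \<open>
  \<open>Y[v,z] = Y(e\<^sup>z\<^sup>L\<^sup>(\<^sup>0\<^sup>)v, e\<^sup>z - 1) = \<Sum>\<^sub>j \<Sum>\<^sub>m (z\<^sup>j/j!) (L(0)\<^sup>j v)(m) (e\<^sup>z - 1)\<^sup>-\<^sup>m\<^sup>-\<^sup>1\<close>, so \<open>v[n]\<close> is the coefficient
  of \<open>z\<^sup>-\<^sup>n\<^sup>-\<^sup>1\<close>; on a given vector only \<open>j \<le> m - n\<close> and \<open>m\<close> bounded above contribute.
\<close>

definition sq_mode :: "'v::ab_group_add vertex_structure \<Rightarrow> 'v \<Rightarrow> int \<Rightarrow> 'v \<Rightarrow> 'v" where
  "sq_mode V v n w = Sum_any (\<lambda>(m::int, j::nat).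
     smult V (fls_nth (fps_to_fls (fps_exp 1 - 1) powi (- m - 1)) (- n - 1 - int j) / fact j)
       (mode V ((Lop V 0 ^^ j) v) m w))"

definition square_bracket :: "'v::ab_group_add vertex_structure \<Rightarrow> 'v vertex_structure" where
  "square_bracket V = \<lparr> smult = smult V, mode = sq_mode V, vacuum = vacuum V,
     conformal = conformal V - smult V (central_charge V / 24) (vacuum V),
     central_charge = central_charge V \<rparr>"

text \<open>
  The invariance condition is the coefficient of \<open>z\<^sup>-\<^sup>n\<^sup>-\<^sup>1\<close> in
  \<open>\<langle>Y(b,z)u,v\<rangle> = \<langle>u, Y(e\<^sup>z\<^sup>L\<^sup>(\<^sup>1\<^sup>)(-z\<^sup>-\<^sup>2)\<^sup>L\<^sup>(\<^sup>0\<^sup>)b, z\<^sup>-\<^sup>1)v\<rangle>\<close> for \<open>b\<close> of weight \<open>k\<close>, where the right-hand side is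
  \<open>\<Sum>\<^sub>i \<Sum>\<^sub>m ((-1)\<^sup>k/i!) z\<^sup>i\<^sup>-\<^sup>2\<^sup>k\<^sup>+\<^sup>m\<^sup>+\<^sup>1 \<langle>u, (L(1)\<^sup>i b)(m) v\<rangle>\<close>.
\<close>

definition is_LiZ_metric ::
    "'v::ab_group_add vertex_structure \<Rightarrow> ('v \<Rightarrow> 'v \<Rightarrow> complex) \<Rightarrow> bool" where
  "is_LiZ_metric V B \<longleftrightarrow>
     (\<forall>u. Vector_Spaces.linear (smult V) (*) (B u)) \<and>
     (\<forall>v. Vector_Spaces.linear (smult V) (*) (\<lambda>u. B u v)) \<and>
     (\<forall>u. (\<forall>v. B u v = 0) \<longrightarrow> u = 0) \<and>
     (\<forall>v. (\<forall>u. B u v = 0) \<longrightarrow> v = 0) \<and>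
     B (vacuum V) (vacuum V) = 1 \<and>
     (\<forall>k b n u v. b \<in> weight_space V k \<longrightarrow>
        B (mode V b n u) v =
        Sum_any (\<lambda>i::nat. (-1) powi k / fact i *
          B u (mode V ((Lop V 1 ^^ i) b) (2 * k - n - 2 - int i) v)))"

section \<open>Genus one and genus two functions\<close>

definition homogeneous_part :: "'v::ab_group_add vertex_structure \<Rightarrow> 'v \<Rightarrow> int \<Rightarrow> 'v" where
  "homogeneous_part V v = (THE f. finite {k. f k \<noteq> 0} \<and>
     (\<forall>k. f k \<in> weight_space V k) \<and> Sum_any f = v)"

definition zero_mode :: "'v::ab_group_add vertex_structure \<Rightarrow> 'v \<Rightarrow> 'v \<Rightarrow> 'v" where
  "zero_mode V v w = Sum_any (\<lambda>k. mode V (homogeneous_part V v k) (k - 1) w)"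

definition trace_on ::
    "'v::ab_group_add vertex_structure \<Rightarrow> 'v set \<Rightarrow> ('v \<Rightarrow> 'v) \<Rightarrow> complex" where
  "trace_on V W f = (let S = (SOME S. is_basis_of V W S)
     in \<Sum>b\<in>S. module.representation (smult V) S (f b) b)"

text \<open>\<open>q\<^sup>L\<^sup>(\<^sup>0\<^sup>)\<^sup>-\<^sup>c\<^sup>/\<^sup>2\<^sup>4\<close> acts on the weight \<open>n\<close> space as \<open>exp (2 \<pi> i \<tau> (n - c/24))\<close>.\<close>

definition genus_one :: "'v::ab_group_add vertex_structure \<Rightarrow> 'v \<Rightarrow> complex \<Rightarrow> complex" where
  "genus_one V v \<tau> = (\<Sum>\<^sub>\<infinity>n::int\<in>UNIV. trace_on V (weight_space V n) (zero_mode V v) *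
     exp (2 * of_real pi * \<i> * \<tau> * (of_int n - central_charge V / 24)))"

definition genus_one_partition :: "'v::ab_group_add vertex_structure \<Rightarrow> complex \<Rightarrow> complex" where
  "genus_one_partition V \<tau> = genus_one V (vacuum V) \<tau>"

definition dual_vector ::
    "'v::ab_group_add vertex_structure \<Rightarrow> ('v \<Rightarrow> 'v \<Rightarrow> complex) \<Rightarrow> 'v set \<Rightarrow> 'v \<Rightarrow> 'v" where
  "dual_vector V B S u = (THE w. w \<in> module.span (smult V) S \<and>
     (\<forall>u'\<in>S. B u' w = (if u' = u then 1 else 0)))"

text \<open>
  A formal power series in \<open>\<epsilon>\<close>. \<open>B\<close> is the Li-Zamolodchikov metric of \<^term>\<open>square_bracket V\<close>
  and \<open>S n\<close> a basis of the square bracket weight space of weight \<open>n\<close>.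
\<close>

definition genus_two_partition ::
    "'v::ab_group_add vertex_structure \<Rightarrow> ('v \<Rightarrow> 'v \<Rightarrow> complex) \<Rightarrow> (nat \<Rightarrow> 'v set) \<Rightarrow>
     complex \<Rightarrow> complex \<Rightarrow> complex fps" where
  "genus_two_partition V B S \<tau>\<^sub>1 \<tau>\<^sub>2 = Abs_fps (\<lambda>n.
     \<Sum>u\<in>S n. genus_one V u \<tau>\<^sub>1 * genus_one V (dual_vector V B (S n) u) \<tau>\<^sub>2)"

section \<open>Edge weights\<close>

definition bernoulli_number :: "nat \<Rightarrow> complex" where
  "bernoulli_number k = fact k * fps_nth (fps_X / (fps_exp 1 - 1)) k"

text \<open>Only used for \<open>k \<ge> 2\<close>.\<close>

definition eisenstein :: "nat \<Rightarrow> complex \<Rightarrow> complex" where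
  "eisenstein k \<tau> = (if odd k then 0 else
     - bernoulli_number k / fact k +
     2 / fact (k - 1) * suminf (\<lambda>n. of_nat (\<Sum>d | d dvd Suc n. d ^ (k - 1)) *
       exp (2 * of_real pi * \<i> * \<tau>) ^ Suc n))"

definition C_coeff :: "nat \<Rightarrow> nat \<Rightarrow> complex \<Rightarrow> complex" where
  "C_coeff k l \<tau> = (-1) ^ (k + 1) * (fact (k + l - 1) / (fact (k - 1) * fact (l - 1))) *
     eisenstein (k + l) \<tau>"

text \<open>
  Edge weights involve half-integral powers of \<open>\<epsilon>\<close>; in the next definition the formal
  variable \<^term>\<open>fps_X\<close> stands for \<open>\<epsilon>\<^sup>1\<^sup>/\<^sup>2\<close>.
\<close>

definition edge_weight :: "complex \<Rightarrow> complex \<Rightarrow> nat \<Rightarrow> nat \<Rightarrow> nat \<Rightarrow> complex fps" where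
  "edge_weight \<tau>\<^sub>1 \<tau>\<^sub>2 e k l =
     fps_const (C_coeff k l (if e = 1 then \<tau>\<^sub>1 else \<tau>\<^sub>2) / of_real (sqrt (real (k * l)))) * fps_X ^ (k + l)"

section \<open>Chequered cycles\<close>

text \<open>
  A chequered cycle with a chosen starting node is a list of pairs, namely the label of
  each node and the label of the edge leaving it. The orientation-preserving isomorphisms
  between such polygons are exactly the list rotations.
\<close>

definition chequered_cycle :: "(nat \<times> nat) list \<Rightarrow> bool" where
  "chequered_cycle N \<longleftrightarrow> N \<noteq> [] \<and> even (length N) \<and>
     (\<forall>(k, e)\<in>set N. k > 0 \<and> e \<in> {1, 2}) \<and>
     (\<forall>i<length N. snd (N ! i) \<noteq> snd (N ! (Suc i mod length N)))"

definition cycle_iso :: "((nat \<times> nat) list \<times> (nat \<times> nat) list) set" where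
  "cycle_iso = {(N, N'). \<exists>r. N' = rotate r N}"

definition rotationless :: "(nat \<times> nat) list \<Rightarrow> bool" where
  "rotationless N \<longleftrightarrow> (\<forall>r. 0 < r \<and> r < length N \<longrightarrow> rotate r N \<noteq> N)"

definition rotationless_classes :: "(nat \<times> nat) list set set" where
  "rotationless_classes = {N. chequered_cycle N \<and> rotationless N} // cycle_iso"

text \<open>
  The product of the edge weights is a series in \<open>\<epsilon>\<^sup>1\<^sup>/\<^sup>2\<close>; \<open>cycle_weight\<close> is the series in
  \<open>\<epsilon>\<close> from which it arises by substituting \<open>\<epsilon> = (\<epsilon>\<^sup>1\<^sup>/\<^sup>2)\<^sup>2\<close>.
\<close>

definition cycle_weight :: "complex \<Rightarrow> complex \<Rightarrow> (nat \<times> nat) list \<Rightarrow> complex fps" where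
  "cycle_weight \<tau>\<^sub>1 \<tau>\<^sub>2 N = (THE \<zeta>. \<zeta> oo fps_X ^ 2 =
     (\<Prod>i<length N. edge_weight \<tau>\<^sub>1 \<tau>\<^sub>2 (snd (N ! i)) (fst (N ! i)) (fst (N ! (Suc i mod length N)))))"

definition class_weight :: "complex \<Rightarrow> complex \<Rightarrow> (nat \<times> nat) list set \<Rightarrow> complex fps" where
  "class_weight \<tau>\<^sub>1 \<tau>\<^sub>2 \<N> = the_elem (cycle_weight \<tau>\<^sub>1 \<tau>\<^sub>2 ` \<N>)"

text \<open>\<open>(1 - \<zeta>)\<^sup>1\<^sup>/\<^sup>2\<close> for \<open>\<zeta>\<close> without constant term, by the binomial series.\<close>

definition sqrt_one_minus :: "complex fps \<Rightarrow> complex fps" where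
  "sqrt_one_minus \<zeta> = fps_binomial (1/2) oo (- \<zeta>)"

text \<open>Unordered infinite product, as a limit in the \<open>\<epsilon>\<close>-adic metric on power series.\<close>

definition infprod_fps :: "('i \<Rightarrow> complex fps) \<Rightarrow> 'i set \<Rightarrow> complex fps" where
  "infprod_fps f I = Lim (finite_subsets_at_top I) (prod f)"

end

theory Submission
  imports Defs
begin

text \<open>
  Write \<open>x = e\<^sup>z - 1\<close>. The square bracket modes \<open>a[n]\<close> again satisfy the Heisenberg relations, and in the
  Li-Zamolodchikov metric \<open>-a[-n]\<close> is the adjoint of \<open>a[n]\<close>. In the Casimir sum \<open>\<Sum> u \<otimes> dual u\<close> over a
  basis of a weight space, a creation operator on one factor can therefore be traded for an
  annihilation operator on the other factor (\<open>casimir_move\<close>).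

  Zhu's recursion says that the genus one functions are Gaussian: the functional \<open>Z\<^sup>(\<^sup>1\<^sup>)\<close> contracts
  \<open>a[-n]\<close> with any other factor \<open>a[-m]\<close> to the number \<open>C(n,m,\<tau>)\<close> (\<open>genus_one_zhu\<close>). The recursion follows
  from the Borcherds identity and the cyclicity of the trace, which relates the trace of
  \<open>a(k) v(l)\<close> to that of \<open>v(l) a(k)\<close>: the two orders differ by a factor \<open>q\<^sup>k\<close>, which produces Lambert
  series, while the change from \<open>x\<close> to \<open>z\<close> produces Bernoulli numbers; together these form Eisenstein
  series. All traces converge, because by the same recursion the character satisfies a differential
  equation whose coefficients converge in the unit disc.

  The weight operator of the square bracket grading is \<open>\<Sum> a[-k] a[k]\<close>. Insert it on one side of the
  Casimir sum and alternate the two rules: \<open>a[k]\<close> passes to the other torus as a creation operator,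
  is contracted there into annihilation operators \<open>a[l]\<close>, which pass back, and so on, until the
  travelling operator is contracted with \<open>a[-k]\<close>. This traces out a chequered cycle rooted at a node
  of label \<open>k\<close> and collects its weight (\<open>casimir_recursion\<close>). Starting on either torus and taking
  the average of the results,
    \<open>\<epsilon> d/d\<epsilon> Z\<^sup>(\<^sup>2\<^sup>) = 1/2 (\<Sum> k\<^sub>1 \<zeta>(M)) Z\<^sup>(\<^sup>2\<^sup>)\<close>,
  where \<open>M\<close> ranges over all rooted chequered cycles and \<open>k\<^sub>1\<close> is the label of the root (\<open>genus_two_ode\<close>).

  Every rooted cycle is a power \<open>N\<^sup>r\<close> of a unique rotationless one, and the root labels of the rotations
  of \<open>N\<close> add up to the exponent \<open>|N|\<close> of \<open>\<epsilon>\<close> in \<open>\<zeta>(N)\<close>. Hence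
    \<open>\<Sum> k\<^sub>1 \<zeta>(M) = \<Sum>\<^sub>N \<Sum>\<^sub>r |N| \<zeta>(N)\<^sup>r = - \<epsilon> d/d\<epsilon> \<Sum>\<^sub>N log (1 - \<zeta>(N))\<close>,
  where \<open>N\<close> ranges over the classes of rotationless cycles (\<open>sum_over_classes\<close>). So both sides of the theorem
  satisfy the same differential equation of first order, and they agree at \<open>\<epsilon> = 0\<close>.
\<close>

section \<open>Expansion in the coordinate \<open>e\<^sup>z - 1\<close>\<close>

definition vanishes_below :: "int \<Rightarrow> 'b::zero fls \<Rightarrow> bool" where
  "vanishes_below N f \<longleftrightarrow> (\<forall>i<N. fls_nth f i = 0)"

lemma vanishes_below_imp_subdegree:
  assumes "vanishes_below N f" and "f \<noteq> 0"
  shows "N \<le> fls_subdegree f"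
  using assms unfolding vanishes_below_def by (meson fls_subdegree_geI)

lemma vanishes_below_times:
  fixes f h :: "complex fls"
  assumes "vanishes_below N f" and "vanishes_below M h"
  shows "vanishes_below (N + M) (f * h)"
proof (cases "f = 0 \<or> h = 0")
  case False
  then have "N + M \<le> fls_subdegree f + fls_subdegree h"
    using assms vanishes_below_imp_subdegree by (metis add_mono)
  then show ?thesis
    unfolding vanishes_below_def by (auto intro!: fls_times_nth_eq0)
qed (auto simp: vanishes_below_def)

lemma leading_coeff_times:
  fixes f h :: "complex fls"
  assumes "vanishes_below N f" and "vanishes_below M h"
  shows "fls_nth (f * h) (N + M) = fls_nth f N * fls_nth h M"
proof (cases "f = 0 \<or> h = 0")
  case False
  then have le: "N \<le> fls_subdegree f" "M \<le> fls_subdegree h"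
    using assms vanishes_below_imp_subdegree by metis+
  show ?thesis
  proof (cases "N = fls_subdegree f \<and> M = fls_subdegree h")
    case True
    then show ?thesis by (simp add: fls_times_nth(2))
  next
    case False
    with le have "fls_nth f N = 0 \<or> fls_nth h M = 0"
      by (auto intro: fls_eq0_below_subdegree)
    moreover have "fls_nth (f * h) (N + M) = 0"
      using False le by (intro fls_times_nth_eq0) auto
    ultimately show ?thesis by auto
  qed
qed auto

text \<open>
  \<open>expm1 = e\<^sup>z - 1\<close>. The square bracket modes are the coefficients of a vertex operator in the
  coordinate \<open>z\<close>, the original modes those in \<open>x = e\<^sup>z - 1\<close>; relations between the two
  are relations between expansions of Laurent series in \<open>z\<close> and in \<open>x\<close>.
\<close>

definition expm1 :: "complex fls" where
  "expm1 = fps_to_fls (fps_exp 1 - 1)"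

lemma expm1_nth: "fls_nth expm1 i = (if i \<ge> 1 then 1 / fact (nat i) else 0)"
  by (auto simp: expm1_def fps_to_fls_nth)

lemma expm1_nz [simp]: "expm1 \<noteq> 0"
  using expm1_nth[of 1] by auto

lemma expm1_subdegree [simp]: "fls_subdegree expm1 = 1"
  by (rule fls_subdegree_eqI) (auto simp: expm1_nth)

lemma exp_eq_expm1: "fps_to_fls (fps_exp 1) = 1 + expm1"
  by (simp add: expm1_def)

lemma deriv_expm1: "fls_deriv expm1 = 1 + expm1"
  by (simp add: expm1_def fls_deriv_fps_to_fls)

lemma expm1_powi_vanishes: "vanishes_below n (expm1 powi n)"
  unfolding vanishes_below_def by (auto intro!: fls_eq0_below_subdegree)

text \<open>
  The leading coefficient of a product is the product of the leading coefficients, so natural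
  powers follow by induction, and negative ones because \<open>x\<^sup>-\<^sup>n x\<^sup>n = 1\<close>.
\<close>

lemma expm1_powi_leading: "fls_nth (expm1 powi n) n = 1"
proof -
  have one: "fls_nth (expm1 powi (-k)) (-k) * fls_nth (expm1 powi k) k = 1" for k
    using leading_coeff_times[OF expm1_powi_vanishes[of "-k"] expm1_powi_vanishes[of k]]
    by (simp add: power_int_minus)
  have nat: "fls_nth (expm1 powi int k) (int k) = 1" for k
  proof (induction k)
    case (Suc k)
    have "fls_nth (expm1 * expm1 ^ k) (1 + int k) = fls_nth expm1 1 * fls_nth (expm1 ^ k) (int k)"
      using leading_coeff_times[OF expm1_powi_vanishes[of 1] expm1_powi_vanishes[of "int k"]] by simp
    with Suc show ?case by (simp add: expm1_nth power_int_add)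
  qed simp
  show ?thesis
  proof (cases "n \<ge> 0")
    case True
    then show ?thesis using nat[of "nat n"] by simp
  next
    case False
    then show ?thesis using nat[of "nat (-n)"] one[of "-n"] by simp
  qed
qed

lemma expm1_powi_add: "expm1 powi i * expm1 powi j = expm1 powi (i + j)"
  by (simp add: power_int_add)

lemma deriv_expm1_powi: "fls_deriv (expm1 powi n) = of_int n * expm1 powi (n - 1) * (1 + expm1)"
proof (cases "n \<ge> 0")
  case True
  then obtain k where k: "n = int k" using nonneg_int_cases by blast
  have "fls_deriv (expm1 ^ k) = of_nat k * expm1 ^ (k - 1) * (1 + expm1)"
    by (simp only: fls_deriv_power deriv_expm1)
  then show ?thesis
    using k by (cases k) (simp_all del: fls_deriv_mult power_Suc add: power_int_def nat_add_distrib)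
next
  case False
  define k where "k = nat (-n)"
  have k: "n = - int k" using False by (simp add: k_def)
  have "k > 0" using False by (simp add: k_def)
  have "fls_deriv (inverse (expm1 ^ k)) = - inverse (expm1 ^ k) * (of_nat k * expm1 ^ (k - 1) * (1 + expm1)) * inverse (expm1 ^ k)"
    by (simp only: fls_inverse_deriv_divring fls_deriv_power deriv_expm1)
  also have "\<dots> = - of_nat k * (inverse (expm1 ^ k) * expm1 ^ (k - 1) * inverse (expm1 ^ k)) * (1 + expm1)"
    by (simp add: algebra_simps)
  also have "inverse (expm1 ^ k) * expm1 ^ (k - 1) * inverse (expm1 ^ k) = expm1 powi (- int k - 1)"
  proof -
    have "expm1 powi (- int k) * expm1 powi (int k - 1) * expm1 powi (- int k) = expm1 powi (- int k - 1)"
      by (simp only: expm1_powi_add) (rule arg_cong[where f = "power_int expm1"], simp)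
    moreover have "expm1 powi (int k - 1) = expm1 ^ (k - 1)"
      using \<open>k > 0\<close> by (simp add: power_int_def nat_diff_distrib)
    ultimately show ?thesis by (simp add: power_int_minus)
  qed
  finally show ?thesis using k by (simp add: power_int_minus)
qed

text \<open>
  The coefficient of \<open>x\<^sup>j\<close> in the expansion of \<open>f\<close> in powers of \<open>x = e\<^sup>z - 1\<close>, namely
  \<open>Res\<^sub>x f x\<^sup>-\<^sup>j\<^sup>-\<^sup>1 dx\<close>, written as a residue in \<open>z\<close>; the factor \<open>1 + x\<close> is \<open>dx/dz\<close>.
\<close>

definition expm1_coeff :: "complex fls \<Rightarrow> int \<Rightarrow> complex" where
  "expm1_coeff f j = fls_nth (f * expm1 powi (- j - 1) * (1 + expm1)) (-1)"

lemma expm1_coeff_add: "expm1_coeff (f + h) j = expm1_coeff f j + expm1_coeff h j"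
  by (simp add: expm1_coeff_def algebra_simps)

lemma expm1_coeff_zero [simp]: "expm1_coeff 0 j = 0"
  by (simp add: expm1_coeff_def)

lemma expm1_coeff_diff: "expm1_coeff (f - h) j = expm1_coeff f j - expm1_coeff h j"
  by (simp add: expm1_coeff_def algebra_simps)

lemma expm1_coeff_const: "expm1_coeff (fls_const c * f) j = c * expm1_coeff f j"
  by (simp add: expm1_coeff_def mult.assoc)

lemma expm1_coeff_sum: "expm1_coeff (sum f A) j = (\<Sum>i\<in>A. expm1_coeff (f i) j)"
  by (induction A rule: infinite_finite_induct) (simp_all add: expm1_coeff_add)

lemma one_plus_expm1_vanishes: "vanishes_below 0 (1 + expm1)"
  by (auto simp: vanishes_below_def expm1_nth)

lemma expm1_coeff_eq_0:
  assumes "vanishes_below N f" and "j < N"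
  shows "expm1_coeff f j = 0"
proof -
  have "vanishes_below (N + (-j-1) + 0) (f * expm1 powi (- j - 1) * (1 + expm1))"
    by (intro vanishes_below_times assms expm1_powi_vanishes one_plus_expm1_vanishes)
  then show ?thesis using assms(2) by (auto simp: expm1_coeff_def vanishes_below_def)
qed

lemma expm1_coeff_leading:
  assumes "vanishes_below N f"
  shows "expm1_coeff f N = fls_nth f N"
proof -
  have v: "vanishes_below (N + (-N-1)) (f * expm1 powi (- N - 1))"
    by (intro vanishes_below_times assms expm1_powi_vanishes)
  have "fls_nth (f * expm1 powi (- N - 1) * (1 + expm1)) (N + (-N-1) + 0)
      = fls_nth (f * expm1 powi (- N - 1)) (N + (-N-1)) * fls_nth (1 + expm1) 0"
    by (rule leading_coeff_times[OF v one_plus_expm1_vanishes])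
  also have "fls_nth (f * expm1 powi (- N - 1)) (N + (-N-1)) = fls_nth f N"
    by (simp only: leading_coeff_times[OF assms expm1_powi_vanishes] expm1_powi_leading mult_1_right)
  finally show ?thesis by (simp add: expm1_coeff_def expm1_nth)
qed

text \<open>
  The residue of the derivative of \<open>f x\<^sup>-\<^sup>j\<^sup>-\<^sup>1\<close> is zero.
\<close>

lemma expm1_coeff_deriv:
  "of_int (j + 1) * expm1_coeff f (j + 1) = fls_nth (fls_deriv f * expm1 powi (- j - 1)) (-1)"
proof -
  have "0 = fls_nth (fls_deriv (f * expm1 powi (- j - 1))) (-1)"
    by (simp only: fls_deriv_residue)
  also have "fls_deriv (f * expm1 powi (- j - 1)) =
      fls_deriv f * expm1 powi (- j - 1) - of_int (j + 1) * (f * expm1 powi (- (j + 1) - 1) * (1 + expm1))"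
    by (simp only: fls_deriv_mult deriv_expm1_powi) (simp add: algebra_simps)
  finally show ?thesis
    unfolding expm1_coeff_def by (simp only: fls_minus_nth fls_mult_of_int_nth mult.assoc) simp
qed


text \<open>
  For \<open>i \<noteq> j\<close> the form \<open>x\<^sup>i\<^sup>-\<^sup>j\<^sup>-\<^sup>1 dx\<close> is exact.
\<close>

lemma expm1_coeff_expm1_powi: "expm1_coeff (expm1 powi i) j = (if i = j then 1 else 0)"
proof -
  have "expm1_coeff (expm1 powi i) j = fls_nth (expm1 powi (i - j - 1) * (1 + expm1)) (-1)"
    unfolding expm1_coeff_def expm1_powi_add by (simp add: algebra_simps)
  also have "\<dots> = (if i = j then 1 else 0)"
  proof (cases "i = j")
    case True
    have "fls_nth (expm1 powi (-1) * (1 + expm1)) (-1 + 0) = fls_nth (expm1 powi (-1)) (-1) * fls_nth (1 + expm1) 0"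
      by (rule leading_coeff_times[OF expm1_powi_vanishes one_plus_expm1_vanishes])
    also have "\<dots> = 1"
      unfolding expm1_powi_leading by (simp add: expm1_nth)
    finally show ?thesis using True by simp
  next
    case False
    have "of_int (i - j) * fls_nth (expm1 powi (i - j - 1) * (1 + expm1)) (-1)
        = fls_nth (fls_deriv (expm1 powi (i - j))) (-1)"
      unfolding deriv_expm1_powi mult.assoc fls_mult_of_int_nth ..
    then show ?thesis using False by (simp add: fls_deriv_residue)
  qed
  finally show ?thesis .
qed

text \<open>
  The coefficients really expand \<open>f\<close>: subtracting \<open>c x\<^sup>K\<close>, with \<open>c\<close> the leading coefficient of the
  remainder, raises the order of the remainder, and orthogonality of the powers of \<open>x\<close> identifies
  \<open>c\<close> with the coefficient of \<open>f\<close>.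
\<close>

lemma expm1_expansion:
  assumes "vanishes_below N f"
  shows "vanishes_below (N + int n) (f - (\<Sum>j\<in>{N..<N + int n}. fls_const (expm1_coeff f j) * expm1 powi j))"
proof (induction n)
  case (Suc n)
  let ?K = "N + int n"
  define r where "r = f - (\<Sum>j\<in>{N..<?K}. fls_const (expm1_coeff f j) * expm1 powi j)"
  have v: "vanishes_below ?K r" using Suc by (simp add: r_def)
  have "expm1_coeff r ?K = expm1_coeff f ?K - (\<Sum>j\<in>{N..<?K}. expm1_coeff f j * (if j = ?K then 1 else 0))"
    by (simp add: r_def expm1_coeff_diff expm1_coeff_sum expm1_coeff_const expm1_coeff_expm1_powi)
  also have "(\<Sum>j\<in>{N..<?K}. expm1_coeff f j * (if j = ?K then 1 else 0)) = 0"
    by (rule sum.neutral) auto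
  finally have c: "expm1_coeff f ?K = fls_nth r ?K" using expm1_coeff_leading[OF v] by simp
  have "{N..<N + int (Suc n)} = insert ?K {N..<?K}" by auto
  then have eq: "f - (\<Sum>j\<in>{N..<N + int (Suc n)}. fls_const (expm1_coeff f j) * expm1 powi j)
      = r - fls_const (expm1_coeff f ?K) * expm1 powi ?K"
    by (simp add: r_def)
  have "fls_nth (r - fls_const (expm1_coeff f ?K) * expm1 powi ?K) i = 0" if "i < ?K + 1" for i
  proof (cases "i = ?K")
    case True
    then show ?thesis by (simp add: c expm1_powi_leading)
  next
    case False
    then show ?thesis using that v expm1_powi_vanishes[of ?K] by (simp add: vanishes_below_def)
  qed
  then show ?case unfolding eq by (simp add: vanishes_below_def ac_simps)
qed (use assms in simp)

text \<open>
  Replace \<open>h\<close> by its expansion in powers of \<open>x\<close>; the remainder has too high an order to matter. The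
  summation range may be enlarged, so that one range can serve several products at once.
\<close>

lemma expm1_coeff_mult:
  assumes f: "vanishes_below P f" and h: "vanishes_below N h"
    and lo: "L \<le> N" and hi: "p - P \<le> U"
  shows "expm1_coeff (f * h) p = (\<Sum>j=L..U. expm1_coeff h j * expm1_coeff f (p - j))"
proof -
  \<comment> \<open>The expansion is continued past the end of the summation range.\<close>
  define n where "n = nat (max (U + 1) N - N)"
  define K where "K = N + int n"
  have K: "K > U" "K \<ge> N" by (auto simp: K_def n_def)
  define r where "r = h - (\<Sum>j\<in>{N..<K}. fls_const (expm1_coeff h j) * expm1 powi j)"
  have v: "vanishes_below K r" unfolding r_def K_def by (rule expm1_expansion[OF h])
  have hsplit: "h = (\<Sum>j\<in>{N..<K}. fls_const (expm1_coeff h j) * expm1 powi j) + r" by (simp add: r_def)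
  have shift: "expm1_coeff (f * expm1 powi j) p = expm1_coeff f (p - j)" for j
  proof -
    have "f * expm1 powi j * expm1 powi (- p - 1) = f * expm1 powi (- (p - j) - 1)"
      unfolding mult.assoc expm1_powi_add by (simp add: algebra_simps)
    then show ?thesis by (simp only: expm1_coeff_def)
  qed
  have "expm1_coeff (f * h) p = expm1_coeff (\<Sum>j\<in>{N..<K}. fls_const (expm1_coeff h j) * (f * expm1 powi j)) p
      + expm1_coeff (f * r) p"
    by (subst hsplit) (simp add: distrib_left sum_distrib_left expm1_coeff_add algebra_simps)
  also have "expm1_coeff (f * r) p = 0"
    by (rule expm1_coeff_eq_0[OF vanishes_below_times[OF f v]]) (use K hi in auto)
  also have "expm1_coeff (\<Sum>j\<in>{N..<K}. fls_const (expm1_coeff h j) * (f * expm1 powi j)) p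
      = (\<Sum>j\<in>{N..<K}. expm1_coeff h j * expm1_coeff f (p - j))"
    by (simp add: expm1_coeff_sum expm1_coeff_const shift)
  also have "\<dots> = (\<Sum>j\<in>{L..<K}. expm1_coeff h j * expm1_coeff f (p - j))"
    using lo by (intro sum.mono_neutral_left) (auto intro: expm1_coeff_eq_0[OF h])
  also have "\<dots> = (\<Sum>j=L..U. expm1_coeff h j * expm1_coeff f (p - j))"
    using K hi by (intro sum.mono_neutral_right) (auto intro: expm1_coeff_eq_0[OF f])
  finally show ?thesis by simp
qed

text \<open>
  The number with \<open>z\<^sup>n = \<Sum>\<^sub>j sq_coeff n j (e\<^sup>z - 1)\<^sup>j\<close>. For \<open>n \<ge> 0\<close> this is \<open>n!/j!\<close> times a signed
  Stirling number of the first kind; for negative \<open>n\<close> and \<open>j = 0\<close> it is a Bernoulli number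
  divided by a factorial.
\<close>

definition sq_coeff :: "int \<Rightarrow> int \<Rightarrow> complex" where
  "sq_coeff n j = expm1_coeff (fls_X_intpow n) j"

lemma X_intpow_vanishes: "vanishes_below n (fls_X_intpow n :: complex fls)"
  by (auto simp: vanishes_below_def)

lemma sq_coeff_eq: "sq_coeff n j = fls_nth (expm1 powi (- j - 1) * fps_to_fls (fps_exp 1)) (- n - 1)"
  unfolding sq_coeff_def expm1_coeff_def exp_eq_expm1 mult.assoc
  unfolding fls_X_intpow_times_conv_shift fls_shift_nth
  by (rule arg_cong[where f = "fls_nth (expm1 powi (- j - 1) * (1 + expm1))"]) simp

lemma sq_coeff_below [simp]: "j < n \<Longrightarrow> sq_coeff n j = 0"
  unfolding sq_coeff_def by (rule expm1_coeff_eq_0[OF X_intpow_vanishes])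

lemma sq_coeff_diag [simp]: "sq_coeff n n = 1"
  unfolding sq_coeff_def by (simp add: expm1_coeff_leading[OF X_intpow_vanishes])

lemma sq_coeff_0: "sq_coeff 0 j = (if j = 0 then 1 else 0)"
  using expm1_coeff_expm1_powi[of 0 j] by (simp add: sq_coeff_def)

lemma intpow_mult: "fls_X_intpow i * fls_X_intpow j = (fls_X_intpow (i + j) :: complex fls)"
  by (simp only: fls_X_intpow_times_conv_shift fls_shift_fls_shift) simp

lemma deriv_X_intpow: "fls_deriv (fls_X_intpow n :: complex fls) = of_int n * fls_X_intpow (n - 1)"
  by (rule fls_deriv_X_intpow)

text \<open>
  Compare coefficients of \<open>x\<^sup>j\<close> in \<open>(1 + x) d/dx z\<^sup>n = n z\<^sup>n\<^sup>-\<^sup>1\<close>.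
\<close>

lemma sq_coeff_rec:
  "of_int (j + 1) * sq_coeff n (j + 1) + of_int j * sq_coeff n j = of_int n * sq_coeff (n - 1) j"
proof -
  let ?f = "fls_deriv (fls_X_intpow n :: complex fls)"
  have "of_int (j + 1) * sq_coeff n (j + 1) = fls_nth (?f * expm1 powi (- j - 1)) (-1)"
    unfolding sq_coeff_def by (rule expm1_coeff_deriv)
  moreover have "of_int j * sq_coeff n j = fls_nth (?f * expm1 powi (- j)) (-1)"
    using expm1_coeff_deriv[of "j - 1" "fls_X_intpow n"] by (simp add: sq_coeff_def)
  moreover have "?f * expm1 powi (- j - 1) + ?f * expm1 powi (- j) = ?f * (expm1 powi (- j - 1) * (1 + expm1))"
  proof -
    have "expm1 powi (- j) = expm1 powi (- j - 1) * expm1"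
      using expm1_powi_add[of "- j - 1" 1] by simp
    then show ?thesis by (simp only:) (simp add: algebra_simps)
  qed
  moreover have "fls_nth (?f * (expm1 powi (- j - 1) * (1 + expm1))) (-1) = of_int n * sq_coeff (n - 1) j"
    unfolding deriv_X_intpow
    by (simp only: mult.assoc fls_mult_of_int_nth) (simp add: sq_coeff_def expm1_coeff_def mult.assoc)
  ultimately show ?thesis by (metis fls_plus_nth)
qed

text \<open>
  The left-hand side is the coefficient of \<open>x\<^sup>p\<close> in \<open>h \<cdot> d(z\<^sup>n)/dx\<close>, since \<open>j sq_coeff n j\<close> is the
  coefficient of \<open>x\<^sup>j\<^sup>-\<^sup>1\<close> in \<open>d(z\<^sup>n)/dx\<close>; the right-hand side is the same coefficient as a
  residue in \<open>z\<close>.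
\<close>

lemma sq_coeff_deriv_mult:
  assumes h: "vanishes_below N h" and lo: "L \<le> n" and hi: "p - N + 1 \<le> U"
  shows "(\<Sum>j=L..U. of_int j * sq_coeff n j * expm1_coeff h (p - j + 1))
    = of_int n * fls_nth (h * fls_X_intpow (n - 1) * expm1 powi (- p - 1)) (-1)"
proof -
  let ?d = "fls_deriv (fls_X_intpow n :: complex fls)"
  have u: "1 + expm1 \<noteq> 0"
    by (metis add_cancel_right_left fls_zero_nth fls_plus_nth fls_one_nth expm1_nth not_one_le_zero zero_neq_one)
  have inv: "vanishes_below 0 (inverse (1 + expm1))"
  proof -
    have "fls_subdegree (1 + expm1) = 0"
      by (rule fls_subdegree_eqI) (auto simp: expm1_nth)
    then have "fls_subdegree (inverse (1 + expm1)) = 0" by simp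
    then show ?thesis unfolding vanishes_below_def by auto
  qed
  define e where "e = ?d * inverse (1 + expm1)"
  have ec: "expm1_coeff e j = of_int (j + 1) * sq_coeff n (j + 1)" for j
  proof -
    have "e * expm1 powi (- j - 1) * (1 + expm1) = ?d * expm1 powi (- j - 1) * (inverse (1 + expm1) * (1 + expm1))"
      unfolding e_def by (simp only: ac_simps)
    then show ?thesis
      unfolding sq_coeff_def expm1_coeff_deriv left_inverse[OF u]
      by (simp only: expm1_coeff_def[of e] mult_1_right)
  qed
  have "vanishes_below (n - 1 + 0) e"
    unfolding e_def by (intro vanishes_below_times inv) (auto simp: vanishes_below_def)
  then have ev: "vanishes_below (n - 1) e" by simp
  have "(\<Sum>j=L..U. of_int j * sq_coeff n j * expm1_coeff h (p - j + 1))
     = (\<Sum>j=L-1..U-1. expm1_coeff e j * expm1_coeff h (p - j))"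
    by (rule sum.reindex_bij_witness[of _ "\<lambda>j. j + 1" "\<lambda>j. j - 1"]) (auto simp: ec algebra_simps)
  also have "\<dots> = expm1_coeff (h * e) p"
    by (rule expm1_coeff_mult[OF h ev, symmetric]) (use lo hi in auto)
  also have "\<dots> = fls_nth (h * ?d * expm1 powi (- p - 1)) (-1)"
  proof -
    have "h * e * expm1 powi (- p - 1) * (1 + expm1) = h * ?d * expm1 powi (- p - 1) * (inverse (1 + expm1) * (1 + expm1))"
      unfolding e_def by (simp only: ac_simps)
    then show ?thesis unfolding expm1_coeff_def left_inverse[OF u] by (simp only: mult_1_right)
  qed
  also have "\<dots> = of_int n * fls_nth (h * fls_X_intpow (n - 1) * expm1 powi (- p - 1)) (-1)"
  proof -
    have "h * ?d * expm1 powi (- p - 1) = of_int n * (h * fls_X_intpow (n - 1) * expm1 powi (- p - 1))"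
      unfolding deriv_X_intpow by (simp only: ac_simps)
    then show ?thesis by (simp only: fls_mult_of_int_nth)
  qed
  finally show ?thesis .
qed

text \<open>
  \<open>Res\<^sub>z z\<^sup>m d(z\<^sup>n)\<close> computed in the coordinate \<open>x\<close>: this makes the square bracket modes satisfy
  the same commutation relations as the original ones.
\<close>

lemma sq_coeff_commutator:
  assumes "L \<le> n" and "- m \<le> U"
  shows "(\<Sum>j=L..U. of_int j * sq_coeff n j * sq_coeff m (- j)) = (if m = - n then of_int n else 0)"
proof -
  have "(\<Sum>j=L..U. of_int j * sq_coeff n j * expm1_coeff (fls_X_intpow m) (- 1 - j + 1))
    = of_int n * fls_nth (fls_X_intpow m * fls_X_intpow (n - 1) * expm1 powi (- (- 1) - 1)) (-1)"
    by (rule sq_coeff_deriv_mult[OF X_intpow_vanishes]) (use assms in auto)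
  then show ?thesis
    unfolding intpow_mult by (auto simp: sq_coeff_def)
qed

text \<open>
  The coefficients of \<open>L[k]\<close> with respect to the modes of the conformal vector: the conformal vector has weight two,
  so in \<open>Y[\<omega>,z] = e\<^sup>2\<^sup>z Y(\<omega>,x)\<close> the mode \<open>\<omega>(j)\<close> has the coefficient \<open>e\<^sup>2\<^sup>z x\<^sup>-\<^sup>j\<^sup>-\<^sup>1\<close>.
\<close>

definition vir_coeff :: "int \<Rightarrow> int \<Rightarrow> complex" where
  "vir_coeff k j = expm1_coeff (fls_X_intpow (k + 1) * (1 + expm1)) j"

lemma vir_vanishes: "vanishes_below (k + 1) (fls_X_intpow (k + 1) * (1 + expm1))"
  using vanishes_below_times[OF X_intpow_vanishes[of "k+1"] one_plus_expm1_vanishes] by simp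

lemma vir_coeff_eq: "vir_coeff k j = fls_nth (expm1 powi (- j - 1) * fps_to_fls (fps_exp 2)) (- (k + 1) - 1)"
proof -
  have "fps_to_fls (fps_exp 2) = fps_to_fls (fps_exp 1) * fps_to_fls (fps_exp 1 :: complex fps)"
    by (simp add: fls_times_fps_to_fls [symmetric] fps_exp_add_mult [symmetric])
  also have "\<dots> = (1 + expm1) * (1 + expm1)" by (simp add: exp_eq_expm1)
  finally have e: "fps_to_fls (fps_exp 2) = (1 + expm1) * (1 + expm1)" .
  have "vir_coeff k j = fls_nth (fls_X_intpow (k + 1) * (expm1 powi (- j - 1) * fps_to_fls (fps_exp 2))) (-1)"
    unfolding vir_coeff_def expm1_coeff_def e by (simp only: ac_simps)
  also have "\<dots> = fls_nth (expm1 powi (- j - 1) * fps_to_fls (fps_exp 2)) (- (k + 1) - 1)"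
    by (simp only: fls_X_intpow_times_conv_shift fls_shift_nth) simp
  finally show ?thesis .
qed

lemma vir_coeff_below: "j < k + 1 \<Longrightarrow> vir_coeff k j = 0"
  unfolding vir_coeff_def by (rule expm1_coeff_eq_0[OF vir_vanishes])

text \<open>
  In terms of vector fields: \<open>z\<^sup>k\<^sup>+\<^sup>1 d/dz\<close> maps \<open>z\<^sup>n\<close> to \<open>n z\<^sup>n\<^sup>+\<^sup>k\<close>.
\<close>

lemma vir_coeff_commutator:
  assumes "L \<le> n" and "p - k \<le> U"
  shows "(\<Sum>j=L..U. of_int j * sq_coeff n j * vir_coeff k (p - j + 1)) = of_int n * sq_coeff (n + k) p"
proof -
  have "(\<Sum>j=L..U. of_int j * sq_coeff n j * expm1_coeff (fls_X_intpow (k + 1) * (1 + expm1)) (p - j + 1))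
    = of_int n * fls_nth (fls_X_intpow (k + 1) * (1 + expm1) * fls_X_intpow (n - 1) * expm1 powi (- p - 1)) (-1)"
    by (rule sq_coeff_deriv_mult[OF vir_vanishes]) (use assms in auto)
  also have "fls_X_intpow (k + 1) * (1 + expm1) * fls_X_intpow (n - 1) * expm1 powi (- p - 1)
     = (fls_X_intpow (k + 1) * fls_X_intpow (n - 1)) * expm1 powi (- p - 1) * (1 + expm1)"
    by (simp only: ac_simps)
  also have "fls_X_intpow (k + 1) * fls_X_intpow (n - 1) = (fls_X_intpow (n + k) :: complex fls)"
    by (simp only: intpow_mult) (simp add: algebra_simps)
  finally show ?thesis by (simp add: vir_coeff_def sq_coeff_def expm1_coeff_def)
qed

text \<open>
  Expanding \<open>x\<^sup>j\<close> in powers of \<open>z\<close> and these again in powers of \<open>x\<close> returns \<open>x\<^sup>j\<close>. Only finitely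
  many powers of \<open>z\<close> affect the coefficient of \<open>x\<^sup>i\<close>.
\<close>

lemma sq_coeff_inverse:
  assumes "i < j + int n"
  shows "(\<Sum>m\<in>{j..<j + int n}. fls_nth (expm1 powi j) m * sq_coeff m i) = (if i = j then 1 else 0)"
proof -
  let ?r = "expm1 powi j - (\<Sum>m\<in>{j..<j + int n}. fls_const (fls_nth (expm1 powi j) m) * fls_X_intpow m)"
  have "vanishes_below (j + int n) ?r"
    unfolding vanishes_below_def
  proof (intro allI impI)
    fix l assume l: "l < j + int n"
    have "(\<Sum>m\<in>{j..<j + int n}. fls_nth (expm1 powi j) m * (if l = m then 1 else 0))
      = (if l \<in> {j..<j + int n} then fls_nth (expm1 powi j) l else 0)"
      by (simp add: if_distrib[of "\<lambda>c. _ * c"] cong: if_cong)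
    then show "fls_nth ?r l = 0"
      using l expm1_powi_vanishes[of j] by (auto simp: fls_nth_sum vanishes_below_def)
  qed
  then have "expm1_coeff ?r i = 0" using assms by (rule expm1_coeff_eq_0)
  then show ?thesis
    by (simp add: expm1_coeff_diff expm1_coeff_sum expm1_coeff_const expm1_coeff_expm1_powi sq_coeff_def) (auto split: if_splits)
qed


section \<open>Polynomial identities for the expansion coefficients\<close>

text \<open>
  The coefficient of \<open>x\<^sup>i\<close> in \<open>e\<^sup>y\<^sup>z = (1 + x)\<^sup>y\<close>.
\<close>

lemma sum_power_sq_coeff:
  fixes y :: complex
  assumes "i \<le> M"
  shows "(\<Sum>m\<le>M. y ^ m / fact m * sq_coeff (int m) (int i)) = y gchoose i"
  using assms
proof (induction i arbitrary: M)
  case 0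
  have "(\<Sum>m\<le>M. y ^ m / fact m * sq_coeff (int m) 0) = (\<Sum>m\<in>{0}. y ^ m / fact m * sq_coeff (int m) 0)"
    by (rule sum.mono_neutral_right) auto
  then show ?case by (simp add: sq_coeff_0)
next
  case (Suc i)
  obtain M' where M: "M = Suc M'" "i \<le> M'" using Suc.prems by (cases M) auto
  have rec: "of_nat (Suc i) * sq_coeff (int m) (int (Suc i)) = of_nat m * sq_coeff (int m - 1) (int i) - of_nat i * sq_coeff (int m) (int i)" for m
    using sq_coeff_rec[of "int i" "int m"] by (simp add: algebra_simps)
  have "of_nat (Suc i) * (\<Sum>m\<le>M. y ^ m / fact m * sq_coeff (int m) (int (Suc i)))
     = (\<Sum>m\<le>M. y ^ m / fact m * (of_nat m * sq_coeff (int m - 1) (int i) - of_nat i * sq_coeff (int m) (int i)))"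
    unfolding sum_distrib_left rec [symmetric] by (simp add: mult_ac)
  also have "\<dots> = (\<Sum>m\<le>M. y ^ m / fact m * of_nat m * sq_coeff (int m - 1) (int i))
      - of_nat i * (\<Sum>m\<le>M. y ^ m / fact m * sq_coeff (int m) (int i))"
    by (simp add: sum_subtractf sum_distrib_left algebra_simps)
  also have "(\<Sum>m\<le>M. y ^ m / fact m * of_nat m * sq_coeff (int m - 1) (int i))
      = y * (\<Sum>m\<le>M'. y ^ m / fact m * sq_coeff (int m) (int i))"
  proof -
    have "y ^ Suc m / fact (Suc m) * of_nat (Suc m) = y * (y ^ m / fact m)" for m
      by (simp del: of_nat_Suc add: fact_Suc)
    then show ?thesis
      unfolding M sum.atMost_Suc_shift sum_distrib_left
      by (simp only:) (simp add: mult.assoc)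
  qed
  finally have "of_nat (Suc i) * (\<Sum>m\<le>M. y ^ m / fact m * sq_coeff (int m) (int (Suc i))) = y * (y gchoose i) - of_nat i * (y gchoose i)"
    using Suc.IH[of M'] Suc.IH[of M] M by simp
  also have "\<dots> = of_nat (Suc i) * (y gchoose Suc i)"
    by (simp add: gbinomial_mult_1)
  finally show ?case
    by (metis mult_cancel_left of_nat_eq_0_iff nat.distinct(1))
qed

text \<open>
  The coefficient of \<open>z\<^sup>n\<close> in \<open>e\<^sup>z (1 + x)\<^sup>y\<^sup>-\<^sup>1 = e\<^sup>y\<^sup>z\<close>, because \<open>sq_coeff (- n - 1) (- s - 1)\<close> is the
  coefficient of \<open>z\<^sup>n\<close> in \<open>e\<^sup>z x\<^sup>s\<close>.
\<close>

lemma sum_sq_coeff_gbinomial: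
  fixes y :: complex
  shows "(\<Sum>s\<le>n. sq_coeff (- int (Suc n)) (- int (Suc s)) * ((y - 1) gchoose s)) = y ^ n / fact n"
proof (induction n)
  case (Suc n)
  let ?g = "\<lambda>n s. sq_coeff (- int (Suc n)) (- int (Suc s))"
  have rec: "of_nat (Suc n) * ?g (Suc n) s = of_nat (Suc s) * ?g n s + of_nat s * sq_coeff (- int (Suc n)) (- int s)" for s
    using sq_coeff_rec[of "- int (Suc s)" "- int (Suc n)"] by (simp add: algebra_simps)
  have "of_nat (Suc n) * (\<Sum>s\<le>Suc n. ?g (Suc n) s * ((y - 1) gchoose s))
     = (\<Sum>s\<le>Suc n. (of_nat (Suc s) * ?g n s + of_nat s * sq_coeff (- int (Suc n)) (- int s)) * ((y - 1) gchoose s))"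
    unfolding sum_distrib_left rec [symmetric] by (simp add: mult_ac)
  also have "\<dots> = (\<Sum>s\<le>Suc n. of_nat (Suc s) * ?g n s * ((y - 1) gchoose s))
      + (\<Sum>s\<le>Suc n. of_nat s * sq_coeff (- int (Suc n)) (- int s) * ((y - 1) gchoose s))"
    by (simp add: sum.distrib algebra_simps)
  also have "(\<Sum>s\<le>Suc n. of_nat (Suc s) * ?g n s * ((y - 1) gchoose s)) = (\<Sum>s\<le>n. of_nat (Suc s) * ?g n s * ((y - 1) gchoose s))"
    by simp
  also have "(\<Sum>s\<le>Suc n. of_nat s * sq_coeff (- int (Suc n)) (- int s) * ((y - 1) gchoose s))
     = (\<Sum>s\<le>n. ?g n s * (of_nat (Suc s) * ((y - 1) gchoose Suc s)))"
    unfolding sum.atMost_Suc_shift by (simp add: mult_ac)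
  also have "(\<Sum>s\<le>n. of_nat (Suc s) * ?g n s * ((y - 1) gchoose s)) + \<dots>
     = (\<Sum>s\<le>n. y * (?g n s * ((y - 1) gchoose s)))"
  proof -
    have "of_nat (Suc s) * ((y - 1) gchoose Suc s) = (y - 1) * ((y - 1) gchoose s) - of_nat s * ((y - 1) gchoose s)" for s
      by (simp add: gbinomial_mult_1)
    then show ?thesis
      unfolding sum.distrib [symmetric] by (simp only:) (simp add: algebra_simps)
  qed
  also have "\<dots> = y * (y ^ n / fact n)"
    using Suc by (simp add: sum_distrib_left [symmetric])
  also have "\<dots> = of_nat (Suc n) * (y ^ Suc n / fact (Suc n))"
    by (simp add: fact_Suc del: of_nat_Suc)
  finally show ?case
    by (metis mult_cancel_left of_nat_eq_0_iff nat.distinct(1))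
qed simp

text \<open>
  The coefficient of \<open>t\<^sup>m z\<^sup>n\<^sup>-\<^sup>1\<close> in the regular part of \<open>1 / (1 - e\<^sup>t\<^sup>-\<^sup>z)\<close>: the constant term of the
  kernel in Zhu's recursion.
\<close>

definition bern_coeff :: "nat \<Rightarrow> nat \<Rightarrow> complex" where
  "bern_coeff n m = (-1) ^ m * of_nat ((m + n - 1) choose m) * sq_coeff (- int (n + m)) 0"

lemma bern_coeff_rec:
  assumes "n \<ge> 1"
  shows "bern_coeff n (Suc m) * of_nat (Suc m) = - of_nat n * bern_coeff (Suc n) m"
proof -
  have "((m + n) choose Suc m) * Suc m = n * ((m + n) choose m)"
    using choose_mult_lemma[of 0 m n] binomial_absorb_comp[of "m+n" m] binomial_absorption[of m "m + n"]
    by (metis add_diff_cancel_left' binomial_absorb_comp binomial_absorption mult.commute add.commute)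
  then have "of_nat ((m + n) choose Suc m) * of_nat (Suc m) = (of_nat n * of_nat ((m + n) choose m) :: complex)"
    by (metis of_nat_mult)
  moreover have "bern_coeff n (Suc m) * of_nat (Suc m)
      = (-1) ^ Suc m * (of_nat ((m + n) choose Suc m) * of_nat (Suc m)) * sq_coeff (- int (n + Suc m)) 0"
    by (simp add: bern_coeff_def)
  ultimately show ?thesis
    by (simp add: bern_coeff_def)
qed

text \<open>
  This rewrites the annihilating part of \<open>a[-n]\<close> in terms of the modes \<open>a[m]\<close> with \<open>m \<ge> 0\<close>.
  Both sides satisfy the same recursion in \<open>j\<close>.
\<close>

lemma sum_bern_coeff:
  assumes "j \<le> M" and "n \<ge> 1"
  shows "(\<Sum>m\<le>M. bern_coeff n m * sq_coeff (int m) (int j)) = sq_coeff (- int n) (int j)"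
  using assms
proof (induction j arbitrary: M n)
  case 0
  have "(\<Sum>m\<le>M. bern_coeff n m * sq_coeff (int m) 0) = (\<Sum>m\<in>{0}. bern_coeff n m * sq_coeff (int m) 0)"
    by (rule sum.mono_neutral_right) auto
  then show ?case by (simp add: sq_coeff_0 bern_coeff_def)
next
  case (Suc j)
  obtain M' where M: "M = Suc M'" "j \<le> M'" using Suc.prems by (cases M) auto
  have rec: "of_nat (Suc j) * sq_coeff (int m) (int (Suc j)) = of_nat m * sq_coeff (int m - 1) (int j) - of_nat j * sq_coeff (int m) (int j)" for m
    using sq_coeff_rec[of "int j" "int m"] by (simp add: algebra_simps)
  have "of_nat (Suc j) * (\<Sum>m\<le>M. bern_coeff n m * sq_coeff (int m) (int (Suc j)))
     = (\<Sum>m\<le>M. bern_coeff n m * (of_nat m * sq_coeff (int m - 1) (int j) - of_nat j * sq_coeff (int m) (int j)))"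
    unfolding sum_distrib_left rec [symmetric] by (simp add: mult_ac)
  also have "\<dots> = (\<Sum>m\<le>M. bern_coeff n m * of_nat m * sq_coeff (int m - 1) (int j))
      - of_nat j * (\<Sum>m\<le>M. bern_coeff n m * sq_coeff (int m) (int j))"
    by (simp add: sum_subtractf sum_distrib_left algebra_simps)
  also have "(\<Sum>m\<le>M. bern_coeff n m * of_nat m * sq_coeff (int m - 1) (int j))
      = (\<Sum>m\<le>M'. (bern_coeff n (Suc m) * of_nat (Suc m)) * sq_coeff (int m) (int j))"
    unfolding M sum.atMost_Suc_shift by simp
  also have "\<dots> = - of_nat n * (\<Sum>m\<le>M'. bern_coeff (Suc n) m * sq_coeff (int m) (int j))"
    unfolding bern_coeff_rec[OF Suc.prems(2)] by (simp add: sum_distrib_left mult_ac)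
  finally have "of_nat (Suc j) * (\<Sum>m\<le>M. bern_coeff n m * sq_coeff (int m) (int (Suc j)))
      = - of_nat n * sq_coeff (- int (Suc n)) (int j) - of_nat j * sq_coeff (- int n) (int j)"
    using Suc.IH[of M' "Suc n"] Suc.IH[of M n] M Suc.prems by simp
  also have "\<dots> = of_nat (Suc j) * sq_coeff (- int n) (int (Suc j))"
  proof -
    have "- int (Suc n) = - int n - 1" by simp
    then show ?thesis
      using sq_coeff_rec[of "int j" "- int n"] by (simp only:) (simp add: algebra_simps)
  qed
  finally show ?case
    by (metis mult_cancel_left of_nat_eq_0_iff nat.distinct(1))
qed

section \<open>Bernoulli numbers as expansion coefficients\<close>

definition bern_fps :: "complex fps" where
  "bern_fps = fps_X / (fps_exp 1 - 1)"

lemma bern_fps_mult: "bern_fps * (fps_exp 1 - 1) = fps_X"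
proof -
  have nz: "(fps_exp 1 - 1 :: complex fps) \<noteq> 0"
    by (metis fps_zero_to_fls expm1_def expm1_nz)
  have "subdegree (fps_exp 1 - 1 :: complex fps) = 1"
    by (rule subdegreeI) auto
  then have "fps_exp 1 - 1 dvd (fps_X :: complex fps)"
    using nz by (subst fps_dvd_iff) auto
  then show ?thesis by (simp add: bern_fps_def)
qed

text \<open>
  \<open>sq_coeff (-n) 0\<close> is the coefficient of \<open>z\<^sup>n\<^sup>-\<^sup>1\<close> in \<open>e\<^sup>z / (e\<^sup>z - 1) = 1 + 1 / (e\<^sup>z - 1)\<close>.
\<close>

lemma sq_coeff_bernoulli:
  assumes "n \<ge> 2"
  shows "sq_coeff (- int n) 0 = bernoulli_number n / fact n"
proof -
  have "fps_to_fls bern_fps * expm1 = fls_X"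
    unfolding expm1_def fls_times_fps_to_fls [symmetric] bern_fps_mult by simp
  then have b: "fls_X * inverse expm1 = fps_to_fls bern_fps"
    by (metis expm1_nz mult.assoc mult_1_right right_inverse)
  have "sq_coeff (- int n) 0 = fls_nth (inverse expm1 + 1) (int n - 1)"
    by (simp add: sq_coeff_eq exp_eq_expm1 distrib_left power_int_minus)
  also have "\<dots> = fls_nth (fls_X * inverse expm1) (int n)"
    using assms by (simp add: fls_X_times_conv_shift)
  also have "\<dots> = fps_nth bern_fps n" unfolding b by simp
  finally show ?thesis by (simp add: bernoulli_number_def bern_fps_def)
qed

text \<open>
  With \<open>b(z) = z / (e\<^sup>z - 1)\<close> one has \<open>b(-z) = b(z) e\<^sup>z = b(z) + z\<close>, so apart from the linear term
  \<open>b\<close> is even.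
\<close>

lemma bernoulli_odd:
  assumes "odd n" and "n \<ge> 2"
  shows "sq_coeff (- int n) 0 = 0"
proof -
  let ?m = "fps_const (-1) * fps_X :: complex fps"
  have m0: "fps_nth ?m 0 = 0" by simp
  have E: "fps_exp (-1) * fps_exp 1 = (1 :: complex fps)"
    by (simp add: fps_exp_add_mult [symmetric])
  have "(bern_fps oo ?m) * (fps_exp (-1) - 1) = - fps_X"
    using arg_cong[OF bern_fps_mult, of "\<lambda>f. f oo ?m"]
    by (simp add: fps_compose_mult_distrib[OF m0] fps_compose_sub_distrib fps_exp_compose_linear del: fps_const_neg)
  moreover have "fps_exp (-1) - 1 = - fps_exp (-1) * (fps_exp 1 - 1 :: complex fps)"
    using E by (simp add: algebra_simps)
  ultimately have "(bern_fps oo ?m) * fps_exp (-1) * (fps_exp 1 - 1) = bern_fps * (fps_exp 1 - 1)"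
    by (simp add: bern_fps_mult mult.assoc)
  moreover have "(fps_exp 1 - 1 :: complex fps) \<noteq> 0"
    by (metis fps_zero_to_fls expm1_def expm1_nz)
  ultimately have "(bern_fps oo ?m) * fps_exp (-1) = bern_fps"
    by simp
  then have "bern_fps oo ?m = bern_fps * fps_exp 1"
    using E by (metis mult.assoc mult_1_right)
  also have "\<dots> = bern_fps * (fps_exp 1 - 1) + bern_fps"
    by (simp add: algebra_simps)
  also have "\<dots> = fps_X + bern_fps" unfolding bern_fps_mult ..
  finally have "(-1) ^ n * fps_nth bern_fps n = fps_nth fps_X n + fps_nth bern_fps n"
    unfolding fps_compose_linear by (metis fps_add_nth fps_nth_Abs_fps)
  then have "fps_nth bern_fps n = 0" using assms by simp
  then show ?thesis
    using assms by (simp add: sq_coeff_bernoulli bernoulli_number_def bern_fps_def)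
qed

section \<open>Linear algebra and modes in a vertex operator algebra\<close>

context vertex_operator_algebra
begin

sublocale vs: vector_space "smult V"
  by (rule vector_space)

abbreviation lin :: "('v \<Rightarrow> 'v) \<Rightarrow> bool" where
  "lin \<equiv> Vector_Spaces.linear (smult V) (smult V)"

lemma linI:
  assumes "\<And>x y. f (x + y) = f x + f y" and "\<And>c x. f (smult V c x) = smult V c (f x)"
  shows "lin f"
  using assms vector_space by (simp add: Vector_Spaces.linear_iff)

lemma lin_add: "lin f \<Longrightarrow> f (x + y) = f x + f y"
  and lin_scale: "lin f \<Longrightarrow> f (smult V c x) = smult V c (f x)"
  by (simp_all add: Vector_Spaces.linear_iff)

lemma lin_zero: "lin f \<Longrightarrow> f 0 = 0"
  using lin_add[of f 0 0] by simp

lemma lin_neg: "lin f \<Longrightarrow> f (- x) = - f x"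
  using lin_add[of f x "- x"] lin_zero[of f] by (simp add: add_eq_0_iff)

lemma lin_diff: "lin f \<Longrightarrow> f (x - y) = f x - f y"
  using lin_add[of f x "- y"] lin_neg[of f y] by simp

lemma lin_sum: "lin f \<Longrightarrow> f (sum g A) = (\<Sum>i\<in>A. f (g i))"
  by (induction A rule: infinite_finite_induct) (simp_all add: lin_add lin_zero)

lemmas mode_add = mode_linear_right[THEN lin_add] mode_linear_left[THEN lin_add]
lemmas mode_zero [simp] = mode_linear_right[THEN lin_zero] mode_linear_left[THEN lin_zero]
lemmas mode_scale = mode_linear_right[THEN lin_scale] mode_linear_left[THEN lin_scale]

lemma Lop_lin: "lin (Lop V n)"
  unfolding Lop_def by (rule mode_linear_right)

text \<open>
  The Borcherds identity with \<open>l = 0\<close>, where only \<open>i = 0\<close> survives on the right.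
\<close>

lemma mode_commutator:
  "mode V u m (mode V v n w) - mode V v n (mode V u m w) =
    Sum_any (\<lambda>i::nat. smult V (of_int m gchoose i) (mode V (mode V u (int i) v) (m + n - int i) w))"
proof -
  have "Sum_any (\<lambda>i::nat. smult V ((-1) ^ i * (of_int 0 gchoose i))
         (mode V u (m + 0 - int i) (mode V v (n + int i) w)
          - smult V ((-1) powi 0) (mode V v (n + 0 - int i) (mode V u (m + int i) w))))
      = (\<Sum>i\<in>{0::nat}. smult V ((-1) ^ i * (of_int 0 gchoose i))
         (mode V u (m + 0 - int i) (mode V v (n + int i) w)
          - smult V ((-1) powi 0) (mode V v (n + 0 - int i) (mode V u (m + int i) w))))"
    by (rule Sum_any.expand_superset) (auto simp: gbinomial_0_left)
  then show ?thesis using borcherds_identity[of m u 0 v n w] by simp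
qed

text \<open>
  The Borcherds identity with \<open>m = 0\<close>, where only \<open>i = 0\<close> survives on the left.
\<close>

lemma mode_associator:
  "mode V (mode V u l v) n w = Sum_any (\<lambda>i::nat. smult V ((-1) ^ i * (of_int l gchoose i))
         (mode V u (l - int i) (mode V v (n + int i) w)
          - smult V ((-1) powi l) (mode V v (n + l - int i) (mode V u (int i) w))))"
proof -
  have "Sum_any (\<lambda>i::nat. smult V (of_int 0 gchoose i) (mode V (mode V u (l + int i) v) (0 + n - int i) w))
     = (\<Sum>i\<in>{0::nat}. smult V (of_int 0 gchoose i) (mode V (mode V u (l + int i) v) (0 + n - int i) w))"
    by (rule Sum_any.expand_superset) (auto simp: gbinomial_0_left)
  then show ?thesis using borcherds_identity[of 0 u l v n w] by simp
qed

lemma mode_commutator_finite: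
  assumes "\<And>i. i > M \<Longrightarrow> mode V u (int i) v = 0"
  shows "mode V u m (mode V v n w) - mode V v n (mode V u m w) =
    (\<Sum>i\<le>M. smult V (of_int m gchoose i) (mode V (mode V u (int i) v) (m + n - int i) w))"
  unfolding mode_commutator
  by (rule Sum_any.expand_superset) (use assms in \<open>auto simp: not_less [symmetric]\<close>)

section \<open>Weight spaces and zero modes\<close>

text \<open>
  Applying \<open>L - m\<close> to the sum removes the eigenvector for \<open>m\<close> and rescales each of the others by a
  nonzero factor, so induction on the number of eigenvalues applies.
\<close>

lemma eigen_sum_zero:
  assumes L: "lin L" and "finite A" and "\<And>k. k \<in> A \<Longrightarrow> L (f k) = smult V (of_int k) (f k)"
    and "sum f A = 0" and "k \<in> A"
  shows "f k = 0"
  using assms(2-)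
proof (induction A arbitrary: f k rule: finite_induct)
  case (insert m A)
  define h where "h k = smult V (of_int (k - m)) (f k)" for k
  have "L (sum f (insert m A)) = 0"
    using insert.prems by (simp add: lin_zero[OF L])
  then have "(\<Sum>k\<in>insert m A. smult V (of_int k) (f k)) = 0"
    using insert.prems(1) by (simp add: lin_sum[OF L])
  moreover have "(\<Sum>k\<in>insert m A. smult V (of_int m) (f k)) = 0"
    using insert.prems(2) by (simp only: vs.scale_sum_right [symmetric]) simp
  ultimately have "(\<Sum>k\<in>insert m A. h k) = 0"
    by (simp only: h_def of_int_diff vs.scale_left_diff_distrib sum_subtractf) simp
  then have "sum h A = 0" using insert.hyps by (simp add: h_def)
  moreover have "L (h k) = smult V (of_int k) (h k)" if "k \<in> A" for k
    using that insert.prems(1)[of k] by (simp add: h_def lin_scale[OF L] mult.commute)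
  ultimately have h0: "h k = 0" if "k \<in> A" for k
    using insert.IH[of h] that by blast
  have f0: "f k = 0" if "k \<in> A" for k
  proof -
    have "k \<noteq> m" using that insert.hyps by auto
    then show ?thesis using h0[OF that] by (simp add: h_def)
  qed
  have "f m = 0" using insert.prems(2) insert.hyps f0 by simp
  with f0 insert.prems(3) show ?case by auto
qed auto

text \<open>
  Group an expansion of \<open>v\<close> in the eigenvectors by eigenvalue; eigenvectors for different
  eigenvalues being independent, only the group for \<open>k\<close> remains.
\<close>

lemma eigenspace_span:
  assumes L: "lin L" and eig: "\<And>e. e \<in> E \<Longrightarrow> L e = smult V (of_int (wt e)) e"
    and span: "vs.span E = UNIV" and v: "L v = smult V (of_int k) v"
  shows "v \<in> vs.span {e \<in> E. wt e = k}"
proof -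
  have "v \<in> vs.span E" using span by simp
  then obtain T r where T: "finite T" "T \<subseteq> E" and vT: "v = (\<Sum>e\<in>T. smult V (r e) e)"
    unfolding vs.span_explicit by auto
  define f where "f j = (\<Sum>e\<in>{e\<in>T. wt e = j}. smult V (r e) e)" for j
  define A where "A = insert k (wt ` T)"
  have "finite A" using T by (simp add: A_def)
  have v_eq: "v = sum f A"
    unfolding vT f_def using T \<open>finite A\<close> by (subst sum.group) (auto simp: A_def)
  have Lf: "L (f j) = smult V (of_int j) (f j)" for j
    unfolding f_def lin_sum[OF L] vs.scale_sum_right
    by (intro sum.cong refl) (use T in \<open>auto simp: lin_scale[OF L] eig mult.commute subset_iff\<close>)
  define g where "g j = f j - (if j = k then v else 0)" for j
  have "sum g A = 0"
    using v_eq \<open>finite A\<close> by (simp add: g_def sum_subtractf sum.delta A_def)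
  moreover have "L (g j) = smult V (of_int j) (g j)" for j
    using Lf v by (auto simp: g_def lin_diff[OF L] lin_zero[OF L] vs.scale_right_diff_distrib)
  moreover have "k \<in> A" by (simp add: A_def)
  ultimately have "g k = 0"
    using eigen_sum_zero[OF L \<open>finite A\<close>, of g k] by blast
  then have "v = f k" by (simp add: g_def)
  also have "\<dots> \<in> vs.span {e \<in> E. wt e = k}"
    unfolding f_def using T by (intro vs.span_sum vs.span_scale vs.span_base) auto
  finally show ?thesis .
qed

lemma weight_subspace: "vs.subspace (weight_space V k)"
  unfolding weight_space_def
  by (rule vs.subspaceI) (auto simp: lin_zero[OF Lop_lin] lin_add[OF Lop_lin] lin_scale[OF Lop_lin] vs.scale_right_distrib mult.commute)

lemmas weight_add = vs.subspace_add[OF weight_subspace]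
lemmas weight_scale = vs.subspace_scale[OF weight_subspace]
lemmas weight_sum = vs.subspace_sum[OF weight_subspace]
lemmas weight_zero [simp] = vs.subspace_0[OF weight_subspace]
lemmas weight_diff = vs.subspace_diff[OF weight_subspace]

lemma homogeneous_decomposition:
  "\<exists>f. finite {k. f k \<noteq> 0} \<and> (\<forall>k. f k \<in> weight_space V k) \<and> Sum_any f = v"
proof -
  define P where "P v f \<longleftrightarrow> finite {k. f k \<noteq> 0} \<and> (\<forall>k. f k \<in> weight_space V k) \<and> Sum_any f = v" for v :: 'v and f :: "int \<Rightarrow> 'v"
  have "v \<in> vs.span (\<Union>k. weight_space V k)" using grading_spans by simp
  then have "\<exists>f. P v f"
  proof (induction rule: vs.span_induct_alt)
    case base
    have "P 0 (\<lambda>_. 0)" by (simp add: P_def)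
    then show ?case by blast
  next
    case (step c x y)
    then obtain f j where f: "P y f" and x: "x \<in> weight_space V j" by auto
    define h where "h k = (if k = j then smult V c x else 0)" for k
    have fh: "finite {k. h k \<noteq> 0}" by (rule finite_subset[of _ "{j}"]) (auto simp: h_def)
    have hw: "h k \<in> weight_space V k" for k using x by (simp add: h_def weight_scale)
    have "Sum_any h = smult V c x" unfolding h_def by (rule Sum_any.delta)
    moreover have "finite {k. h k + f k \<noteq> 0}"
      by (rule finite_subset[of _ "{k. h k \<noteq> 0} \<union> {k. f k \<noteq> 0}"]) (use fh f in \<open>auto simp: P_def\<close>)
    ultimately have "P (smult V c x + y) (\<lambda>k. h k + f k)"
      using f fh hw by (auto simp: P_def Sum_any.distrib intro: weight_add)
    then show ?case by blast
  qed
  then show ?thesis unfolding P_def .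
qed

lemma homogeneous_unique:
  assumes "finite {k. f k \<noteq> 0}" "\<And>k. f k \<in> weight_space V k"
    and "finite {k. h k \<noteq> 0}" "\<And>k. h k \<in> weight_space V k"
    and "Sum_any f = Sum_any h"
  shows "f = h"
proof (rule ext)
  fix k
  define A where "A = insert k ({k. f k \<noteq> 0} \<union> {k. h k \<noteq> 0})"
  have "finite A" using assms by (simp add: A_def)
  have "Sum_any f = sum f A" "Sum_any h = sum h A"
    using \<open>finite A\<close> by (auto intro!: Sum_any.expand_superset simp: A_def)
  then have "(\<Sum>j\<in>A. f j - h j) = 0" using assms(5) by (simp add: sum_subtractf)
  moreover have "Lop V 0 (f j - h j) = smult V (of_int j) (f j - h j)" for j
    using weight_diff[OF assms(2)[of j] assms(4)[of j]] by (simp only: weight_space_def mem_Collect_eq)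
  moreover have "k \<in> A" by (simp add: A_def)
  ultimately have "f k - h k = 0"
    using eigen_sum_zero[OF Lop_lin[of 0] \<open>finite A\<close>, of "\<lambda>j. f j - h j" k] by blast
  then show "f k = h k" by simp
qed

lemma homogeneous_part_eqI:
  assumes "finite {k. f k \<noteq> 0}" "\<And>k. f k \<in> weight_space V k" "Sum_any f = v"
  shows "homogeneous_part V v = f"
  unfolding homogeneous_part_def
  by (rule the_equality) (use assms homogeneous_unique in blast)+

lemma homogeneous_part:
  "finite {k. homogeneous_part V v k \<noteq> 0}" "homogeneous_part V v k \<in> weight_space V k"
  "Sum_any (homogeneous_part V v) = v"
  using homogeneous_decomposition[of v] homogeneous_part_eqI by metis+

lemma homogeneous_part_add:
  "homogeneous_part V (u + v) = (\<lambda>k. homogeneous_part V u k + homogeneous_part V v k)"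
proof (rule homogeneous_part_eqI)
  show "finite {k. homogeneous_part V u k + homogeneous_part V v k \<noteq> 0}"
    by (rule finite_subset[of _ "{k. homogeneous_part V u k \<noteq> 0} \<union> {k. homogeneous_part V v k \<noteq> 0}"])
      (auto simp: homogeneous_part)
  show "Sum_any (\<lambda>k. homogeneous_part V u k + homogeneous_part V v k) = u + v"
    by (subst Sum_any.distrib) (auto simp: homogeneous_part)
qed (auto intro: weight_add simp: homogeneous_part)

lemma homogeneous_part_scale:
  "homogeneous_part V (smult V c v) = (\<lambda>k. smult V c (homogeneous_part V v k))"
proof (rule homogeneous_part_eqI)
  let ?A = "{k. homogeneous_part V v k \<noteq> 0}"
  have "finite ?A" by (rule homogeneous_part)
  show "finite {k. smult V c (homogeneous_part V v k) \<noteq> 0}"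
    by (rule finite_subset[of _ ?A]) (auto simp: homogeneous_part)
  have "Sum_any (\<lambda>k. smult V c (homogeneous_part V v k)) = (\<Sum>k\<in>?A. smult V c (homogeneous_part V v k))"
    by (rule Sum_any.expand_superset[OF \<open>finite ?A\<close>]) auto
  also have "\<dots> = smult V c (Sum_any (homogeneous_part V v))"
    by (simp add: vs.scale_sum_right Sum_any.expand_set)
  finally show "Sum_any (\<lambda>k. smult V c (homogeneous_part V v k)) = smult V c v"
    by (simp add: homogeneous_part)
qed (auto intro: weight_scale simp: homogeneous_part)

lemma homogeneous_part_weight:
  assumes "v \<in> weight_space V k"
  shows "homogeneous_part V v = (\<lambda>j. if j = k then v else 0)"
proof (rule homogeneous_part_eqI)
  show "finite {j. (if j = k then v else 0) \<noteq> 0}" by (rule finite_subset[of _ "{k}"]) auto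
qed (use assms in auto)

lemma zero_mode_finite: "finite {k. mode V (homogeneous_part V v k) (k - 1) w \<noteq> 0}"
  by (rule finite_subset[OF _ homogeneous_part(1)[of v]]) auto

lemma zero_mode_weight: "v \<in> weight_space V k \<Longrightarrow> zero_mode V v w = mode V v (k - 1) w"
proof -
  assume v: "v \<in> weight_space V k"
  have "zero_mode V v w = Sum_any (\<lambda>j. if j = k then mode V v (j - 1) w else 0)"
    unfolding zero_mode_def homogeneous_part_weight[OF v] by (rule Sum_any.cong) simp
  then show ?thesis by simp
qed

lemma zero_mode_add: "zero_mode V (u + v) w = zero_mode V u w + zero_mode V v w"
  unfolding zero_mode_def homogeneous_part_add mode_add
  by (rule Sum_any.distrib[OF zero_mode_finite zero_mode_finite])

lemma zero_mode_scale: "zero_mode V (smult V c v) w = smult V c (zero_mode V v w)"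
proof -
  let ?A = "{k. mode V (homogeneous_part V v k) (k - 1) w \<noteq> 0}"
  have "zero_mode V (smult V c v) w = (\<Sum>k\<in>?A. smult V c (mode V (homogeneous_part V v k) (k - 1) w))"
    unfolding zero_mode_def homogeneous_part_scale mode_scale
    by (rule Sum_any.expand_superset[OF zero_mode_finite]) auto
  then show ?thesis
    by (simp add: zero_mode_def vs.scale_sum_right Sum_any.expand_set)
qed

lemma Lop_commutator:
  assumes "v \<in> weight_space V k"
  shows "Lop V 0 (mode V v n w) - mode V v n (Lop V 0 w) = smult V (of_int (k - n - 1)) (mode V v n w)"
proof -
  have "Lop V 0 (mode V v n w) - mode V v n (Lop V 0 w)
     = Sum_any (\<lambda>i::nat. smult V (of_int 1 gchoose i) (mode V (mode V (conformal V) (int i) v) (1 + n - int i) w))"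
    unfolding Lop_def by (simp only: mode_commutator) simp
  also have "\<dots> = (\<Sum>i\<in>{0::nat,1}. smult V (of_int 1 gchoose i) (mode V (mode V (conformal V) (int i) v) (1 + n - int i) w))"
  proof (rule Sum_any.expand_superset)
    have "(1 gchoose i :: complex) = 0" if "i \<notin> {0,1}" for i
    proof -
      have "1 choose i = 0" using that by (intro binomial_eq_0) auto
      then show ?thesis by (metis binomial_gbinomial of_nat_0 of_nat_1)
    qed
    then show "{i::nat. smult V (of_int 1 gchoose i) (mode V (mode V (conformal V) (int i) v) (1 + n - int i) w) \<noteq> 0} \<subseteq> {0,1}"
      by auto
  qed simp
  also have "\<dots> = mode V (Lop V (-1) v) (1 + n) w + mode V (Lop V 0 v) n w"
    by (simp add: Lop_def)
  also have "\<dots> = smult V (of_int (k - n - 1)) (mode V v n w)"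
    using assms by (simp add: translation weight_space_def mode_scale vs.scale_left_distrib [symmetric])
  finally show ?thesis .
qed

lemma mode_weight:
  assumes "v \<in> weight_space V k" and "w \<in> weight_space V N"
  shows "mode V v n w \<in> weight_space V (N + k - n - 1)"
proof -
  have "Lop V 0 (mode V v n w) = smult V (of_int (k - n - 1)) (mode V v n w) + mode V v n (Lop V 0 w)"
    using Lop_commutator[OF assms(1)] by (metis diff_add_cancel)
  also have "mode V v n (Lop V 0 w) = smult V (of_int N) (mode V v n w)"
    using assms(2) by (simp add: weight_space_def mode_scale)
  also have "smult V (of_int (k - n - 1)) (mode V v n w) + \<dots> = smult V (of_int (k - n - 1) + of_int N) (mode V v n w)"
    by (simp only: vs.scale_left_distrib)
  also have "of_int (k - n - 1) + of_int N = (of_int (N + k - n - 1) :: complex)" by simp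
  finally show ?thesis by (simp only: weight_space_def mem_Collect_eq)
qed

lemma zero_mode_preserves:
  assumes "w \<in> weight_space V N"
  shows "zero_mode V v w \<in> weight_space V N"
proof -
  have "mode V (homogeneous_part V v k) (k - 1) w \<in> weight_space V N" for k
    using mode_weight[OF homogeneous_part(2) assms, of v k "k - 1"] by (simp add: algebra_simps)
  then show ?thesis unfolding zero_mode_def Sum_any.expand_set by (intro weight_sum)
qed

section \<open>Traces on weight spaces\<close>

text \<open>
  The basis that the definition of the trace chooses. The traces below are computed in this basis,
  and \<open>wtrace_cyclic\<close> compares the bases chosen on two weight spaces.
\<close>

definition wbasis :: "int \<Rightarrow> 'v set" where
  "wbasis N = (SOME S. is_basis_of V (weight_space V N) S)"

lemma wbasis: "vs.independent (wbasis N)" "vs.span (wbasis N) = weight_space V N" "finite (wbasis N)"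
proof -
  obtain S where "S \<subseteq> weight_space V N" "vs.independent S" "weight_space V N \<subseteq> vs.span S"
    using vs.maximal_independent_subset by blast
  then have "is_basis_of V (weight_space V N) S"
    unfolding is_basis_of_def using vs.span_minimal[OF _ weight_subspace] by blast
  then have b: "is_basis_of V (weight_space V N) (wbasis N)"
    unfolding wbasis_def by (rule someI)
  then show i: "vs.independent (wbasis N)" and s: "vs.span (wbasis N) = weight_space V N"
    by (simp_all add: is_basis_of_def)
  obtain T where "finite T" "weight_space V N \<subseteq> vs.span T"
    using finite_dimensional by blast
  then show "finite (wbasis N)"
    using vs.independent_span_bound[OF \<open>finite T\<close> i] s vs.span_superset by blast
qed

lemma wbasis_weight: "b \<in> wbasis N \<Longrightarrow> b \<in> weight_space V N"
  using wbasis(2) vs.span_base by blast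

definition wtrace :: "int \<Rightarrow> ('v \<Rightarrow> 'v) \<Rightarrow> complex" where
  "wtrace N f = (\<Sum>b\<in>wbasis N. vs.representation (wbasis N) (f b) b)"

lemma trace_on_weight: "trace_on V (weight_space V N) f = wtrace N f"
  by (simp add: trace_on_def wtrace_def wbasis_def Let_def)

lemma wtrace_cong: "(\<And>w. w \<in> weight_space V N \<Longrightarrow> f w = g w) \<Longrightarrow> wtrace N f = wtrace N g"
  unfolding wtrace_def by (intro sum.cong refl) (simp add: wbasis_weight)

lemma wtrace_add:
  assumes "\<And>w. w \<in> weight_space V N \<Longrightarrow> f w \<in> weight_space V N"
    and "\<And>w. w \<in> weight_space V N \<Longrightarrow> g w \<in> weight_space V N"
  shows "wtrace N (\<lambda>w. f w + g w) = wtrace N f + wtrace N g"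
  unfolding wtrace_def sum.distrib [symmetric]
  by (intro sum.cong refl) (simp add: vs.representation_add[OF wbasis(1)] wbasis(2) assms wbasis_weight)

lemma wtrace_scale:
  assumes "\<And>w. w \<in> weight_space V N \<Longrightarrow> f w \<in> weight_space V N"
  shows "wtrace N (\<lambda>w. smult V c (f w)) = c * wtrace N f"
  unfolding wtrace_def sum_distrib_left
  by (intro sum.cong refl) (simp add: vs.representation_scale[OF wbasis(1)] wbasis(2) assms wbasis_weight)

lemma wtrace_zero: "wtrace N (\<lambda>w. 0) = 0"
  by (simp add: wtrace_def vs.representation_zero)

lemma wtrace_diff:
  assumes f: "\<And>w. w \<in> weight_space V N \<Longrightarrow> f w \<in> weight_space V N"
    and g: "\<And>w. w \<in> weight_space V N \<Longrightarrow> g w \<in> weight_space V N"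
  shows "wtrace N (\<lambda>w. f w - g w) = wtrace N f - wtrace N g"
proof -
  have "wtrace N (\<lambda>w. f w - g w) = wtrace N (\<lambda>w. f w + smult V (-1) (g w))"
    by simp
  also have "\<dots> = wtrace N f + wtrace N (\<lambda>w. smult V (-1) (g w))"
    by (rule wtrace_add[OF f]) (simp_all only: weight_scale[OF g])
  also have "\<dots> = wtrace N f - wtrace N g"
    by (subst wtrace_scale[OF g]) auto
  finally show ?thesis .
qed

lemma wtrace_sum:
  assumes "\<And>i w. i \<in> A \<Longrightarrow> w \<in> weight_space V N \<Longrightarrow> f i w \<in> weight_space V N"
  shows "wtrace N (\<lambda>w. \<Sum>i\<in>A. f i w) = (\<Sum>i\<in>A. wtrace N (f i))"
  using assms
proof (induction A rule: infinite_finite_induct)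
  case (insert i A)
  have "wtrace N (\<lambda>w. f i w + (\<Sum>i\<in>A. f i w)) = wtrace N (f i) + wtrace N (\<lambda>w. \<Sum>i\<in>A. f i w)"
    by (rule wtrace_add) (use insert.prems in \<open>auto intro: weight_sum\<close>)
  then show ?case using insert by simp
qed (simp_all add: wtrace_zero)

lemma wbasis_expansion:
  assumes "w \<in> weight_space V N"
  shows "w = (\<Sum>b\<in>wbasis N. smult V (vs.representation (wbasis N) w b) b)"
  using assms wbasis by (intro vs.sum_representation_eq[symmetric]) auto

text \<open>
  In terms of matrix entries with respect to the two chosen bases, both sides are the same double
  sum in different order.
\<close>

lemma wtrace_cyclic:
  assumes A: "lin A" "\<And>w. w \<in> weight_space V M \<Longrightarrow> A w \<in> weight_space V N"
    and B: "lin B" "\<And>w. w \<in> weight_space V N \<Longrightarrow> B w \<in> weight_space V M"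
  shows "wtrace N (\<lambda>w. A (B w)) = wtrace M (\<lambda>w. B (A w))"
proof -
  have expand: "wtrace N (\<lambda>w. A (B w)) = (\<Sum>b\<in>wbasis N. \<Sum>c\<in>wbasis M.
      vs.representation (wbasis M) (B b) c * vs.representation (wbasis N) (A c) b)"
    if A: "lin A" "\<And>w. w \<in> weight_space V M \<Longrightarrow> A w \<in> weight_space V N"
      and B: "\<And>w. w \<in> weight_space V N \<Longrightarrow> B w \<in> weight_space V M" for A B M N
    unfolding wtrace_def
  proof (rule sum.cong[OF refl], goal_cases)
    case b: (1 b)
    let ?r = "vs.representation (wbasis M) (B b)"
    have "A (B b) = A (\<Sum>c\<in>wbasis M. smult V (?r c) c)"
      by (rule arg_cong[where f = A, OF wbasis_expansion[OF B[OF wbasis_weight[OF b]]]])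
    also have "\<dots> = (\<Sum>c\<in>wbasis M. smult V (?r c) (A c))"
      by (simp add: lin_sum[OF A(1)] lin_scale[OF A(1)])
    finally have "vs.representation (wbasis N) (A (B b)) b
       = vs.representation (wbasis N) (\<Sum>c\<in>wbasis M. smult V (?r c) (A c)) b" by simp
    also have "\<dots> = (\<Sum>c\<in>wbasis M. vs.representation (wbasis N) (smult V (?r c) (A c)) b)"
    proof -
      have "smult V (?r c) (A c) \<in> vs.span (wbasis N)" if "c \<in> wbasis M" for c
        unfolding wbasis(2) by (rule weight_scale[OF A(2)[OF wbasis_weight[OF that]]])
      then show ?thesis
        by (simp only: vs.representation_sum[OF wbasis(1)])
    qed
    also have "\<dots> = (\<Sum>c\<in>wbasis M. ?r c * vs.representation (wbasis N) (A c) b)"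
    proof (rule sum.cong[OF refl], goal_cases)
      case c: (1 c)
      have "A c \<in> vs.span (wbasis N)"
        unfolding wbasis(2) by (rule A(2)[OF wbasis_weight[OF c]])
      then show ?case
        by (simp only: vs.representation_scale[OF wbasis(1)])
    qed
    finally show ?case .
  qed
  have "wtrace N (\<lambda>w. A (B w)) = (\<Sum>b\<in>wbasis N. \<Sum>c\<in>wbasis M.
      vs.representation (wbasis M) (B b) c * vs.representation (wbasis N) (A c) b)"
    by (rule expand[OF A(1) A(2) B(2)])
  also have "\<dots> = (\<Sum>c\<in>wbasis M. \<Sum>b\<in>wbasis N.
      vs.representation (wbasis N) (A c) b * vs.representation (wbasis M) (B b) c)"
    by (subst sum.swap) (simp add: mult.commute)
  also have "\<dots> = wtrace M (\<lambda>w. B (A w))"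
    by (rule expand[OF B(1) B(2) A(2), symmetric])
  finally show ?thesis .
qed

end

text \<open>
  The version of \<open>eigenspace_span\<close> for a family in which a vector may be listed more than once.
\<close>

lemma (in vertex_operator_algebra) eigenspace_span_indexed:
  assumes L: "lin L" and eig: "\<And>i. i \<in> I \<Longrightarrow> L (e i) = smult V (of_int (wt i)) (e i)"
    and span: "vs.span (e ` I) = UNIV" and v: "L v = smult V (of_int k) v"
  shows "v \<in> vs.span (e ` {i \<in> I. wt i = k})"
proof -
  define p where "p x = (SOME i. i \<in> I \<and> e i = x)" for x
  have p: "p x \<in> I \<and> e (p x) = x" if "x \<in> e ` I" for x
    unfolding p_def by (rule someI_ex) (use that in blast)
  have "v \<in> vs.span {x \<in> e ` I. wt (p x) = k}"
  proof (rule eigenspace_span[OF L _ span v])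
    fix x assume "x \<in> e ` I"
    then have px: "p x \<in> I" "e (p x) = x" using p by blast+
    show "L x = smult V (of_int (wt (p x))) x" using eig[OF px(1)] unfolding px(2) .
  qed
  moreover have "{x \<in> e ` I. wt (p x) = k} \<subseteq> e ` {i \<in> I. wt i = k}"
  proof
    fix x assume "x \<in> {x \<in> e ` I. wt (p x) = k}"
    then have "x \<in> e ` I" "wt (p x) = k" by simp_all
    with p[of x] have "e (p x) = x" "p x \<in> {i \<in> I. wt i = k}" by simp_all
    then show "x \<in> e ` {i \<in> I. wt i = k}" by (metis imageI)
  qed
  ultimately show ?thesis by (rule subsetD[OF vs.span_mono, rotated])
qed

lemma (in vertex_operator_algebra) lin_in_span:
  assumes "lin f" and "x \<in> vs.span S" and "\<And>s. s \<in> S \<Longrightarrow> f s \<in> vs.span T"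
  shows "f x \<in> vs.span T"
  using assms(2)
  by (induction rule: vs.span_induct_alt)
    (auto simp: lin_zero[OF assms(1)] lin_add[OF assms(1)] lin_scale[OF assms(1)]
      intro!: vs.span_add vs.span_scale vs.span_zero assms(3))

section \<open>The Heisenberg algebra\<close>

context heisenberg_voa
begin

abbreviation ar :: "int \<Rightarrow> 'v \<Rightarrow> 'v" where
  "ar n \<equiv> mode V a n"

lemma ar_commute: "ar m (ar n v) = ar n (ar m v) + (if m = - n then smult V (of_int m) v else 0)"
  using heisenberg_commutator[of m n v] by (simp only: diff_eq_eq add.commute)

lemma fock_span: "vs.span (fock_vector V a ` fock_indices) = UNIV"
  using fock_basis by (simp add: is_basis_of_def)

lemma fock_Nil [simp]: "fock_vector V a [] = vacuum V"
  and fock_Cons [simp]: "fock_vector V a (n # ns) = ar (- int n) (fock_vector V a ns)"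
  by (simp_all add: fock_vector_def)

text \<open>
  The mode \<open>a(0)\<close> is central and kills the vacuum, hence kills the Fock space.
\<close>

lemma ar_0 [simp]: "ar 0 v = 0"
proof -
  have "ar 0 (fock_vector V a ns) = 0" for ns
    by (induction ns) (simp_all add: creation(2) ar_commute[of 0])
  then have "ar 0 v \<in> vs.span {}"
    by (intro lin_in_span[OF mode_linear_right, of v "fock_vector V a ` fock_indices"])
      (auto simp: fock_span)
  then show ?thesis by simp
qed

lemma a_eq: "ar (-1) (vacuum V) = a"
  by (rule creation(1))

text \<open>
  Since \<open>\<omega> = a(-1)\<^sup>2 1 / 2\<close>, the mode \<open>a(1)\<close> acts on it as a derivative, and the modes \<open>a(i)\<close> for the
  other \<open>i \<ge> 0\<close> commute with \<open>a(-1)\<close> and kill the vacuum.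
\<close>

lemma ar_conformal:
  assumes "i \<ge> 0"
  shows "ar i (conformal V) = (if i = 1 then a else 0)"
proof (cases "i = 1")
  case True
  have "ar 1 (ar (-1) (ar (-1) (vacuum V))) = ar (-1) (ar 1 (ar (-1) (vacuum V))) + ar (-1) (vacuum V)"
    by (subst ar_commute) simp
  also have "ar 1 (ar (-1) (vacuum V)) = vacuum V"
    by (subst ar_commute) (simp add: creation(2))
  finally have "ar 1 (conformal V) = smult V (1/2) (a + a)"
    by (simp only: conformal_eq mode_scale a_eq)
  also have "a + a = smult V 2 a"
    using vs.scale_left_distrib[of 1 1 a] by simp
  finally show ?thesis using True by simp
next
  case False
  then show ?thesis
    using assms by (simp add: conformal_eq mode_scale ar_commute[of i] creation(2))
qed

text \<open>
  Commuting \<open>a(j)\<close> past \<open>\<omega>(k)\<close>, rather than the other way round, only requires the products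
  \<open>a(i) \<omega>\<close>, which the Heisenberg relations determine.
\<close>

lemma conformal_ar_commutator:
  "ar j (mode V (conformal V) k w) - mode V (conformal V) k (ar j w) = smult V (of_int j) (ar (j + k - 1) w)"
proof -
  have "ar j (mode V (conformal V) k w) - mode V (conformal V) k (ar j w)
     = (\<Sum>i\<le>1. smult V (of_int j gchoose i) (mode V (ar (int i) (conformal V)) (j + k - int i) w))"
    by (rule mode_commutator_finite) (simp add: ar_conformal)
  then show ?thesis by (simp add: ar_conformal)
qed

lemma conformal_ar_commute:
  "mode V (conformal V) k (ar j w) = ar j (mode V (conformal V) k w) - smult V (of_int j) (ar (j + k - 1) w)"
  unfolding conformal_ar_commutator[of j k w, symmetric] by simp

lemma fock_weight: "fock_vector V a ns \<in> weight_space V (int (sum_list ns))"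
proof (induction ns)
  case Nil
  then show ?case by (simp add: weight_space_def Lop_def creation(2))
next
  case (Cons n ns)
  then show ?case
    using mode_weight[OF generator_weight Cons, of "- int n"] by (simp add: algebra_simps)
qed

lemma vacuum_weight: "vacuum V \<in> weight_space V 0"
  using fock_weight[of "[]"] by simp

lemma conformal_weight: "conformal V \<in> weight_space V 2"
  using fock_weight[of "[1,1]"] weight_scale by (simp add: conformal_eq)

lemma weight_negative:
  assumes "v \<in> weight_space V k" and "k < 0"
  shows "v = 0"
proof -
  have "v \<in> vs.span (fock_vector V a ` {ns \<in> fock_indices. int (sum_list ns) = k})"
  proof (rule eigenspace_span_indexed[OF Lop_lin[of 0] _ fock_span])
    show "Lop V 0 (fock_vector V a ns) = smult V (of_int (int (sum_list ns))) (fock_vector V a ns)" for ns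
      using fock_weight[of ns] by (simp only: weight_space_def mem_Collect_eq)
    show "Lop V 0 v = smult V (of_int k) v" using assms(1) by (simp only: weight_space_def mem_Collect_eq)
  qed
  moreover have "{ns \<in> fock_indices. int (sum_list ns) = k} = {}" using assms(2) by auto
  ultimately show ?thesis by simp
qed

end

section \<open>Square bracket modes\<close>

text \<open>
  The product is summed over the exponents of the exponential series; larger exponents do not
  reach the coefficient, so any sufficiently large bound \<open>J\<close> may be used.
\<close>

lemma expm1_powi_exp_nth:
  assumes "m - n \<le> int J"
  shows "fls_nth (expm1 powi (- m - 1) * fps_to_fls (fps_exp c)) (- n - 1)
    = (\<Sum>j\<le>J. fls_nth (expm1 powi (- m - 1)) (- n - 1 - int j) * (c ^ j / fact j))"
proof -
  let ?f = "expm1 powi (- m - 1)" and ?g = "fps_to_fls (fps_exp c)"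
  have sg: "fls_subdegree ?g = 0" by (rule fls_subdegree_eqI) auto
  have sf: "fls_subdegree ?f = - m - 1" by simp
  have "fls_nth (?f * ?g) (- n - 1) = (\<Sum>i=- m - 1..- n - 1. fls_nth ?f i * fls_nth ?g (- n - 1 - i))"
    unfolding fls_times_nth(2) sg sf by simp
  also have "\<dots> = (\<Sum>j\<in>{j. j \<le> J \<and> int j \<le> m - n}. fls_nth ?f (- n - 1 - int j) * (c ^ j / fact j))"
    using assms
    by (intro sum.reindex_bij_witness[of _ "\<lambda>j. - n - 1 - int j" "\<lambda>i. nat (- n - 1 - i)"]) auto
  also have "\<dots> = (\<Sum>j\<le>J. fls_nth ?f (- n - 1 - int j) * (c ^ j / fact j))"
    using expm1_powi_vanishes[of "- m - 1"]
    by (intro sum.mono_neutral_left) (auto simp: vanishes_below_def)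
  finally show ?thesis .
qed

context vertex_operator_algebra
begin

text \<open>
  On an eigenvector of weight \<open>k\<close> the exponential \<open>e\<^sup>z\<^sup>L\<^sup>(\<^sup>0\<^sup>)\<close> is the scalar \<open>e\<^sup>k\<^sup>z\<close>, and the double sum in the
  definition becomes a single one. Two components are needed because the conformal vector of the
  square bracket structure is a sum of vectors of weights two and zero.
\<close>

lemma sq_mode_eigen:
  assumes v: "v1 \<in> weight_space V (int k1)" "v2 \<in> weight_space V (int k2)"
    and M: "\<And>m. m > M \<Longrightarrow> mode V v1 m w = 0" "\<And>m. m > M \<Longrightarrow> mode V v2 m w = 0" and L: "L \<le> n"
  shows "sq_mode V (v1 + v2) n w = (\<Sum>m=L..M.
     smult V (fls_nth (expm1 powi (- m - 1) * fps_to_fls (fps_exp (of_nat k1))) (- n - 1)) (mode V v1 m w)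
   + smult V (fls_nth (expm1 powi (- m - 1) * fps_to_fls (fps_exp (of_nat k2))) (- n - 1)) (mode V v2 m w))"
proof -
  define c where "c m j = fls_nth (expm1 powi (- m - 1)) (- n - 1 - int j)" for m j
  define J where "J = nat (M - n)"
  have pow: "(Lop V 0 ^^ j) (v1 + v2) = smult V (of_nat k1 ^ j) v1 + smult V (of_nat k2 ^ j) v2" for j
  proof (induction j)
    case (Suc j)
    have "Lop V 0 v1 = smult V (of_nat k1) v1" "Lop V 0 v2 = smult V (of_nat k2) v2"
      using v by (simp_all add: weight_space_def)
    then show ?case using Suc by (simp add: lin_add[OF Lop_lin] lin_scale[OF Lop_lin] mult.commute)
  qed simp
  have term_eq: "smult V (c m j / fact j) (mode V ((Lop V 0 ^^ j) (v1 + v2)) m w)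
     = smult V (c m j * (of_nat k1 ^ j / fact j)) (mode V v1 m w) + smult V (c m j * (of_nat k2 ^ j / fact j)) (mode V v2 m w)" for m j
    by (simp add: pow mode_add mode_scale vs.scale_right_distrib)
  have c0: "c m j = 0" if "int j > m - n" for m j
    using that expm1_powi_vanishes[of "- m - 1"] by (auto simp: c_def vanishes_below_def)
  have "sq_mode V (v1 + v2) n w
     = Sum_any (\<lambda>(m, j). smult V (c m j / fact j) (mode V ((Lop V 0 ^^ j) (v1 + v2)) m w))"
    unfolding sq_mode_def c_def expm1_def ..
  also have "\<dots> = (\<Sum>(m, j)\<in>{L..M} \<times> {..J}. smult V (c m j / fact j) (mode V ((Lop V 0 ^^ j) (v1 + v2)) m w))"
  proof (rule Sum_any.expand_superset)
    show "{p. (case p of (m, j) \<Rightarrow> smult V (c m j / fact j) (mode V ((Lop V 0 ^^ j) (v1 + v2)) m w)) \<noteq> 0} \<subseteq> {L..M} \<times> {..J}"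
    proof
      fix p assume p: "p \<in> {p. (case p of (m, j) \<Rightarrow> smult V (c m j / fact j) (mode V ((Lop V 0 ^^ j) (v1 + v2)) m w)) \<noteq> 0}"
      obtain m j where pm: "p = (m, j)" by (cases p)
      have nz: "smult V (c m j * (of_nat k1 ^ j / fact j)) (mode V v1 m w) + smult V (c m j * (of_nat k2 ^ j / fact j)) (mode V v2 m w) \<noteq> 0"
        using p unfolding pm mem_Collect_eq prod.case term_eq .
      have "c m j \<noteq> 0" using nz by (rule contrapos_nn) simp
      then have "int j \<le> m - n" using c0[of m j] by linarith
      moreover have "m \<le> M"
      proof (rule ccontr)
        assume "\<not> m \<le> M"
        then have "mode V v1 m w = 0" "mode V v2 m w = 0" using M by auto
        then show False using nz by simp
      qed
      ultimately show "p \<in> {L..M} \<times> {..J}" using L by (auto simp: pm J_def)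
    qed
  qed simp
  also have "\<dots> = (\<Sum>m=L..M. \<Sum>j\<le>J. smult V (c m j * (of_nat k1 ^ j / fact j)) (mode V v1 m w) + smult V (c m j * (of_nat k2 ^ j / fact j)) (mode V v2 m w))"
    by (simp only: term_eq sum.cartesian_product [symmetric])
  also have "\<dots> = (\<Sum>m=L..M. smult V (\<Sum>j\<le>J. c m j * (of_nat k1 ^ j / fact j)) (mode V v1 m w)
      + smult V (\<Sum>j\<le>J. c m j * (of_nat k2 ^ j / fact j)) (mode V v2 m w))"
    by (simp only: sum.distrib vs.scale_sum_left)
  also have "\<dots> = (\<Sum>m=L..M.
     smult V (fls_nth (expm1 powi (- m - 1) * fps_to_fls (fps_exp (of_nat k1))) (- n - 1)) (mode V v1 m w)
   + smult V (fls_nth (expm1 powi (- m - 1) * fps_to_fls (fps_exp (of_nat k2))) (- n - 1)) (mode V v2 m w))"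
  proof (rule sum.cong[OF refl], goal_cases)
    case (1 m)
    then have "m - n \<le> int J" by (auto simp: J_def)
    then show ?case
      by (simp only: expm1_powi_exp_nth c_def)
  qed
  finally show ?thesis .
qed

lemma truncation_pair: "\<exists>M. (\<forall>m>M. mode V u m w = 0) \<and> (\<forall>m>M. mode V v m w = 0) \<and> M \<ge> B"
proof -
  obtain N1 where N1: "\<forall>n\<ge>N1. mode V u n w = 0" using truncation by blast
  obtain N2 where N2: "\<forall>n\<ge>N2. mode V v n w = 0" using truncation by blast
  show ?thesis by (rule exI[of _ "max B (max N1 N2)"]) (use N1 N2 in auto)
qed

end

context heisenberg_voa
begin

abbreviation aq :: "int \<Rightarrow> 'v \<Rightarrow> 'v" where
  "aq n \<equiv> sq_mode V a n"

text \<open>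
  The generator has weight one, so \<open>a[n] = \<Sum>\<^sub>m sq_coeff n m a(m)\<close>; on a given vector the sum
  may be cut off at any \<open>M\<close> beyond which the modes \<open>a(m)\<close> vanish.
\<close>

lemma aq_eq:
  assumes "\<And>m. m > M \<Longrightarrow> ar m w = 0" and "L \<le> n"
  shows "aq n w = (\<Sum>m=L..M. smult V (sq_coeff n m) (ar m w))"
proof -
  have "sq_mode V (a + 0) n w = (\<Sum>m=L..M.
     smult V (fls_nth (expm1 powi (- m - 1) * fps_to_fls (fps_exp (of_nat 1))) (- n - 1)) (ar m w)
   + smult V (fls_nth (expm1 powi (- m - 1) * fps_to_fls (fps_exp (of_nat 0))) (- n - 1)) (mode V 0 m w))"
    by (rule sq_mode_eigen) (use assms generator_weight in auto)
  then show ?thesis by (simp add: sq_coeff_eq)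
qed

definition Lsq :: "int \<Rightarrow> 'v \<Rightarrow> 'v" where
  "Lsq k = Lop (square_bracket V) k"

text \<open>
  The multiple of the vacuum in the conformal vector has as only nonzero mode the one of index
  \<open>-1\<close>, which contributes to \<open>L[-2]\<close> alone.
\<close>

lemma Lsq_eq:
  assumes M: "\<And>m. m > M \<Longrightarrow> mode V (conformal V) m w = 0" and L: "L \<le> k + 1" and k: "k \<ge> 0"
  shows "Lsq k w = (\<Sum>m=L..M. smult V (vir_coeff k m) (mode V (conformal V) m w))"
proof -
  define v2 where "v2 = smult V (- (central_charge V / 24)) (vacuum V)"
  define M' where "M' = max M 0"
  have v2m: "mode V v2 m w = (if m = - 1 then smult V (- (central_charge V / 24)) w else 0)" for m
    unfolding v2_def mode_scale vacuum by auto
  have "sq_mode V (conformal V + v2) (k + 1) w = (\<Sum>m=L..M'.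
     smult V (fls_nth (expm1 powi (- m - 1) * fps_to_fls (fps_exp (of_nat 2))) (- (k + 1) - 1)) (mode V (conformal V) m w)
   + smult V (fls_nth (expm1 powi (- m - 1) * fps_to_fls (fps_exp (of_nat 0))) (- (k + 1) - 1)) (mode V v2 m w))"
  proof (rule sq_mode_eigen)
    show "v2 \<in> weight_space V (int 0)" unfolding v2_def of_nat_0 by (rule weight_scale[OF vacuum_weight])
  qed (use M L conformal_weight in \<open>auto simp: M'_def v2m\<close>)
  also have "\<dots> = (\<Sum>m=L..M'. smult V (vir_coeff k m) (mode V (conformal V) m w))"
    using k by (intro sum.cong refl) (auto simp: v2m vir_coeff_eq)
  also have "\<dots> = (\<Sum>m=L..M. smult V (vir_coeff k m) (mode V (conformal V) m w))"
    by (rule sum.mono_neutral_right) (use M in \<open>auto simp: M'_def\<close>)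
  also have "conformal V + v2 = conformal (square_bracket V)"
    by (simp add: v2_def square_bracket_def)
  finally show ?thesis by (simp add: Lsq_def Lop_def square_bracket_def)
qed

lemma aq_lin: "lin (aq n)"
proof (rule linI)
  fix x y :: 'v and c
  obtain M1 where M1: "\<forall>m>M1. ar m x = 0" "\<forall>m>M1. ar m x = 0" using truncation_pair by blast
  obtain M2 where M2: "\<forall>m>M2. ar m y = 0" "M2 \<ge> M1" using truncation_pair by blast
  have "aq n (x + y) = (\<Sum>m=n..M2. smult V (sq_coeff n m) (ar m (x + y)))"
    "aq n x = (\<Sum>m=n..M2. smult V (sq_coeff n m) (ar m x))"
    "aq n y = (\<Sum>m=n..M2. smult V (sq_coeff n m) (ar m y))"
    by (rule aq_eq; use M1 M2 in \<open>auto simp: mode_add\<close>)+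
  then show "aq n (x + y) = aq n x + aq n y"
    by (simp add: mode_add vs.scale_right_distrib sum.distrib)
  have "aq n (smult V c x) = (\<Sum>m=n..M1. smult V (sq_coeff n m) (ar m (smult V c x)))"
    "aq n x = (\<Sum>m=n..M1. smult V (sq_coeff n m) (ar m x))"
    by (rule aq_eq; use M1 in \<open>auto simp: mode_scale\<close>)+
  then show "aq n (smult V c x) = smult V c (aq n x)"
    by (simp add: mode_scale vs.scale_sum_right mult.commute)
qed

lemma Lsq_lin: "k \<ge> 0 \<Longrightarrow> lin (Lsq k)"
proof (rule linI)
  fix x y :: 'v and c assume k: "k \<ge> 0"
  let ?m = "mode V (conformal V)"
  obtain M1 where M1: "\<forall>m>M1. ?m m x = 0" "\<forall>m>M1. ?m m x = 0" using truncation_pair by blast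
  obtain M2 where M2: "\<forall>m>M2. ?m m y = 0" "M2 \<ge> M1" using truncation_pair by blast
  have "Lsq k (x + y) = (\<Sum>m=k+1..M2. smult V (vir_coeff k m) (?m m (x + y)))"
    "Lsq k x = (\<Sum>m=k+1..M2. smult V (vir_coeff k m) (?m m x))"
    "Lsq k y = (\<Sum>m=k+1..M2. smult V (vir_coeff k m) (?m m y))"
    by (rule Lsq_eq; use M1 M2 k in \<open>auto simp: mode_add\<close>)+
  then show "Lsq k (x + y) = Lsq k x + Lsq k y"
    by (simp add: mode_add vs.scale_right_distrib sum.distrib)
  have "Lsq k (smult V c x) = (\<Sum>m=k+1..M1. smult V (vir_coeff k m) (?m m (smult V c x)))"
    "Lsq k x = (\<Sum>m=k+1..M1. smult V (vir_coeff k m) (?m m x))"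
    by (rule Lsq_eq; use M1 k in \<open>auto simp: mode_scale\<close>)+
  then show "Lsq k (smult V c x) = smult V c (Lsq k x)"
    by (simp add: mode_scale vs.scale_sum_right mult.commute)
qed

text \<open>
  Expanding both modes in the \<open>a(m)\<close>, the commutator is the scalar evaluated in
  \<open>sq_coeff_commutator\<close>. A common cutoff \<open>K\<close> turns all sums into finite ones.
\<close>

lemma aq_commute: "aq m (aq n w) = aq n (aq m w) + (if m = - n then smult V (of_int m) w else 0)"
proof -
  obtain K where K: "\<forall>j>K. ar j w = 0" "K \<ge> \<bar>m\<bar> + \<bar>n\<bar>" using truncation_pair by blast
  have ann: "ar i (ar j w) = 0" if "i > K" "j \<ge> - K" for i j
    using that K by (simp add: ar_commute[of i])
  have dbl: "aq m (aq n w) = (\<Sum>j=-K..K. \<Sum>i=-K..K. smult V (sq_coeff n j * sq_coeff m i) (ar i (ar j w)))"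
    if "\<bar>m\<bar> \<le> K" "\<bar>n\<bar> \<le> K" for m n
  proof -
    have "aq n w = (\<Sum>j=-K..K. smult V (sq_coeff n j) (ar j w))"
      by (rule aq_eq) (use K that in auto)
    then have "aq m (aq n w) = (\<Sum>j=-K..K. smult V (sq_coeff n j) (aq m (ar j w)))"
      by (simp add: lin_sum[OF aq_lin] lin_scale[OF aq_lin])
    also have "\<dots> = (\<Sum>j=-K..K. smult V (sq_coeff n j) (\<Sum>i=-K..K. smult V (sq_coeff m i) (ar i (ar j w))))"
    proof (rule sum.cong[OF refl], goal_cases)
      case (1 j)
      then have "aq m (ar j w) = (\<Sum>i=-K..K. smult V (sq_coeff m i) (ar i (ar j w)))"
        by (intro aq_eq) (use ann that in auto)
      then show ?case
        by simp
    qed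
    finally show ?thesis by (simp add: vs.scale_sum_right)
  qed
  have "aq m (aq n w) = (\<Sum>j=-K..K. \<Sum>i=-K..K. smult V (sq_coeff n j * sq_coeff m i) (ar i (ar j w)))"
    by (rule dbl) (use K in auto)
  also have "\<dots> = (\<Sum>j=-K..K. \<Sum>i=-K..K. smult V (sq_coeff n j * sq_coeff m i) (ar j (ar i w)))
     + (\<Sum>j=-K..K. \<Sum>i=-K..K. smult V (sq_coeff n j * sq_coeff m i) (if i = - j then smult V (of_int i) w else 0))"
    unfolding sum.distrib [symmetric] vs.scale_right_distrib [symmetric]
    by (intro sum.cong refl arg_cong[where f = "smult V _"] ar_commute)
  also have "(\<Sum>j=-K..K. \<Sum>i=-K..K. smult V (sq_coeff n j * sq_coeff m i) (ar j (ar i w)))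
     = (\<Sum>i=-K..K. \<Sum>j=-K..K. smult V (sq_coeff m i * sq_coeff n j) (ar j (ar i w)))"
    by (subst sum.swap) (simp add: mult.commute)
  also have "\<dots> = aq n (aq m w)"
    by (rule dbl[symmetric]) (use K in auto)
  also have "(\<Sum>j=-K..K. \<Sum>i=-K..K. smult V (sq_coeff n j * sq_coeff m i) (if i = - j then smult V (of_int i) w else 0))
     = (\<Sum>j=-K..K. smult V (- (of_int j * sq_coeff n j * sq_coeff m (- j))) w)"
  proof (rule sum.cong[OF refl], goal_cases)
    case j: (1 j)
    have "(\<Sum>i=-K..K. smult V (sq_coeff n j * sq_coeff m i) (if i = - j then smult V (of_int i) w else 0))
      = (\<Sum>i\<in>{-j}. smult V (sq_coeff n j * sq_coeff m i) (if i = - j then smult V (of_int i) w else 0))"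
      by (rule sum.mono_neutral_right) (use j in auto)
    then show ?case
      by (simp add: mult_ac)
  qed
  also have "\<dots> = smult V (- (\<Sum>j=-K..K. of_int j * sq_coeff n j * sq_coeff m (- j))) w"
    by (simp only: vs.scale_sum_left [symmetric] sum_negf)
  also have "(\<Sum>j=-K..K. of_int j * sq_coeff n j * sq_coeff m (- j)) = (if m = - n then of_int n else 0)"
    by (rule sq_coeff_commutator) (use K in auto)
  finally show ?thesis by simp
qed

text \<open>
  Expanding in the original modes and using \<open>[L(m), a(j)] = - j a(m + j)\<close>, the coefficient of
  \<open>a(p)\<close> in the commutator is the sum evaluated in \<open>vir_coeff_commutator\<close>.
\<close>

lemma Lsq_aq_commute:
  assumes k: "k \<ge> 0"
  shows "Lsq k (aq n w) = aq n (Lsq k w) - smult V (of_int n) (aq (n + k) w)"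
proof -
  let ?w = "mode V (conformal V)"
  obtain K where K: "\<forall>j>K. ar j w = 0" "\<forall>j>K. ?w j w = 0" "K \<ge> \<bar>n\<bar> + k + 1"
    using truncation_pair by blast
  \<comment> \<open>Exchanging \<open>a(j)\<close> and \<open>\<omega>(m)\<close> produces \<open>a(j + m - 1)\<close>, which must also vanish on \<open>w\<close> when one index
    exceeds the cutoff and the other one is as small as possible.\<close>
  define T where "T = 2 * K + 2"
  have TK: "T > K" "K > 0" "n \<ge> - K" "n \<le> K" using K k by (auto simp: T_def)
  have ann1: "?w m (ar j w) = 0" if "m > T" "j \<ge> n" for m j
    using that K TK by (simp add: conformal_ar_commute T_def)
  have ann2: "ar j (?w m w) = 0" if "j > T" "m \<ge> k + 1" for m j
  proof -
    have "ar j (?w m w) = ?w m (ar j w) + smult V (of_int j) (ar (j + m - 1) w)"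
      by (simp add: conformal_ar_commute)
    then show ?thesis using that K TK k by simp
  qed
  have an: "aq n w = (\<Sum>j=n..T. smult V (sq_coeff n j) (ar j w))"
    by (rule aq_eq) (use K TK in auto)
  have Lw: "Lsq k w = (\<Sum>m=k+1..T. smult V (vir_coeff k m) (?w m w))"
    by (rule Lsq_eq) (use K TK k in auto)
  have "Lsq k (aq n w) = (\<Sum>j=n..T. smult V (sq_coeff n j) (Lsq k (ar j w)))"
    unfolding an by (simp add: lin_sum[OF Lsq_lin[OF k]] lin_scale[OF Lsq_lin[OF k]])
  also have "\<dots> = (\<Sum>j=n..T. smult V (sq_coeff n j) (\<Sum>m=k+1..T. smult V (vir_coeff k m) (?w m (ar j w))))"
  proof (rule sum.cong[OF refl], goal_cases)
    case j: (1 j)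
    have "Lsq k (ar j w) = (\<Sum>m=k+1..T. smult V (vir_coeff k m) (?w m (ar j w)))"
      by (rule Lsq_eq) (use j ann1 k in auto)
    then show ?case
      by simp
  qed
  also have "\<dots> = (\<Sum>j=n..T. \<Sum>m=k+1..T. smult V (sq_coeff n j * vir_coeff k m) (?w m (ar j w)))"
    by (simp add: vs.scale_sum_right)
  also have "\<dots> = (\<Sum>j=n..T. \<Sum>m=k+1..T. smult V (sq_coeff n j * vir_coeff k m) (ar j (?w m w)))
     - (\<Sum>j=n..T. \<Sum>m=k+1..T. smult V (of_int j * sq_coeff n j * vir_coeff k m) (ar (j + m - 1) w))"
    unfolding sum_subtractf [symmetric] conformal_ar_commute vs.scale_right_diff_distrib
    by (simp add: mult_ac)
  also have "(\<Sum>j=n..T. \<Sum>m=k+1..T. smult V (sq_coeff n j * vir_coeff k m) (ar j (?w m w)))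
     = aq n (Lsq k w)"
  proof -
    have "aq n (Lsq k w) = (\<Sum>m=k+1..T. smult V (vir_coeff k m) (aq n (?w m w)))"
      unfolding Lw by (simp add: lin_sum[OF aq_lin] lin_scale[OF aq_lin])
    also have "\<dots> = (\<Sum>m=k+1..T. smult V (vir_coeff k m) (\<Sum>j=n..T. smult V (sq_coeff n j) (ar j (?w m w))))"
    proof (rule sum.cong[OF refl], goal_cases)
      case m: (1 m)
      have "aq n (?w m w) = (\<Sum>j=n..T. smult V (sq_coeff n j) (ar j (?w m w)))"
        by (rule aq_eq) (use m ann2 in auto)
      then show ?case
        by simp
    qed
    also have "\<dots> = (\<Sum>j=n..T. \<Sum>m=k+1..T. smult V (sq_coeff n j * vir_coeff k m) (ar j (?w m w)))"
      by (subst sum.swap) (simp add: vs.scale_sum_right mult.commute)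
    finally show ?thesis by simp
  qed
  also have "(\<Sum>j=n..T. \<Sum>m=k+1..T. smult V (of_int j * sq_coeff n j * vir_coeff k m) (ar (j + m - 1) w))
     = (\<Sum>j=n..T. \<Sum>p=n+k..K. smult V (of_int j * sq_coeff n j * vir_coeff k (p - j + 1)) (ar p w))"
  proof (rule sum.cong[OF refl], goal_cases)
    case j: (1 j)
    have "(\<Sum>m=k+1..T. smult V (of_int j * sq_coeff n j * vir_coeff k m) (ar (j + m - 1) w))
      = (\<Sum>p=j+k..j+T-1. smult V (of_int j * sq_coeff n j * vir_coeff k (p - j + 1)) (ar p w))"
      by (rule sum.reindex_bij_witness[of _ "\<lambda>p. p - j + 1" "\<lambda>m. j + m - 1"]) (auto simp: algebra_simps)
    also have "\<dots> = (\<Sum>p=n+k..K. smult V (of_int j * sq_coeff n j * vir_coeff k (p - j + 1)) (ar p w))"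
      by (rule sum.mono_neutral_cong) (use j K TK in \<open>auto simp: T_def vir_coeff_below not_le\<close>)
    finally show ?case .
  qed
  also have "\<dots> = (\<Sum>p=n+k..K. smult V (\<Sum>j=n..T. of_int j * sq_coeff n j * vir_coeff k (p - j + 1)) (ar p w))"
    by (subst sum.swap) (simp only: vs.scale_sum_left)
  also have "\<dots> = (\<Sum>p=n+k..K. smult V (of_int n * sq_coeff (n + k) p) (ar p w))"
    by (intro sum.cong refl, subst vir_coeff_commutator) (use TK k in \<open>auto simp: T_def\<close>)
  also have "\<dots> = smult V (of_int n) (\<Sum>p=n+k..K. smult V (sq_coeff (n + k) p) (ar p w))"
    by (simp add: vs.scale_sum_right)
  also have "(\<Sum>p=n+k..K. smult V (sq_coeff (n + k) p) (ar p w)) = aq (n + k) w"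
    by (rule aq_eq[symmetric]) (use K in auto)
  finally show ?thesis .
qed

lemma Lsq_vacuum: "k \<ge> 0 \<Longrightarrow> Lsq k (vacuum V) = 0"
  by (subst Lsq_eq[of 0 _ "k+1"]) (auto simp: creation(2))

lemma aq_vacuum: "n \<ge> 0 \<Longrightarrow> aq n (vacuum V) = 0"
  by (subst aq_eq[of "-1" _ n]) (auto simp: creation(2))

lemma aq_a: "aq (-1) (vacuum V) = a"
  by (subst aq_eq[of "-1" _ "-1"]) (auto simp: creation)

lemma aq_0 [simp]: "aq 0 w = 0"
proof -
  obtain K where K: "\<forall>j>K. ar j w = 0" "K \<ge> 0" using truncation_pair by blast
  have "aq 0 w = (\<Sum>m=0..K. smult V (sq_coeff 0 m) (ar m w))"
    by (rule aq_eq) (use K in auto)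
  also have "\<dots> = 0" by (rule sum.neutral) (auto simp: sq_coeff_0)
  finally show ?thesis .
qed

section \<open>The square bracket Fock basis\<close>

text \<open>
  \<open>sq_fock [n\<^sub>1, \<dots>, n\<^sub>r] = a[-n\<^sub>1] \<dots> a[-n\<^sub>r] 1\<close>. The lists are not required to be sorted: repetitions
  in a spanning family do no harm.
\<close>

definition sq_fock :: "nat list \<Rightarrow> 'v" where
  "sq_fock ns = fock_vector (square_bracket V) a ns"

lemma sq_fock_Nil [simp]: "sq_fock [] = vacuum V"
  and sq_fock_Cons [simp]: "sq_fock (n # ns) = aq (- int n) (sq_fock ns)"
  by (simp_all add: sq_fock_def fock_vector_def square_bracket_def)

lemma Lsq_sq_fock: "Lsq 0 (sq_fock ns) = smult V (of_int (int (sum_list ns))) (sq_fock ns)"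
proof (induction ns)
  case (Cons n ns)
  let ?x = "aq (- int n) (sq_fock ns)"
  have "Lsq 0 ?x = smult V (of_nat (sum_list ns)) ?x + smult V (of_nat n) ?x"
    by (simp add: Lsq_aq_commute Cons lin_scale[OF aq_lin])
  also have "\<dots> = smult V (of_nat (sum_list ns) + of_nat n) ?x"
    by (simp only: vs.scale_left_distrib)
  finally show ?case by (simp add: add.commute)
qed (simp add: Lsq_vacuum)

text \<open>
  An annihilation operator removes one factor: it is commuted to the right until it meets the
  vacuum.
\<close>

lemma aq_sq_fock_span:
  assumes "0 \<notin> set ns"
  shows "aq (int m) (sq_fock ns) \<in> vs.span (sq_fock ` {ms. 0 \<notin> set ms \<and> length ns = Suc (length ms)})"
  using assms
proof (induction ns)
  case Nil
  then show ?case by (simp add: aq_vacuum)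
next
  case (Cons n ns)
  let ?S = "\<lambda>ns. sq_fock ` {ms. 0 \<notin> set ms \<and> length ns = Suc (length ms)}"
  have n: "n \<noteq> 0" using Cons.prems by auto
  have "aq (- int n) (aq (int m) (sq_fock ns)) \<in> vs.span (?S (n # ns))"
  proof (rule lin_in_span[OF aq_lin])
    show "aq (int m) (sq_fock ns) \<in> vs.span (?S ns)" using Cons by simp
    fix s assume "s \<in> ?S ns"
    then obtain ms where ms: "s = sq_fock ms" "0 \<notin> set ms" "length ns = Suc (length ms)" by auto
    then have "aq (- int n) s = sq_fock (n # ms)" by simp
    then show "aq (- int n) s \<in> vs.span (?S (n # ns))"
      using ms n by (auto intro!: vs.span_base image_eqI[where x = "n # ms"])
  qed
  moreover have "(if int m = - (- int n) then smult V (of_int (int m)) (sq_fock ns) else 0) \<in> vs.span (?S (n # ns))"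
    by (cases "m = n") (use Cons.prems in \<open>auto intro: vs.span_scale[OF vs.span_base] vs.span_zero\<close>)
  ultimately show ?case
    unfolding sq_fock_Cons by (subst aq_commute) (rule vs.span_add)
qed

text \<open>
  Expand \<open>x\<^sup>j\<close> in powers of \<open>z\<close>; on a given vector only finitely many of the \<open>a[m]\<close> act nontrivially.
\<close>

lemma ar_from_aq:
  "\<exists>A c. finite A \<and> ar j w = (\<Sum>m\<in>A. smult V (c m) (aq m w))"
proof -
  obtain K where K: "\<forall>j>K. ar j w = 0" "K \<ge> j" using truncation_pair by blast
  define n where "n = nat (K + 1 - j)"
  have n: "j + int n = K + 1" using K by (simp add: n_def)
  let ?c = "\<lambda>m. fls_nth (expm1 powi j) m"
  have "(\<Sum>m\<in>{j..<j + int n}. smult V (?c m) (aq m w))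
     = (\<Sum>m\<in>{j..<j + int n}. smult V (?c m) (\<Sum>i=j..K. smult V (sq_coeff m i) (ar i w)))"
  proof (rule sum.cong[OF refl], goal_cases)
    case (1 m)
    then have "aq m w = (\<Sum>i=j..K. smult V (sq_coeff m i) (ar i w))"
      by (intro aq_eq) (use K in auto)
    then show ?case by simp
  qed
  also have "\<dots> = (\<Sum>i=j..K. smult V (\<Sum>m\<in>{j..<j + int n}. ?c m * sq_coeff m i) (ar i w))"
    unfolding vs.scale_sum_right vs.scale_scale by (subst sum.swap) (simp only: vs.scale_sum_left)
  also have "\<dots> = (\<Sum>i=j..K. if i = j then ar i w else 0)"
    by (intro sum.cong refl, subst sq_coeff_inverse) (auto simp: n)
  also have "\<dots> = ar j w" using K by simp
  finally show ?thesis by (metis finite_atLeastLessThan_int)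
qed

text \<open>
  The span is invariant under all \<open>a[m]\<close>, hence under all \<open>a(j)\<close> by the previous lemma; it contains
  the vacuum and therefore the original Fock basis.
\<close>

lemma sq_fock_span: "vs.span (sq_fock ` {ns. 0 \<notin> set ns}) = UNIV"
proof -
  let ?U = "vs.span (sq_fock ` {ns. 0 \<notin> set ns})"
  have aq: "aq m u \<in> ?U" if "u \<in> ?U" for m u
  proof (rule lin_in_span[OF aq_lin that])
    fix s assume "s \<in> sq_fock ` {ns. 0 \<notin> set ns}"
    then obtain ns where ns: "s = sq_fock ns" "0 \<notin> set ns" by auto
    show "aq m s \<in> ?U"
    proof (cases "m < 0")
      case True
      then have e: "aq m s = sq_fock (nat (- m) # ns)" by (simp add: ns)
      show ?thesis
        unfolding e by (intro vs.span_base imageI) (use True ns in auto)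
    next
      case False
      then have "aq m s \<in> vs.span (sq_fock ` {ms. 0 \<notin> set ms \<and> length ns = Suc (length ms)})"
        using aq_sq_fock_span[OF ns(2), of "nat m"] by (simp add: ns)
      moreover have "sq_fock ` {ms. 0 \<notin> set ms \<and> length ns = Suc (length ms)} \<subseteq> sq_fock ` {ns. 0 \<notin> set ns}" by auto
      ultimately show ?thesis by (rule subsetD[OF vs.span_mono, rotated])
    qed
  qed
  have ar: "ar j u \<in> ?U" if "u \<in> ?U" for j u
  proof -
    obtain A c where Ac: "finite A" "ar j u = (\<Sum>m\<in>A. smult V (c m) (aq m u))"
      using ar_from_aq[of j u] by blast
    show ?thesis unfolding Ac(2) by (intro vs.span_sum vs.span_scale aq that)
  qed
  have "vacuum V \<in> ?U"
    by (intro vs.span_base image_eqI[where x = "[]"]) simp_all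
  then have "fock_vector V a ns \<in> ?U" for ns
    by (induction ns) (auto intro: ar)
  then have "fock_vector V a ` fock_indices \<subseteq> ?U" by auto
  then have "vs.span (fock_vector V a ` fock_indices) \<subseteq> ?U"
    by (rule vs.span_minimal[OF _ vs.subspace_span])
  then show ?thesis using fock_span by auto
qed

abbreviation sq_weight :: "int \<Rightarrow> 'v set" where
  "sq_weight k \<equiv> weight_space (square_bracket V) k"

lemma sq_weight_iff: "v \<in> sq_weight k \<longleftrightarrow> Lsq 0 v = smult V (of_int k) v"
  by (simp add: weight_space_def Lsq_def square_bracket_def)

lemma sq_fock_weight: "sq_fock ns \<in> sq_weight (int (sum_list ns))"
  unfolding sq_weight_iff by (rule Lsq_sq_fock)

lemma sq_weight_span:
  "v \<in> sq_weight k \<Longrightarrow> v \<in> vs.span (sq_fock ` {ns. 0 \<notin> set ns \<and> int (sum_list ns) = k})"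
  using eigenspace_span_indexed[OF Lsq_lin, of 0 "{ns. 0 \<notin> set ns}" sq_fock "\<lambda>ns. int (sum_list ns)" v k]
  by (simp add: Lsq_sq_fock[simplified] sq_fock_span sq_weight_iff)

lemma aq_weight: "v \<in> sq_weight k \<Longrightarrow> aq n v \<in> sq_weight (k - n)"
  unfolding sq_weight_iff
  by (simp add: Lsq_aq_commute lin_scale[OF aq_lin] vs.scale_left_diff_distrib)

lemma sq_weight_negative: "v \<in> sq_weight k \<Longrightarrow> k < 0 \<Longrightarrow> v = 0"
proof -
  assume "v \<in> sq_weight k" "k < 0"
  moreover from this have "{ns. 0 \<notin> set ns \<and> int (sum_list ns) = k} = {}" by auto
  ultimately show "v = 0" using sq_weight_span[of v k] by simp
qed

lemma finite_positive_lists: "finite {ns. (0::nat) \<notin> set ns \<and> int (sum_list ns) = k}"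
proof -
  have len: "length ns \<le> sum_list ns" if "(0::nat) \<notin> set ns" for ns
    using that by (induction ns) auto
  have "{ns. (0::nat) \<notin> set ns \<and> int (sum_list ns) = k} \<subseteq> {ns. set ns \<subseteq> {..nat k} \<and> length ns \<le> nat k}"
    using len member_le_sum_list by fastforce
  then show ?thesis using finite_lists_length_le[of "{..nat k}" "nat k"] finite_subset by blast
qed

lemma generator_sq_weight: "a \<in> sq_weight 1"
  using sq_fock_weight[of "[1]"] by (simp add: aq_a)

text \<open>
  The generator is a primary vector of the square bracket structure, so that the invariance of the
  metric makes \<open>- a[-n]\<close> the adjoint of \<open>a[n]\<close>.
\<close>

lemma Lsq_1_a: "Lsq 1 a = 0"
proof -
  have "Lsq 1 (aq (-1) (vacuum V)) = aq (-1) (Lsq 1 (vacuum V)) - smult V (of_int (-1)) (aq (-1 + 1) (vacuum V))"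
    by (rule Lsq_aq_commute) simp
  also have "\<dots> = 0" by (simp add: Lsq_vacuum lin_zero[OF aq_lin])
  finally have "Lsq 1 (aq (-1) (vacuum V)) = 0" .
  then show ?thesis by (simp add: aq_a)
qed

end

section \<open>Lambert series\<close>

text \<open>
  \<open>q\<^sup>k / (1 - q\<^sup>k)\<close>
\<close>

definition lambert_fps :: "nat \<Rightarrow> complex fps" where
  "lambert_fps k = Abs_fps (\<lambda>n. if n > 0 \<and> k dvd n then 1 else 0)"

lemma lambert_fps_mult:
  assumes "k > 0"
  shows "lambert_fps k * (1 - fps_X ^ k) = fps_X ^ k"
proof (rule fps_ext)
  fix n
  have "fps_nth (lambert_fps k * (1 - fps_X ^ k)) n = fps_nth (lambert_fps k) n - (if n < k then 0 else fps_nth (lambert_fps k) (n - k))"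
    by (simp add: right_diff_distrib fps_X_power_mult_right_nth)
  also have "\<dots> = (if n = k then 1 else 0)"
    using assms by (auto simp: lambert_fps_def dvd_imp_le dvd_minus_self)
  finally show "fps_nth (lambert_fps k * (1 - fps_X ^ k)) n = fps_nth (fps_X ^ k) n"
    by (simp add: fps_X_power_nth)
qed

text \<open>
  This turns the relation between a trace and its cyclic rotation into an explicit formula.
\<close>

lemma lambert_fps_solution:
  fixes f g :: "complex fps"
  assumes "k > 0" and "f = fps_X ^ k * f + fps_X ^ k * g"
  shows "f = lambert_fps k * g"
proof -
  have "f * (1 - fps_X ^ k) = fps_X ^ k * g"
    using assms(2) by (simp add: algebra_simps)
  also have "\<dots> = lambert_fps k * g * (1 - fps_X ^ k)"
    using lambert_fps_mult[OF assms(1)] by (simp add: ac_simps)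
  finally have "f * (1 - fps_X ^ k) = lambert_fps k * g * (1 - fps_X ^ k)" .
  moreover have "(1 - fps_X ^ k :: complex fps) \<noteq> 0"
  proof
    assume z: "(1 - fps_X ^ k :: complex fps) = 0"
    have "fps_X ^ k = (0 :: complex fps)"
      using lambert_fps_mult[OF assms(1)] unfolding z by simp
    then show False by simp
  qed
  ultimately show ?thesis by simp
qed

lemma lambert_fps_mult_nth_0: "k > n \<Longrightarrow> fps_nth (lambert_fps k * g) n = 0"
proof -
  assume "k > n"
  then have "fps_nth (lambert_fps k) i = 0" if "i \<le> n" for i
    using that dvd_imp_le[of k i] by (auto simp: lambert_fps_def)
  then show ?thesis by (simp add: fps_mult_nth)
qed

text \<open>
  \<open>\<Sum>\<^sub>n \<sigma>\<^sub>p(n) q\<^sup>n = \<Sum>\<^sub>k k\<^sup>p q\<^sup>k / (1 - q\<^sup>k)\<close>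
\<close>

definition divisor_fps :: "nat \<Rightarrow> complex fps" where
  "divisor_fps p = Abs_fps (\<lambda>n. if n = 0 then 0 else of_nat (\<Sum>d | d dvd n. d ^ p))"

lemma divisor_fps_0 [simp]: "fps_nth (divisor_fps p) 0 = 0"
  by (simp add: divisor_fps_def)

lemma divisor_fps_mult_nth:
  "fps_nth (divisor_fps p * g) n = (\<Sum>k=1..n. of_nat k ^ p * fps_nth (lambert_fps k * g) n)"
proof -
  have "fps_nth (divisor_fps p) i = (\<Sum>k=1..n. of_nat k ^ p * fps_nth (lambert_fps k) i)" if "i \<le> n" for i
  proof (cases "i = 0")
    case False
    have "{k. k dvd i} \<subseteq> {1..n}"
    proof
      fix k assume "k \<in> {k. k dvd i}"
      then show "k \<in> {1..n}" using that False dvd_imp_le[of k i] dvd_pos_nat[of i k] by auto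
    qed
    then have "(\<Sum>k=1..n. of_nat k ^ p * fps_nth (lambert_fps k) i) = (\<Sum>k\<in>{k. k dvd i}. of_nat k ^ p)"
      using that False
      by (intro sum.mono_neutral_cong_right) (auto simp: lambert_fps_def)
    then show ?thesis using False by (simp add: divisor_fps_def)
  qed (simp add: lambert_fps_def)
  then have "fps_nth (divisor_fps p * g) n = (\<Sum>i=0..n. (\<Sum>k=1..n. of_nat k ^ p * fps_nth (lambert_fps k) i) * fps_nth g (n - i))"
    unfolding fps_mult_nth by (intro sum.cong refl) simp
  also have "\<dots> = (\<Sum>k=1..n. of_nat k ^ p * fps_nth (lambert_fps k * g) n)"
    by (simp add: sum_distrib_right sum_distrib_left fps_mult_nth mult.assoc) (rule sum.swap)
  finally show ?thesis .
qed

section \<open>Radius of convergence\<close>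

lemma conv_radius_comparison:
  fixes f g :: "nat \<Rightarrow> complex"
  assumes "\<And>n. norm (f n) \<le> norm (g n)"
  shows "conv_radius g \<le> conv_radius f"
proof (rule conv_radius_geI_ex')
  fix r :: real assume r: "0 < r" "ereal r < conv_radius g"
  then have "summable (\<lambda>n. norm (g n * of_real r ^ n))"
    by (intro abs_summable_in_conv_radius) simp
  then show "summable (\<lambda>n. f n * of_real r ^ n)"
    by (rule summable_comparison_test')
      (use assms r in \<open>auto simp: norm_mult norm_power intro: mult_right_mono\<close>)
qed

text \<open>
  The series \<open>\<Sum> n\<^sup>k z\<^sup>n\<close> arise from the geometric series by repeated application of \<open>z d/dz\<close>.
\<close>

lemma conv_radius_of_nat_power: "conv_radius (\<lambda>n. of_nat n ^ k :: complex) \<ge> 1"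
proof -
  define A where "A k = Abs_fps (\<lambda>n. of_nat n ^ k :: complex)" for k
  have "fps_conv_radius (A k) \<ge> 1"
  proof (induction k)
    case 0
    have "conv_radius (\<lambda>n. 1 :: complex) \<ge> 1"
    proof (rule conv_radius_geI_ex')
      fix r :: real assume "0 < r" "ereal r < 1"
      then show "summable (\<lambda>n. 1 * complex_of_real r ^ n)"
        by (simp add: summable_geometric)
    qed
    then show ?case by (simp add: A_def fps_conv_radius_def)
  next
    case (Suc k)
    have "A (Suc k) = fps_X * fps_deriv (A k)"
    proof (rule fps_ext)
      fix n show "fps_nth (A (Suc k)) n = fps_nth (fps_X * fps_deriv (A k)) n"
        by (cases n) (simp_all add: A_def)
    qed
    moreover have "fps_conv_radius (fps_X * fps_deriv (A k)) \<ge> min (fps_conv_radius (fps_X :: complex fps)) (fps_conv_radius (fps_deriv (A k)))"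
      by (rule fps_conv_radius_mult)
    moreover have "fps_conv_radius (fps_deriv (A k)) \<ge> 1"
      using Suc fps_conv_radius_deriv[of "A k"] by (rule order_trans)
    ultimately show ?case by simp
  qed
  then show ?thesis by (simp add: A_def fps_conv_radius_def)
qed

lemma divisor_fps_conv_radius: "fps_conv_radius (divisor_fps p) \<ge> 1"
proof -
  have "norm (fps_nth (divisor_fps p) n) \<le> norm (of_nat n ^ Suc p :: complex)" for n
  proof (cases "n = 0")
    case False
    have "(\<Sum>d | d dvd n. d ^ p) \<le> (\<Sum>d | d dvd n. n ^ p)"
      by (rule sum_mono) (use False in \<open>auto intro: power_mono dvd_imp_le\<close>)
    also have "\<dots> = card {d. d dvd n} * n ^ p" by simp
    also have "card {d. d dvd n} \<le> card {1..n}"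
    proof (rule card_mono)
      show "{d. d dvd n} \<subseteq> {1..n}"
      proof
        fix k assume "k \<in> {k. k dvd n}"
        then show "k \<in> {1..n}" using False dvd_imp_le[of k n] dvd_pos_nat[of n k] by auto
      qed
    qed simp
    finally have "(\<Sum>d | d dvd n. d ^ p) \<le> n ^ Suc p" by simp
    then have "real (\<Sum>d | d dvd n. d ^ p) \<le> real (n ^ Suc p)" by (simp only: of_nat_le_iff)
    moreover have "norm (fps_nth (divisor_fps p) n) = real (\<Sum>d | d dvd n. d ^ p)"
      using False unfolding divisor_fps_def by (simp only: fps_nth_Abs_fps if_False norm_of_nat)
    moreover have "norm (of_nat n ^ Suc p :: complex) = real (n ^ Suc p)"
      by (simp only: norm_power norm_of_nat of_nat_power)
    ultimately show ?thesis by simp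
  qed simp
  then have "conv_radius (\<lambda>n. of_nat n ^ Suc p :: complex) \<le> conv_radius (fps_nth (divisor_fps p))"
    by (rule conv_radius_comparison)
  then show ?thesis
    unfolding fps_conv_radius_def using conv_radius_of_nat_power[of "Suc p"] by (rule order_trans[rotated])
qed

text \<open>
  For \<open>\<rho> < 1\<close> put \<open>t\<^sub>n = |f\<^sub>n| \<rho>\<^sup>n\<close>. The equation bounds \<open>n t\<^sub>n\<close> by \<open>A\<close> times the largest of the
  previous \<open>t\<^sub>i\<close>, where \<open>A = \<Sum> |s\<^sub>n| \<rho>\<^sup>n\<close>. From \<open>n \<ge> A\<close> on the \<open>t\<^sub>n\<close> can thus no longer exceed
  their previous maximum.
\<close>

lemma conv_radius_log_ode:
  fixes f s :: "complex fps"
  assumes rec: "fps_X * fps_deriv f = s * f" and s0: "fps_nth s 0 = 0" and s: "fps_conv_radius s \<ge> 1"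
  shows "fps_conv_radius f \<ge> 1"
  unfolding fps_conv_radius_def
proof (rule conv_radius_geI_ex')
  fix r :: real assume r: "0 < r" "ereal r < 1"
  \<comment> \<open>Boundedness at a radius \<open>\<rho> > r\<close> gives summability at \<open>r\<close>.\<close>
  define \<rho> where "\<rho> = (1 + r) / 2"
  have \<rho>: "r < \<rho>" "\<rho> < 1" "0 < \<rho>" using r by (simp_all add: \<rho>_def)
  have "ereal (norm (complex_of_real \<rho>)) < fps_conv_radius s"
    using \<rho> s by (intro less_le_trans[OF _ s]) simp
  then have summ: "summable (\<lambda>n. norm (fps_nth s n) * \<rho> ^ n)"
    using abs_summable_in_conv_radius[of "complex_of_real \<rho>" "fps_nth s"] \<rho>
    by (simp add: fps_conv_radius_def norm_mult norm_power)
  define A where "A = suminf (\<lambda>n. norm (fps_nth s n) * \<rho> ^ n)"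
  define t where "t n = norm (fps_nth f n) * \<rho> ^ n" for n
  have t0: "t n \<ge> 0" for n using \<rho> by (simp add: t_def)
  have rec': "real n * t n \<le> (\<Sum>i=1..n. norm (fps_nth s i) * \<rho> ^ i * t (n - i))" for n
  proof -
    have "of_nat n * fps_nth f n = fps_nth (fps_X * fps_deriv f) n"
      by (cases n) simp_all
    also have "\<dots> = (\<Sum>i=1..n. fps_nth s i * fps_nth f (n - i))"
      unfolding rec fps_mult_nth using s0 by (simp add: sum.atLeast_Suc_atMost)
    finally have "real n * norm (fps_nth f n) = norm (\<Sum>i=1..n. fps_nth s i * fps_nth f (n - i))"
      by (metis norm_mult norm_of_nat)
    also have "\<dots> \<le> (\<Sum>i=1..n. norm (fps_nth s i) * norm (fps_nth f (n - i)))"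
      by (rule order_trans[OF norm_sum]) (simp add: norm_mult)
    finally have "real n * norm (fps_nth f n) * \<rho> ^ n \<le> (\<Sum>i=1..n. norm (fps_nth s i) * norm (fps_nth f (n - i))) * \<rho> ^ n"
      using \<rho> by (intro mult_right_mono) simp_all
    also have "\<dots> = (\<Sum>i=1..n. norm (fps_nth s i) * \<rho> ^ i * t (n - i))"
      unfolding sum_distrib_right t_def
      by (intro sum.cong refl) (simp add: mult_ac power_add [symmetric])
    finally show ?thesis by (simp add: t_def mult_ac)
  qed
  obtain N where N: "A \<le> real N" using real_arch_simple by blast
  define B where "B = Max (t ` {..N})"
  have bound: "t n \<le> B" for n
  proof (induction n rule: less_induct)
    case (less n)
    have "t 0 \<le> B" unfolding B_def by (rule Max_ge) auto
    then have B0: "B \<ge> 0" using t0[of 0] by linarith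
    show ?case
    proof (cases "n \<le> N")
      case True
      then show ?thesis by (simp add: B_def)
    next
      case False
      have "real n * t n \<le> (\<Sum>i=1..n. norm (fps_nth s i) * \<rho> ^ i * t (n - i))" by (rule rec')
      also have "\<dots> \<le> (\<Sum>i=1..n. norm (fps_nth s i) * \<rho> ^ i * B)"
        using \<rho> less by (intro sum_mono mult_left_mono) auto
      also have "\<dots> = (\<Sum>i=1..n. norm (fps_nth s i) * \<rho> ^ i) * B" by (simp add: sum_distrib_right)
      also have "\<dots> \<le> A * B"
        unfolding A_def using \<rho> B0 by (intro mult_right_mono sum_le_suminf summ) auto
      also have "\<dots> \<le> real n * B" using N False B0 by (intro mult_right_mono) auto
      finally show ?thesis using False by simp
    qed
  qed
  have "summable (\<lambda>n. B * (r / \<rho>) ^ n)"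
    using \<rho> r by (intro summable_mult summable_geometric) (simp add: field_simps)
  then show "summable (\<lambda>n. fps_nth f n * of_real r ^ n)"
  proof (rule summable_comparison_test')
    fix n :: nat
    have "norm (fps_nth f n * of_real r ^ n) = t n * (r / \<rho>) ^ n"
      using \<rho> r by (simp add: t_def norm_mult norm_power power_divide)
    also have "\<dots> \<le> B * (r / \<rho>) ^ n" using bound r \<rho> by (intro mult_right_mono) simp_all
    finally show "norm (fps_nth f n * of_real r ^ n) \<le> B * (r / \<rho>) ^ n" .
  qed
qed

text \<open>
  The kernel of Zhu's recursion as a series in \<open>q\<close>. By \<open>eval_zhu_fps\<close> its value is \<open>C(n,m,\<tau>)/m\<close>; the
  second summand vanishes unless \<open>n + m\<close> is even.
\<close>

definition zhu_fps :: "nat \<Rightarrow> nat \<Rightarrow> complex fps" where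
  "zhu_fps n m = fps_const (bern_coeff n m) +
     fps_const (((-1) ^ (n - 1) - (-1) ^ m) / (fact (n - 1) * fact m)) * divisor_fps (n - 1 + m)"

lemma fps_conv_radius_mult_ge:
  fixes f g :: "complex fps"
  assumes "fps_conv_radius f \<ge> R" "fps_conv_radius g \<ge> R"
  shows "fps_conv_radius (f * g) \<ge> R"
  by (rule order_trans[OF _ fps_conv_radius_mult]) (use assms in simp)

lemma fps_conv_radius_add_ge:
  fixes f g :: "complex fps"
  assumes "fps_conv_radius f \<ge> R" "fps_conv_radius g \<ge> R"
  shows "fps_conv_radius (f + g) \<ge> R"
  by (rule order_trans[OF _ fps_conv_radius_add]) (use assms in simp)

lemma fps_conv_radius_sum_ge:
  fixes f :: "'i \<Rightarrow> complex fps"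
  assumes "\<And>i. i \<in> A \<Longrightarrow> fps_conv_radius (f i) \<ge> R"
  shows "fps_conv_radius (sum f A) \<ge> R"
  using assms by (induction A rule: infinite_finite_induct) (auto intro: fps_conv_radius_add_ge)

lemma zhu_fps_conv_radius: "fps_conv_radius (zhu_fps n m) \<ge> 1"
  unfolding zhu_fps_def
  by (intro fps_conv_radius_add_ge fps_conv_radius_mult_ge divisor_fps_conv_radius) simp_all

lemma eval_fps_sum:
  fixes f :: "'i \<Rightarrow> complex fps"
  assumes "\<And>i. i \<in> A \<Longrightarrow> fps_conv_radius (f i) \<ge> R" and "ereal (norm z) < R"
  shows "eval_fps (sum f A) z = (\<Sum>i\<in>A. eval_fps (f i) z)"
  using assms(1)
proof (induction A rule: infinite_finite_induct)
  case (insert i A)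
  have "ereal (norm z) < fps_conv_radius (f i)" using insert.prems assms(2) by (auto intro: less_le_trans)
  moreover have "ereal (norm z) < fps_conv_radius (sum f A)"
    using insert.prems assms(2) by (intro less_le_trans[OF _ fps_conv_radius_sum_ge]) auto
  ultimately show ?case using insert by (simp add: eval_fps_add)
qed simp_all

lemma norm_nome: "Im \<tau> > 0 \<Longrightarrow> norm (exp (2 * of_real pi * \<i> * \<tau>)) < 1"
  by (simp add: norm_exp_eq_Re)

text \<open>
  For odd \<open>n + m\<close> both summands of the kernel vanish, the first one by \<open>bernoulli_odd\<close>. For even \<open>n + m\<close>
  they are the constant term and the divisor sums of the Eisenstein series.
\<close>

lemma eval_zhu_fps:
  assumes "Im \<tau> > 0" and "n \<ge> 1" and "m \<ge> 1"
  shows "eval_fps (zhu_fps n m) (exp (2 * of_real pi * \<i> * \<tau>)) = C_coeff n m \<tau> / of_nat m"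
proof -
  let ?q = "exp (2 * of_real pi * \<i> * \<tau>)"
  obtain n' where n': "n = Suc n'" using assms by (cases n) auto
  obtain m' where m': "m = Suc m'" using assms by (cases m) auto
  define D where "D = eval_fps (divisor_fps (n - 1 + m)) ?q"
  have q: "ereal (norm ?q) < 1" using norm_nome[OF assms(1)] by simp
  have qd: "ereal (norm ?q) < fps_conv_radius (divisor_fps p)" for p
    by (rule less_le_trans[OF q divisor_fps_conv_radius])
  define c where "c = ((-1) ^ (n - 1) - (-1) ^ m) / (fact (n - 1) * fact m :: complex)"
  have r2: "ereal (norm ?q) < fps_conv_radius (fps_const c * divisor_fps (n - 1 + m))"
    by (rule less_le_trans[OF q]) (intro fps_conv_radius_mult_ge divisor_fps_conv_radius, simp)
  have "eval_fps (zhu_fps n m) ?q = bern_coeff n m + c * D"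
    unfolding zhu_fps_def c_def[symmetric] D_def
    by (subst eval_fps_add[OF _ r2], simp, subst eval_fps_mult[OF _ qd], simp, simp)
  also have "\<dots> = C_coeff n m \<tau> / of_nat m"
  proof (cases "odd (n + m)")
    case True
    then have "n + m \<ge> 2" "c = 0" using n' m' by (auto simp: c_def minus_one_power_iff)
    then show ?thesis
      using True bernoulli_odd[of "n + m"] by (simp add: bern_coeff_def C_coeff_def eisenstein_def)
  next
    case False
    have D: "D = suminf (\<lambda>n'. of_nat (\<Sum>d | d dvd Suc n'. d ^ (n + m - 1)) * ?q ^ Suc n')"
    proof -
      have "summable (\<lambda>i. fps_nth (divisor_fps (n - 1 + m)) i * ?q ^ i)"
        by (rule summable_fps[OF qd])
      then have "D = fps_nth (divisor_fps (n - 1 + m)) 0 * ?q ^ 0 + suminf (\<lambda>i. fps_nth (divisor_fps (n - 1 + m)) (Suc i) * ?q ^ Suc i)"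
        unfolding D_def eval_fps_def by (subst suminf_split_head) auto
      then show ?thesis using n' by (simp add: divisor_fps_def)
    qed
    have sg: "(-1) ^ (n - 1) = - ((-1) ^ m :: complex)" "(-1) ^ (n + 1) = - ((-1) ^ m :: complex)"
      using False n' by (auto simp: minus_one_power_iff)
    have c: "c = - 2 * (-1) ^ m / (fact (n - 1) * fact m)" unfolding c_def sg by simp
    have "of_nat ((m + n - 1) choose m) = (fact (n + m - 1) / (fact (n - 1) * fact m) :: complex)"
      using n' by (subst binomial_fact) (auto simp: mult_ac add_ac)
    then have b: "bern_coeff n m = (-1) ^ m * (fact (n + m - 1) / (fact (n - 1) * fact m)) * (bernoulli_number (n + m) / fact (n + m))"
      using n' m' sq_coeff_bernoulli[of "n + m"] by (simp add: bern_coeff_def)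
    have E: "eisenstein (n + m) \<tau> = - bernoulli_number (n + m) / fact (n + m) + 2 / fact (n + m - 1) * D"
      unfolding eisenstein_def D using False by simp
    have alg: "- s * (F / (f * g)) * (- B / G + 2 / F * D) = s * (F / (f * g)) * (B / G) + - 2 * s / (f * g) * D"
      if "F \<noteq> 0" for s F f g B G :: complex
    proof -
      have "- s * (F / (f * g)) * (- B / G + 2 / F * D) = s * (F / (f * g)) * (B / G) - s * (F / (f * g)) * (2 / F) * D"
        by (simp only: distrib_left) simp
      also have "s * (F / (f * g)) * (2 / F) = 2 * s / (f * g)" using that by simp
      finally show ?thesis by simp
    qed
    have fm: "of_nat m * fact (m - 1) = (fact m :: complex)" using m' by simp
    have "C_coeff n m \<tau> / of_nat m = - ((-1) ^ m) * (fact (n + m - 1) / (fact (n - 1) * fact m)) * eisenstein (n + m) \<tau>"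
      unfolding C_coeff_def sg fm[symmetric] by (simp add: mult_ac)
    also have "\<dots> = bern_coeff n m + c * D"
      unfolding b c E by (rule alg) (rule fact_nonzero)
    finally show ?thesis by simp
  qed
  finally show ?thesis .
qed

lemma fps_const_sum_eq: "fps_const (\<Sum>i\<in>A. f i) = (\<Sum>i\<in>A. fps_const (f i))"
  by (induction A rule: infinite_finite_induct) (simp_all add: fps_const_add [symmetric] del: fps_const_add)

lemma fps_const_scale_scale: "fps_const c * (fps_const d * f) = fps_const (c * d) * f"
  for f :: "complex fps"
  by (simp add: mult.assoc [symmetric])

context heisenberg_voa
begin

text \<open>
  The weight spaces of negative weight are zero, and the only independent subset of a zero space is
  empty.
\<close>

lemma wbasis_negative: "N < 0 \<Longrightarrow> wbasis N = {}"
  using wbasis_weight[of _ N] weight_negative[of _ N] wbasis(1)[of N] vs.dependent_zero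
  by (metis all_not_in_conv)

lemma wtrace_negative: "N < 0 \<Longrightarrow> wtrace N f = 0"
  by (simp add: wtrace_def wbasis_negative)

definition trace_coeff :: "'v \<Rightarrow> int \<Rightarrow> complex" where
  "trace_coeff v N = wtrace N (zero_mode V v)"

text \<open>
  The series \<open>\<Sum>\<^sub>N Tr\<^sub>N o(v) q\<^sup>N\<close>, so that \<open>Z\<^sup>(\<^sup>1\<^sup>)(v,\<tau>) = q\<^sup>-\<^sup>1\<^sup>/\<^sup>2\<^sup>4 trace_fps v\<close>.
\<close>

definition trace_fps :: "'v \<Rightarrow> complex fps" where
  "trace_fps v = Abs_fps (\<lambda>N. trace_coeff v (int N))"

lemma trace_coeff_add: "trace_coeff (u + v) N = trace_coeff u N + trace_coeff v N"
proof -
  have "trace_coeff (u + v) N = wtrace N (\<lambda>w. zero_mode V u w + zero_mode V v w)"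
    unfolding trace_coeff_def by (rule wtrace_cong) (rule zero_mode_add)
  also have "\<dots> = trace_coeff u N + trace_coeff v N"
    unfolding trace_coeff_def by (rule wtrace_add) (rule zero_mode_preserves, assumption)+
  finally show ?thesis .
qed

lemma trace_coeff_scale: "trace_coeff (smult V c v) N = c * trace_coeff v N"
proof -
  have "trace_coeff (smult V c v) N = wtrace N (\<lambda>w. smult V c (zero_mode V v w))"
    unfolding trace_coeff_def by (rule wtrace_cong) (rule zero_mode_scale)
  also have "\<dots> = c * trace_coeff v N"
    unfolding trace_coeff_def by (rule wtrace_scale) (rule zero_mode_preserves, assumption)
  finally show ?thesis .
qed

lemma trace_fps_add: "trace_fps (u + v) = trace_fps u + trace_fps v"
  by (rule fps_ext) (simp add: trace_fps_def trace_coeff_add)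

lemma trace_fps_scale: "trace_fps (smult V c v) = fps_const c * trace_fps v"
  by (rule fps_ext) (simp add: trace_fps_def trace_coeff_scale)

lemma trace_fps_zero [simp]: "trace_fps 0 = 0"
  using trace_fps_scale[of 0 0] by simp

lemma trace_fps_sum: "trace_fps (\<Sum>i\<in>A. f i) = (\<Sum>i\<in>A. trace_fps (f i))"
  by (induction A rule: infinite_finite_induct) (simp_all add: trace_fps_add)

section \<open>Zhu recursion for traces of zero modes\<close>

lemma ar_weight: "w \<in> weight_space V N \<Longrightarrow> ar k w \<in> weight_space V (N - k)"
  using mode_weight[OF generator_weight, of w N k] by (simp add: algebra_simps)

text \<open>
  \<open>\<Sum>\<^sub>N Tr\<^sub>N (a(k) v(wt - 1 - k)) q\<^sup>N\<close>; the index of the second mode makes the product preserve weights.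
  In \<open>right_fps\<close> the factors are in the opposite order.
\<close>

definition left_fps :: "int \<Rightarrow> 'v \<Rightarrow> int \<Rightarrow> complex fps" where
  "left_fps wt v k = Abs_fps (\<lambda>N. wtrace (int N) (\<lambda>x. ar k (mode V v (wt - 1 - k) x)))"

definition right_fps :: "int \<Rightarrow> 'v \<Rightarrow> int \<Rightarrow> complex fps" where
  "right_fps wt v k = Abs_fps (\<lambda>N. wtrace (int N) (\<lambda>x. mode V v (wt - 1 - k) (ar k x)))"

context
  fixes v wt M
  assumes v: "v \<in> weight_space V wt" and M: "\<And>i. i > int M \<Longrightarrow> ar i v = 0"
begin

lemma shifted_mode_weight: "w \<in> weight_space V N \<Longrightarrow> mode V v (wt - 1 - k) w \<in> weight_space V (N + k)"
  using mode_weight[OF v, of w N "wt - 1 - k"] by (simp add: algebra_simps)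

lemma left_right_cyclic: "wtrace N (\<lambda>x. ar k (mode V v (wt - 1 - k) x)) = wtrace (N + k) (\<lambda>x. mode V v (wt - 1 - k) (ar k x))"
  by (rule wtrace_cyclic[OF mode_linear_right _ mode_linear_right])
    (use ar_weight[of _ "N + k" k] shifted_mode_weight[of _ N k] in auto)

text \<open>
  \<open>\<Sum>\<^sub>m y\<^sup>m/m! trace_fps (a[m] v)\<close>: for \<open>y = k\<close> this is the trace of the commutator of \<open>a(k)\<close> and
  \<open>v(wt - 1 - k)\<close>.
\<close>

definition commutator_fps :: "complex \<Rightarrow> complex fps" where
  "commutator_fps y = (\<Sum>m\<le>M. fps_const (y ^ m / fact m) * trace_fps (aq (int m) v))"

lemma aq_nonneg: "aq (int m) v = (\<Sum>i\<le>M. smult V (sq_coeff (int m) (int i)) (ar (int i) v))"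
proof -
  have "aq (int m) v = (\<Sum>i=0..int M. smult V (sq_coeff (int m) i) (ar i v))"
    by (rule aq_eq) (use M in auto)
  also have "\<dots> = (\<Sum>i\<le>M. smult V (sq_coeff (int m) (int i)) (ar (int i) v))"
    by (rule sum.reindex_bij_witness[of _ int nat]) auto
  finally show ?thesis .
qed

lemma commutator_fps_eq: "commutator_fps y = (\<Sum>i\<le>M. fps_const (y gchoose i) * trace_fps (ar (int i) v))"
proof -
  have "commutator_fps y = (\<Sum>m\<le>M. \<Sum>i\<le>M. fps_const (y ^ m / fact m * sq_coeff (int m) (int i)) * trace_fps (ar (int i) v))"
    unfolding commutator_fps_def aq_nonneg trace_fps_sum trace_fps_scale sum_distrib_left
    by (simp only: fps_const_scale_scale)
  also have "\<dots> = (\<Sum>i\<le>M. (\<Sum>m\<le>M. fps_const (y ^ m / fact m * sq_coeff (int m) (int i))) * trace_fps (ar (int i) v))"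
    by (subst sum.swap) (simp only: sum_distrib_right)
  also have "\<dots> = (\<Sum>i\<le>M. fps_const (y gchoose i) * trace_fps (ar (int i) v))"
    by (intro sum.cong refl) (simp only: sum_power_sq_coeff fps_const_sum_eq [symmetric] atMost_iff)
  finally show ?thesis .
qed

lemma commutator_trace: "left_fps wt v k - right_fps wt v k = commutator_fps (of_int k)"
proof (rule fps_ext)
  fix N
  have "fps_nth (left_fps wt v k - right_fps wt v k) N
     = wtrace (int N) (\<lambda>x. ar k (mode V v (wt - 1 - k) x) - mode V v (wt - 1 - k) (ar k x))"
    unfolding left_fps_def right_fps_def
    by (simp, rule wtrace_diff[symmetric])
      (use ar_weight[OF shifted_mode_weight, of _ "int N" k k] shifted_mode_weight[OF ar_weight, of _ "int N" k k] in simp_all)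
  also have "\<dots> = wtrace (int N) (\<lambda>x. \<Sum>i\<le>M. smult V (of_int k gchoose i) (zero_mode V (ar (int i) v) x))"
  proof (rule wtrace_cong)
    fix x
    have "zero_mode V (ar (int i) v) x = mode V (ar (int i) v) (k + (wt - 1 - k) - int i) x" for i
      by (subst zero_mode_weight[OF ar_weight[OF v]]) (simp add: algebra_simps)
    then show "ar k (mode V v (wt - 1 - k) x) - mode V v (wt - 1 - k) (ar k x)
      = (\<Sum>i\<le>M. smult V (of_int k gchoose i) (zero_mode V (ar (int i) v) x))"
      using mode_commutator_finite[of M a v k "wt - 1 - k" x] M by simp
  qed
  also have "\<dots> = (\<Sum>i\<le>M. (of_int k gchoose i) * trace_coeff (ar (int i) v) (int N))"
    unfolding trace_coeff_def
    by (subst wtrace_sum) (auto intro!: weight_scale zero_mode_preserves sum.cong wtrace_scale)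
  also have "\<dots> = fps_nth (commutator_fps (of_int k)) N"
    by (simp add: commutator_fps_eq fps_sum_nth trace_fps_def)
  finally show "fps_nth (left_fps wt v k - right_fps wt v k) N = fps_nth (commutator_fps (of_int k)) N" .
qed

text \<open>
  By cyclicity the two orders of the factors differ by \<open>q\<^sup>k\<close>, and their difference is the trace
  of the commutator; together these determine both traces.
\<close>

lemma right_fps_pos:
  assumes "k > 0"
  shows "right_fps wt v (int k) = lambert_fps k * commutator_fps (of_nat k)"
proof (rule lambert_fps_solution[OF assms])
  have "right_fps wt v (int k) = fps_X ^ k * left_fps wt v (int k)"
  proof (rule fps_ext)
    fix N
    have "wtrace (int N) (\<lambda>x. mode V v (wt - 1 - int k) (ar (int k) x)) =
       wtrace (int N - int k) (\<lambda>x. ar (int k) (mode V v (wt - 1 - int k) x))"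
      using left_right_cyclic[of "int N - int k" "int k"] by simp
    then show "fps_nth (right_fps wt v (int k)) N = fps_nth (fps_X ^ k * left_fps wt v (int k)) N"
      by (auto simp: fps_X_power_mult_nth right_fps_def left_fps_def wtrace_negative of_nat_diff)
  qed
  moreover have "left_fps wt v (int k) = right_fps wt v (int k) + commutator_fps (of_nat k)"
    using commutator_trace[of "int k"] by (simp add: algebra_simps)
  ultimately have "right_fps wt v (int k) = fps_X ^ k * (right_fps wt v (int k) + commutator_fps (of_nat k))"
    by simp
  then show "right_fps wt v (int k) = fps_X ^ k * right_fps wt v (int k) + fps_X ^ k * commutator_fps (of_nat k)"
    by (simp only: distrib_left)
qed

lemma left_fps_neg:
  assumes "k > 0"
  shows "left_fps wt v (- int k) = - (lambert_fps k * commutator_fps (- of_nat k))"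
proof -
  have "left_fps wt v (- int k) = fps_X ^ k * right_fps wt v (- int k)"
  proof (rule fps_ext)
    fix N
    have "wtrace (int N) (\<lambda>x. ar (- int k) (mode V v (wt - 1 - (- int k)) x)) =
       wtrace (int N - int k) (\<lambda>x. mode V v (wt - 1 - (- int k)) (ar (- int k) x))"
      using left_right_cyclic[of "int N" "- int k"] by simp
    then show "fps_nth (left_fps wt v (- int k)) N = fps_nth (fps_X ^ k * right_fps wt v (- int k)) N"
      by (auto simp: fps_X_power_mult_nth right_fps_def left_fps_def wtrace_negative of_nat_diff)
  qed
  then have "left_fps wt v (- int k) = fps_X ^ k * left_fps wt v (- int k) + fps_X ^ k * (- commutator_fps (- of_nat k))"
    using commutator_trace[of "- int k"] by (simp add: algebra_simps)
  then have "left_fps wt v (- int k) = lambert_fps k * (- commutator_fps (- of_nat k))"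
    by (rule lambert_fps_solution[OF assms])
  then show ?thesis by simp
qed

text \<open>
  The associativity formula writes \<open>o(a(-s-1) v)\<close> as an infinite sum of products \<open>a(-k) v(\<dots>)\<close> and
  \<open>v(\<dots>) a(k)\<close>. On the weight \<open>N\<close> space the factor acting first lowers the weight by \<open>k\<close>, so the
  products with \<open>k > N\<close> vanish; the traces of the others are known.
\<close>

lemma trace_negative_mode:
  "fps_nth (trace_fps (ar (- int (Suc s)) v)) N =
    (\<Sum>k=1..N. ((- of_nat k - 1) gchoose s) * fps_nth (lambert_fps k * commutator_fps (of_nat k)) N
            - ((of_nat k - 1) gchoose s) * fps_nth (lambert_fps k * commutator_fps (- of_nat k)) N)"
proof -
  define b :: "nat \<Rightarrow> complex" where "b i = of_nat ((s + i) choose s)" for i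
  have coeff: "(-1) ^ i * (of_int (- int (Suc s)) gchoose i) = b i" for i
  proof -
    have "(of_int (- int (Suc s)) gchoose i :: complex) = (- (of_nat (Suc s))) gchoose i" by simp
    also have "\<dots> = (-1) ^ i * ((of_nat (Suc s) + of_nat i - 1) gchoose i)" by (rule gbinomial_minus)
    also have "(of_nat (Suc s) + of_nat i - 1 :: complex) = of_nat (s + i)" by simp
    also have "(of_nat (s + i) gchoose i :: complex) = b i"
      unfolding b_def binomial_gbinomial [symmetric] using binomial_symmetric[of i "s + i"] by simp
    finally show ?thesis by (simp add: mult.assoc [symmetric] power_mult_distrib [symmetric])
  qed
  define A where "A i x = ar (- int (Suc s) - int i) (mode V v (wt - 1 - (- int (Suc s) - int i)) x)" for i x
  define B where "B i x = mode V v (wt - 1 - int i) (ar (int i) x)" for i x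
  have Aw: "A i x \<in> weight_space V N'" if "x \<in> weight_space V N'" for i x N'
    using ar_weight[OF shifted_mode_weight[OF that], of "- int (Suc s) - int i" "- int (Suc s) - int i"] by (simp add: A_def)
  have Bw: "B i x \<in> weight_space V N'" if "x \<in> weight_space V N'" for i x N'
    using shifted_mode_weight[OF ar_weight[OF that], of "int i" "int i"] by (simp add: B_def)
  have sgn: "(-1) powi (- int (Suc s)) = ((-1) ^ Suc s :: complex)"
    by (simp only: power_int_minus power_int_of_nat power_inverse [symmetric] inverse_minus_eq inverse_1)
  have zm: "zero_mode V (ar (- int (Suc s)) v) x = (\<Sum>i\<le>N. smult V (b i) (A i x - smult V ((-1) ^ Suc s) (B i x)))"
    if x: "x \<in> weight_space V (int N)" for x
  proof -
    have "zero_mode V (ar (- int (Suc s)) v) x = mode V (ar (- int (Suc s)) v) (wt + int s) x"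
      by (subst zero_mode_weight[OF ar_weight[OF v]]) simp
    also have "\<dots> = Sum_any (\<lambda>i::nat. smult V (b i) (A i x - smult V ((-1) ^ Suc s) (B i x)))"
      unfolding mode_associator coeff sgn A_def B_def by (simp add: algebra_simps)
    also have "\<dots> = (\<Sum>i\<le>N. smult V (b i) (A i x - smult V ((-1) ^ Suc s) (B i x)))"
    proof (rule Sum_any.expand_superset)
      have "A i x - smult V ((-1) ^ Suc s) (B i x) = 0" if "i > N" for i
      proof -
        have "mode V v (wt - 1 - (- int (Suc s) - int i)) x = 0" "ar (int i) x = 0"
          using weight_negative[OF shifted_mode_weight[OF x, of "- int (Suc s) - int i"]]
            weight_negative[OF ar_weight[OF x, of "int i"]] that by auto
        then show ?thesis by (simp add: A_def B_def)
      qed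
      then show "{i. smult V (b i) (A i x - smult V ((-1) ^ Suc s) (B i x)) \<noteq> 0} \<subseteq> {..N}"
        by (force simp: not_less [symmetric])
    qed simp
    finally show ?thesis .
  qed
  have "fps_nth (trace_fps (ar (- int (Suc s)) v)) N
     = wtrace (int N) (\<lambda>x. \<Sum>i\<le>N. smult V (b i) (A i x - smult V ((-1) ^ Suc s) (B i x)))"
    by (simp add: trace_fps_def trace_coeff_def) (rule wtrace_cong, use zm in simp)
  also have "\<dots> = (\<Sum>i\<le>N. wtrace (int N) (\<lambda>x. smult V (b i) (A i x - smult V ((-1) ^ Suc s) (B i x))))"
    by (rule wtrace_sum) (intro weight_scale weight_diff Aw Bw)
  also have "\<dots> = (\<Sum>i\<le>N. b i * (wtrace (int N) (A i) - (-1) ^ Suc s * wtrace (int N) (B i)))"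
  proof (rule sum.cong[OF refl], goal_cases)
    case (1 i)
    have "wtrace (int N) (\<lambda>x. smult V (b i) (A i x - smult V ((-1) ^ Suc s) (B i x)))
       = b i * wtrace (int N) (\<lambda>x. A i x - smult V ((-1) ^ Suc s) (B i x))"
      by (rule wtrace_scale) (intro weight_scale weight_diff Aw Bw)
    also have "wtrace (int N) (\<lambda>x. A i x - smult V ((-1) ^ Suc s) (B i x))
       = wtrace (int N) (A i) - wtrace (int N) (\<lambda>x. smult V ((-1) ^ Suc s) (B i x))"
      by (rule wtrace_diff) (intro weight_scale Aw Bw, assumption)+
    also have "wtrace (int N) (\<lambda>x. smult V ((-1) ^ Suc s) (B i x)) = (-1) ^ Suc s * wtrace (int N) (B i)"
      by (rule wtrace_scale) (intro Bw)
    finally show ?case .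
  qed
  also have "\<dots> = (\<Sum>i\<le>N. b i * wtrace (int N) (A i)) - (-1) ^ Suc s * (\<Sum>i\<le>N. b i * wtrace (int N) (B i))"
    by (simp add: right_diff_distrib sum_subtractf sum_distrib_left mult_ac del: power_Suc)
  also have "(\<Sum>i\<le>N. b i * wtrace (int N) (A i))
     = - (\<Sum>k=1..N. ((of_nat k - 1) gchoose s) * fps_nth (lambert_fps k * commutator_fps (- of_nat k)) N)"
  proof -
    have "(\<Sum>i\<le>N. b i * wtrace (int N) (A i))
       = (\<Sum>i\<le>N. - (b i * fps_nth (lambert_fps (Suc s + i) * commutator_fps (- of_nat (Suc s + i))) N))"
    proof (rule sum.cong[OF refl], goal_cases)
      case (1 i)
      have "wtrace (int N) (A i) = fps_nth (left_fps wt v (- int (Suc s + i))) N"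
        unfolding left_fps_def A_def[abs_def] by (simp add: algebra_simps)
      also have "\<dots> = - fps_nth (lambert_fps (Suc s + i) * commutator_fps (- of_nat (Suc s + i))) N"
        by (subst left_fps_neg) simp_all
      finally show ?case
        by simp
    qed
    also have "\<dots> = - (\<Sum>i\<le>N. b i * fps_nth (lambert_fps (Suc s + i) * commutator_fps (- of_nat (Suc s + i))) N)"
      by (rule sum_negf)
    also have "(\<Sum>i\<le>N. b i * fps_nth (lambert_fps (Suc s + i) * commutator_fps (- of_nat (Suc s + i))) N)
       = (\<Sum>k\<in>{Suc s..Suc s + N}. of_nat ((k - 1) choose s) * fps_nth (lambert_fps k * commutator_fps (- of_nat k)) N)"
      by (rule sum.reindex_bij_witness[of _ "\<lambda>k. k - Suc s" "\<lambda>i. Suc s + i"]) (auto simp: b_def)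
    also have "\<dots> = (\<Sum>k=1..N. of_nat ((k - 1) choose s) * fps_nth (lambert_fps k * commutator_fps (- of_nat k)) N)"
      by (rule sum.mono_neutral_cong) (auto simp: lambert_fps_mult_nth_0 not_le)
    also have "\<dots> = (\<Sum>k=1..N. ((of_nat k - 1) gchoose s) * fps_nth (lambert_fps k * commutator_fps (- of_nat k)) N)"
      by (intro sum.cong refl) (simp add: binomial_gbinomial of_nat_diff)
    finally show ?thesis .
  qed
  also have "(-1) ^ Suc s * (\<Sum>i\<le>N. b i * wtrace (int N) (B i))
     = - (\<Sum>k=1..N. ((- of_nat k - 1) gchoose s) * fps_nth (lambert_fps k * commutator_fps (of_nat k)) N)"
  proof -
    have B0: "wtrace (int N) (B 0) = 0" by (simp add: B_def[abs_def] wtrace_zero)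
    have "(\<Sum>i\<le>N. b i * wtrace (int N) (B i)) = (\<Sum>i=1..N. b i * wtrace (int N) (B i))"
      by (rule sum.mono_neutral_right) (auto simp: B0 not_le)
    also have "\<dots> = (\<Sum>i=1..N. b i * fps_nth (lambert_fps i * commutator_fps (of_nat i)) N)"
    proof (rule sum.cong[OF refl], goal_cases)
      case i: (1 i)
      have "wtrace (int N) (B i) = fps_nth (right_fps wt v (int i)) N"
        unfolding right_fps_def B_def[abs_def] by simp
      also have "\<dots> = fps_nth (lambert_fps i * commutator_fps (of_nat i)) N"
        using i by (subst right_fps_pos) simp_all
      finally show ?case by simp
    qed
    finally have e: "(\<Sum>i\<le>N. b i * wtrace (int N) (B i)) = (\<Sum>i=1..N. b i * fps_nth (lambert_fps i * commutator_fps (of_nat i)) N)" .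
    have "(-1) ^ Suc s * b k = - ((- of_nat k - 1) gchoose s)" for k
    proof -
      have "(- of_nat k - 1 :: complex) gchoose s = (- (of_nat k + 1)) gchoose s" by simp
      also have "\<dots> = (-1) ^ s * ((of_nat k + 1 + of_nat s - 1) gchoose s)" by (rule gbinomial_minus)
      also have "(of_nat k + 1 + of_nat s - 1 :: complex) = of_nat (s + k)" by simp
      finally show ?thesis by (simp add: b_def binomial_gbinomial)
    qed
    then show ?thesis
      unfolding e sum_distrib_left mult.assoc [symmetric] by (simp only: sum_negf [symmetric]) simp
  qed
  finally show ?thesis by (simp add: sum_subtractf)
qed

text \<open>
  Split \<open>a[-n]\<close> into modes \<open>a(j)\<close> with \<open>j \<ge> 0\<close> and with \<open>j < 0\<close>. The former yield the Bernoulli numbers of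
  the constant term. The latter yield sums over \<open>k\<close>, in which the expansion coefficients combine to
  the coefficients \<open>(\<plusminus>k)\<^sup>n\<^sup>-\<^sup>1/(n-1)!\<close> of an exponential; the two signs come from the two orders of
  the factors, and summing over \<open>k\<close> gives divisor sums.
\<close>

lemma zhu_homogeneous:
  assumes "n \<ge> 1"
  shows "trace_fps (aq (- int n) v) = (\<Sum>m\<le>M. zhu_fps n m * trace_fps (aq (int m) v))"
proof -
  obtain n' where n': "n = Suc n'" using assms by (cases n) auto
  let ?y = "\<lambda>m. trace_fps (aq (int m) v)"
  have alg: "s1 * x / f * (y / g * z) - x / f * (s2 * y / g * z) = (s1 - s2) / (f * g) * (x * y * z)"
    for s1 s2 x y z f g :: complex
    by (simp add: divide_inverse algebra_simps)
  have "aq (- int n) v = (\<Sum>j=- int n..int M. smult V (sq_coeff (- int n) j) (ar j v))"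
    by (rule aq_eq) (use M in auto)
  also have "\<dots> = (\<Sum>j\<in>{- int n..-1} \<union> {0..int M}. smult V (sq_coeff (- int n) j) (ar j v))"
    by (rule arg_cong[where f = "sum _"]) auto
  also have "\<dots> = (\<Sum>j\<in>{- int n..-1}. smult V (sq_coeff (- int n) j) (ar j v))
      + (\<Sum>j\<in>{0..int M}. smult V (sq_coeff (- int n) j) (ar j v))"
    by (rule sum.union_disjoint) auto
  also have "(\<Sum>j\<in>{- int n..-1}. smult V (sq_coeff (- int n) j) (ar j v))
      = (\<Sum>s\<le>n'. smult V (sq_coeff (- int (Suc n')) (- int (Suc s))) (ar (- int (Suc s)) v))"
    by (rule sum.reindex_bij_witness[of _ "\<lambda>s. - int (Suc s)" "\<lambda>j. nat (- j - 1)"]) (auto simp: n')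
  also have "(\<Sum>j\<in>{0..int M}. smult V (sq_coeff (- int n) j) (ar j v))
      = (\<Sum>j\<le>M. smult V (sq_coeff (- int n) (int j)) (ar (int j) v))"
    by (rule sum.reindex_bij_witness[of _ int nat]) auto
  finally have split: "trace_fps (aq (- int n) v)
     = (\<Sum>s\<le>n'. fps_const (sq_coeff (- int (Suc n')) (- int (Suc s))) * trace_fps (ar (- int (Suc s)) v))
     + (\<Sum>j\<le>M. fps_const (sq_coeff (- int n) (int j)) * trace_fps (ar (int j) v))"
    by (simp only: trace_fps_add trace_fps_sum trace_fps_scale)
  have nonneg: "(\<Sum>j\<le>M. fps_const (sq_coeff (- int n) (int j)) * trace_fps (ar (int j) v))
     = (\<Sum>m\<le>M. fps_const (bern_coeff n m) * ?y m)"
  proof -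
    have "(\<Sum>m\<le>M. fps_const (bern_coeff n m) * ?y m)
       = (\<Sum>m\<le>M. \<Sum>j\<le>M. fps_const (bern_coeff n m * sq_coeff (int m) (int j)) * trace_fps (ar (int j) v))"
      unfolding aq_nonneg trace_fps_sum trace_fps_scale sum_distrib_left
      by (simp only: fps_const_scale_scale)
    also have "\<dots> = (\<Sum>j\<le>M. (\<Sum>m\<le>M. fps_const (bern_coeff n m * sq_coeff (int m) (int j))) * trace_fps (ar (int j) v))"
      by (subst sum.swap) (simp only: sum_distrib_right)
    also have "\<dots> = (\<Sum>j\<le>M. fps_const (sq_coeff (- int n) (int j)) * trace_fps (ar (int j) v))"
      by (intro sum.cong refl) (simp only: sum_bern_coeff[OF _ assms] fps_const_sum_eq [symmetric] atMost_iff)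
    finally show ?thesis by simp
  qed
  have neg: "fps_nth (\<Sum>s\<le>n'. fps_const (sq_coeff (- int (Suc n')) (- int (Suc s))) * trace_fps (ar (- int (Suc s)) v)) N
     = fps_nth (\<Sum>m\<le>M. fps_const (((-1) ^ n' - (-1) ^ m) / (fact n' * fact m)) * divisor_fps (n' + m) * ?y m) N" for N
  proof -
    let ?X = "\<lambda>k y. fps_nth (lambert_fps k * commutator_fps y) N"
    have "fps_nth (\<Sum>s\<le>n'. fps_const (sq_coeff (- int (Suc n')) (- int (Suc s))) * trace_fps (ar (- int (Suc s)) v)) N
       = (\<Sum>s\<le>n'. sq_coeff (- int (Suc n')) (- int (Suc s)) *
          (\<Sum>k=1..N. ((- of_nat k - 1) gchoose s) * ?X k (of_nat k) - ((of_nat k - 1) gchoose s) * ?X k (- of_nat k)))"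
      by (simp only: fps_sum_nth fps_mult_left_const_nth trace_negative_mode)
    also have "\<dots> = (\<Sum>k=1..N. (\<Sum>s\<le>n'. sq_coeff (- int (Suc n')) (- int (Suc s)) * ((- of_nat k - 1) gchoose s)) * ?X k (of_nat k)
       - (\<Sum>s\<le>n'. sq_coeff (- int (Suc n')) (- int (Suc s)) * ((of_nat k - 1) gchoose s)) * ?X k (- of_nat k))"
      unfolding sum_distrib_left
      by (subst sum.swap) (simp only: sum_distrib_right sum_subtractf [symmetric] right_diff_distrib mult.assoc)
    also have "\<dots> = (\<Sum>k=1..N. (- of_nat k) ^ n' / fact n' * ?X k (of_nat k) - of_nat k ^ n' / fact n' * ?X k (- of_nat k))"
      by (simp only: sum_sq_coeff_gbinomial)
    also have "\<dots> = (\<Sum>k=1..N. \<Sum>m\<le>M. ((-1) ^ n' - (-1) ^ m) / (fact n' * fact m) * (of_nat k ^ (n' + m) * fps_nth (lambert_fps k * ?y m) N))"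
    proof (rule sum.cong[OF refl], goal_cases)
      case (1 k)
      have X: "?X k z = (\<Sum>m\<le>M. z ^ m / fact m * fps_nth (lambert_fps k * ?y m) N)" for z
      proof -
        have "lambert_fps k * commutator_fps z = (\<Sum>m\<le>M. fps_const (z ^ m / fact m) * (lambert_fps k * ?y m))"
          unfolding commutator_fps_def sum_distrib_left by (simp only: ac_simps)
        then show ?thesis by (simp only: fps_sum_nth fps_mult_left_const_nth)
      qed
      show ?case
        unfolding X sum_distrib_left sum_subtractf [symmetric]
      proof (rule sum.cong[OF refl], goal_cases)
        case (1 m)
        let ?z = "fps_nth (lambert_fps k * ?y m) N"
        have p: "(- of_nat k) ^ j = (-1) ^ j * (of_nat k ^ j :: complex)" for j
          by (rule power_minus)
        show ?case
          unfolding p power_add by (rule alg)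
      qed
    qed
    also have "\<dots> = (\<Sum>m\<le>M. ((-1) ^ n' - (-1) ^ m) / (fact n' * fact m) * fps_nth (divisor_fps (n' + m) * ?y m) N)"
      by (subst sum.swap) (simp only: sum_distrib_left [symmetric] divisor_fps_mult_nth)
    also have "\<dots> = fps_nth (\<Sum>m\<le>M. fps_const (((-1) ^ n' - (-1) ^ m) / (fact n' * fact m)) * divisor_fps (n' + m) * ?y m) N"
      by (simp only: fps_sum_nth mult.assoc fps_mult_left_const_nth)
    finally show ?thesis .
  qed
  have "trace_fps (aq (- int n) v) = (\<Sum>m\<le>M. fps_const (((-1) ^ n' - (-1) ^ m) / (fact n' * fact m)) * divisor_fps (n' + m) * ?y m)
     + (\<Sum>m\<le>M. fps_const (bern_coeff n m) * ?y m)"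
    unfolding split nonneg using neg by (simp only: fps_eq_iff fps_add_nth) simp
  also have "\<dots> = (\<Sum>m\<le>M. zhu_fps n m * ?y m)"
    unfolding sum.distrib [symmetric] by (intro sum.cong refl) (simp add: zhu_fps_def n' algebra_simps)
  finally show ?thesis .
qed

end

end

context heisenberg_voa
begin

text \<open>
  The recursion is known for homogeneous vectors, with a cutoff depending on the vector. The cutoff is
  quantified so that the statement passes to linear combinations.
\<close>

lemma zhu_eventually:
  assumes n: "n \<ge> 1"
  shows "\<exists>M0. \<forall>M\<ge>M0. trace_fps (aq (- int n) v) = (\<Sum>m\<le>M. zhu_fps n m * trace_fps (aq (int m) v))"
proof -
  have "v \<in> vs.span (\<Union>k. weight_space V k)" using grading_spans by simp
  then show ?thesis
  proof (induction rule: vs.span_induct_alt)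
    case base
    then show ?case by (simp add: lin_zero[OF aq_lin])
  next
    case (step c x y)
    then obtain k M1 where x: "x \<in> weight_space V k"
      and M1: "\<And>M. M \<ge> M1 \<Longrightarrow> trace_fps (aq (- int n) y) = (\<Sum>m\<le>M. zhu_fps n m * trace_fps (aq (int m) y))"
      by auto
    obtain M2 where M2: "\<forall>m\<ge>M2. ar m x = 0" using truncation by blast
    have "trace_fps (aq (- int n) (smult V c x + y)) = (\<Sum>m\<le>M. zhu_fps n m * trace_fps (aq (int m) (smult V c x + y)))"
      if M: "M \<ge> max M1 (nat M2)" for M
    proof -
      have hx: "trace_fps (aq (- int n) x) = (\<Sum>m\<le>M. zhu_fps n m * trace_fps (aq (int m) x))"
        by (rule zhu_homogeneous[OF x _ n]) (use M M2 in auto)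
      show ?thesis
        using M M1[of M]
        by (simp add: lin_add[OF aq_lin] lin_scale[OF aq_lin] trace_fps_add trace_fps_scale hx
            sum_distrib_left sum.distrib algebra_simps)
    qed
    then show ?case by blast
  qed
qed

lemma zhu_trace_recursion:
  assumes n: "n \<ge> 1" and M: "\<And>m. m > M \<Longrightarrow> aq (int m) v = 0"
  shows "trace_fps (aq (- int n) v) = (\<Sum>m\<le>M. zhu_fps n m * trace_fps (aq (int m) v))"
proof -
  obtain M0 where M0: "\<forall>M\<ge>M0. trace_fps (aq (- int n) v) = (\<Sum>m\<le>M. zhu_fps n m * trace_fps (aq (int m) v))"
    using zhu_eventually[OF n] by blast
  have "trace_fps (aq (- int n) v) = (\<Sum>m\<le>max M M0. zhu_fps n m * trace_fps (aq (int m) v))"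
    using M0 by simp
  also have "\<dots> = (\<Sum>m\<le>M. zhu_fps n m * trace_fps (aq (int m) v))"
    by (rule sum.mono_neutral_right) (use M in \<open>auto simp: not_le\<close>)
  finally show ?thesis .
qed

section \<open>Convergence of the traces\<close>

lemma trace_coeff_vacuum: "trace_coeff (vacuum V) N = wtrace N (\<lambda>w. w)"
  unfolding trace_coeff_def
  by (rule wtrace_cong) (simp add: zero_mode_weight[OF vacuum_weight] vacuum)

lemma trace_fps_conformal: "trace_fps (conformal V) = fps_X * fps_deriv (trace_fps (vacuum V))"
proof (rule fps_ext)
  fix N
  have "trace_coeff (conformal V) (int N) = wtrace (int N) (\<lambda>w. smult V (of_nat N) w)"
    unfolding trace_coeff_def
  proof (rule wtrace_cong)
    fix w assume "w \<in> weight_space V (int N)"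
    then have "Lop V 0 w = smult V (of_nat N) w" by (simp add: weight_space_def)
    then show "zero_mode V (conformal V) w = smult V (of_nat N) w"
      by (simp add: zero_mode_weight[OF conformal_weight] Lop_def)
  qed
  also have "\<dots> = of_nat N * trace_coeff (vacuum V) (int N)"
    unfolding trace_coeff_vacuum by (rule wtrace_scale)
  finally show "fps_nth (trace_fps (conformal V)) N = fps_nth (fps_X * fps_deriv (trace_fps (vacuum V))) N"
    by (cases N) (simp_all add: trace_fps_def)
qed

lemma aq_a_values:
  "aq 1 a = vacuum V" "m > 1 \<Longrightarrow> aq (int m) a = 0"
  "aq (-1) a = smult V 2 (conformal V) + smult V (sq_coeff (-1) 1) (vacuum V)"
proof -
  have "aq 1 (aq (-1) (vacuum V)) = vacuum V"
    by (subst aq_commute) (simp add: aq_vacuum lin_zero[OF aq_lin])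
  then show "aq 1 a = vacuum V" by (simp add: aq_a)
  have "aq (int m) (aq (-1) (vacuum V)) = 0" if "m > 1" for m
    using that by (subst aq_commute) (simp add: aq_vacuum lin_zero[OF aq_lin])
  then show "m > 1 \<Longrightarrow> aq (int m) a = 0" by (simp add: aq_a)
  have ar_a: "ar m a = 0" if "m > 1" for m
    using that ar_commute[of m "-1" "vacuum V"] by (simp add: a_eq creation(2))
  have ar_1: "ar 1 a = vacuum V"
    using ar_commute[of 1 "-1" "vacuum V"] by (simp add: a_eq creation(2))
  have "aq (-1) a = (\<Sum>m=-1..1. smult V (sq_coeff (-1) m) (ar m a))"
    by (rule aq_eq) (use ar_a in auto)
  also have "{-1..1::int} = {-1, 0, 1}" by auto
  also have "(\<Sum>m\<in>{-1, 0, 1}. smult V (sq_coeff (-1) m) (ar m a)) = ar (-1) a + smult V (sq_coeff (-1) 1) (vacuum V)"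
    by (simp add: ar_1)
  also have "ar (-1) a = smult V 2 (conformal V)"
    by (simp add: conformal_eq a_eq)
  finally show "aq (-1) a = smult V 2 (conformal V) + smult V (sq_coeff (-1) 1) (vacuum V)" .
qed

text \<open>
  On the weight \<open>N\<close> space \<open>o(\<omega>) = L(0)\<close> is \<open>N\<close>, so the trace of \<open>\<omega>\<close> is \<open>q d/dq\<close> of the trace of the
  vacuum. As \<open>a[-1] a\<close> is a combination of \<open>\<omega>\<close> and the vacuum, the recursion for \<open>a[-1] a\<close> becomes
  Euler's equation for the generating function of partitions. This yields the convergence of the
  character without counting partitions.
\<close>

lemma vacuum_trace_ode: "fps_X * fps_deriv (trace_fps (vacuum V)) = divisor_fps 1 * trace_fps (vacuum V)"
proof -
  let ?t = "trace_fps (vacuum V)"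
  have "{..1::nat} = {0, 1}" by auto
  then have "trace_fps (aq (- int 1) a) = zhu_fps 1 1 * ?t"
    by (subst zhu_trace_recursion[of 1 1]) (simp_all add: aq_a_values)
  moreover have "trace_fps (aq (- int 1) a) = fps_const 2 * (fps_X * fps_deriv ?t) + fps_const (sq_coeff (-1) 1) * ?t"
    by (simp add: aq_a_values trace_fps_add trace_fps_scale trace_fps_conformal)
  moreover have "sq_coeff (-1) 1 = - sq_coeff (-2) 0"
    using sq_coeff_rec[of 0 "-1"] by simp
  then have "zhu_fps 1 1 = fps_const (sq_coeff (-1) 1) + fps_const 2 * divisor_fps 1"
    by (simp add: zhu_fps_def bern_coeff_def)
  ultimately have "fps_const 2 * (fps_X * fps_deriv ?t) = fps_const 2 * (divisor_fps 1 * ?t)"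
    by (simp add: algebra_simps)
  then show ?thesis by simp
qed

definition convergent_trace :: "'v \<Rightarrow> bool" where
  "convergent_trace v \<longleftrightarrow> fps_conv_radius (trace_fps v) \<ge> 1"

lemma convergent_trace_span:
  assumes "v \<in> vs.span S" and "\<And>s. s \<in> S \<Longrightarrow> convergent_trace s"
  shows "convergent_trace v"
  using assms(1)
proof (induction rule: vs.span_induct_alt)
  case base
  then show ?case by (simp add: convergent_trace_def)
next
  case (step c x y)
  then show ?case
    using assms(2)[of x] unfolding convergent_trace_def trace_fps_add trace_fps_scale
    by (intro fps_conv_radius_add_ge fps_conv_radius_mult_ge) simp_all
qed

text \<open>
  The recursion expresses the trace of a Fock vector by convergent series and traces of Fock
  vectors with fewer factors.
\<close>

lemma convergent_trace_sq_fock: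
  "0 \<notin> set ns \<Longrightarrow> convergent_trace (sq_fock ns)"
proof (induction "length ns" arbitrary: ns rule: less_induct)
  case less
  show ?case
  proof (cases ns)
    case Nil
    have "fps_conv_radius (trace_fps (vacuum V)) \<ge> 1"
      by (rule conv_radius_log_ode[OF vacuum_trace_ode divisor_fps_0 divisor_fps_conv_radius])
    then show ?thesis using Nil by (simp add: convergent_trace_def)
  next
    case (Cons n ms)
    then have n: "n \<ge> 1" and ms: "0 \<notin> set ms" using less.prems by auto
    have c: "convergent_trace (aq (int m) (sq_fock ms))" for m
    proof (rule convergent_trace_span[OF aq_sq_fock_span[OF ms]])
      fix s assume "s \<in> sq_fock ` {ls. 0 \<notin> set ls \<and> length ms = Suc (length ls)}"
      then show "convergent_trace s" using less.hyps Cons by auto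
    qed
    obtain M where "trace_fps (aq (- int n) (sq_fock ms)) = (\<Sum>m\<le>M. zhu_fps n m * trace_fps (aq (int m) (sq_fock ms)))"
      using zhu_eventually[OF n, of "sq_fock ms"] by blast
    then have "fps_conv_radius (trace_fps (aq (- int n) (sq_fock ms))) \<ge> 1"
      using c unfolding convergent_trace_def
      by (auto intro!: fps_conv_radius_sum_ge fps_conv_radius_mult_ge zhu_fps_conv_radius)
    then show ?thesis using Cons by (simp add: convergent_trace_def)
  qed
qed

lemma trace_fps_conv_radius: "fps_conv_radius (trace_fps v) \<ge> 1"
  using convergent_trace_span[of v "sq_fock ` {ns. 0 \<notin> set ns}"] convergent_trace_sq_fock sq_fock_span
  unfolding convergent_trace_def by auto

section \<open>Genus one functions\<close>

lemma genus_one_eq: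
  assumes "Im \<tau> > 0"
  shows "genus_one V v \<tau> = exp (- (2 * of_real pi * \<i> * \<tau> / 24)) * eval_fps (trace_fps v) (exp (2 * of_real pi * \<i> * \<tau>))"
proof -
  let ?q = "exp (2 * of_real pi * \<i> * \<tau>)" and ?e = "exp (- (2 * of_real pi * \<i> * \<tau> / 24))"
  let ?g = "\<lambda>n. trace_on V (weight_space V n) (zero_mode V v) * exp (2 * of_real pi * \<i> * \<tau> * (of_int n - central_charge V / 24))"
  have q: "ereal (norm ?q) < fps_conv_radius (trace_fps v)"
    using norm_nome[OF assms] by (intro less_le_trans[OF _ trace_fps_conv_radius]) simp
  have "summable (\<lambda>n. norm (fps_nth (trace_fps v) n * ?q ^ n))"
    using q unfolding fps_conv_radius_def by (rule abs_summable_in_conv_radius)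
  moreover have "(\<lambda>n. fps_nth (trace_fps v) n * ?q ^ n) sums eval_fps (trace_fps v) ?q"
    unfolding eval_fps_def by (rule summable_sums[OF summable_fps[OF q]])
  ultimately have "((\<lambda>n. fps_nth (trace_fps v) n * ?q ^ n) has_sum eval_fps (trace_fps v) ?q) UNIV"
    by (rule norm_summable_imp_has_sum)
  then have hs: "((\<lambda>n. ?e * (fps_nth (trace_fps v) n * ?q ^ n)) has_sum ?e * eval_fps (trace_fps v) ?q) UNIV"
    by (rule has_sum_cmult_right)
  have g: "?g (int n) = ?e * (fps_nth (trace_fps v) n * ?q ^ n)" for n
  proof -
    have "exp (2 * of_real pi * \<i> * \<tau> * (of_int (int n) - central_charge V / 24)) = ?e * ?q ^ n"
      by (simp add: exp_of_nat_mult [symmetric] exp_add [symmetric] central_charge_one algebra_simps)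
    then show ?thesis by (simp add: trace_on_weight trace_fps_def trace_coeff_def)
  qed
  have "infsum ?g UNIV = infsum ?g (int ` UNIV)"
  proof (rule infsum_cong_neutral)
    fix n :: int assume "n \<in> UNIV - range int"
    then have "n < 0" by (metis DiffE nonneg_int_cases not_le rangeI)
    then show "?g n = 0" by (simp add: trace_on_weight wtrace_negative)
  qed auto
  also have "\<dots> = infsum (?g \<circ> int) UNIV"
    by (rule infsum_reindex) simp
  also have "\<dots> = ?e * eval_fps (trace_fps v) ?q"
    unfolding o_def g using hs by (rule infsumI)
  finally show ?thesis by (simp add: genus_one_def)
qed

lemma genus_one_add:
  assumes "Im \<tau> > 0"
  shows "genus_one V (u + v) \<tau> = genus_one V u \<tau> + genus_one V v \<tau>"
proof -
  have q: "ereal (norm (exp (2 * of_real pi * \<i> * \<tau>))) < fps_conv_radius (trace_fps w)" for w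
    using norm_nome[OF assms] by (intro less_le_trans[OF _ trace_fps_conv_radius]) simp
  show ?thesis
    unfolding genus_one_eq[OF assms] trace_fps_add by (subst eval_fps_add[OF q q]) (rule distrib_left)
qed

lemma genus_one_scale:
  assumes "Im \<tau> > 0"
  shows "genus_one V (smult V c v) \<tau> = c * genus_one V v \<tau>"
proof -
  have q: "ereal (norm (exp (2 * of_real pi * \<i> * \<tau>))) < fps_conv_radius (trace_fps w)" for w
    using norm_nome[OF assms] by (intro less_le_trans[OF _ trace_fps_conv_radius]) simp
  show ?thesis
    unfolding genus_one_eq[OF assms] trace_fps_scale by (subst eval_fps_mult[OF _ q]) simp_all
qed

text \<open>
  The functional \<open>v \<mapsto> Z\<^sup>(\<^sup>1\<^sup>)(v,\<tau>)\<close> on polynomials in the \<open>a[-n]\<close> is Gaussian with covariance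
  \<open>C(n,m,\<tau>)\<close>, since \<open>a[m]/m\<close> is the derivative with respect to \<open>a[-m]\<close>.
\<close>

lemma genus_one_zhu:
  assumes tau: "Im \<tau> > 0" and n: "n \<ge> 1" and M: "\<And>m. m > M \<Longrightarrow> aq (int m) v = 0"
  shows "genus_one V (aq (- int n) v) \<tau> = (\<Sum>m=1..M. C_coeff n m \<tau> / of_nat m * genus_one V (aq (int m) v) \<tau>)"
proof -
  let ?q = "exp (2 * of_real pi * \<i> * \<tau>)" and ?e = "exp (- (2 * of_real pi * \<i> * \<tau> / 24))"
  have q1: "ereal (norm ?q) < 1" using norm_nome[OF tau] by simp
  have q: "ereal (norm ?q) < fps_conv_radius (trace_fps w)" for w
    by (rule less_le_trans[OF q1 trace_fps_conv_radius])
  have qz: "ereal (norm ?q) < fps_conv_radius (zhu_fps n m)" for m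
    by (rule less_le_trans[OF q1 zhu_fps_conv_radius])
  have "eval_fps (trace_fps (aq (- int n) v)) ?q = eval_fps (\<Sum>m\<le>M. zhu_fps n m * trace_fps (aq (int m) v)) ?q"
    by (simp only: zhu_trace_recursion[OF n M])
  also have "\<dots> = (\<Sum>m\<le>M. eval_fps (zhu_fps n m * trace_fps (aq (int m) v)) ?q)"
    by (rule eval_fps_sum[OF _ q1]) (intro fps_conv_radius_mult_ge zhu_fps_conv_radius trace_fps_conv_radius)
  also have "\<dots> = (\<Sum>m\<le>M. eval_fps (zhu_fps n m) ?q * eval_fps (trace_fps (aq (int m) v)) ?q)"
    by (intro sum.cong refl eval_fps_mult qz q)
  also have "\<dots> = (\<Sum>m=1..M. eval_fps (zhu_fps n m) ?q * eval_fps (trace_fps (aq (int m) v)) ?q)"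
    by (rule sum.mono_neutral_right) (auto simp: not_le)
  also have "\<dots> = (\<Sum>m=1..M. C_coeff n m \<tau> / of_nat m * eval_fps (trace_fps (aq (int m) v)) ?q)"
    by (intro sum.cong refl) (simp add: eval_zhu_fps[OF tau n])
  finally show ?thesis
    unfolding genus_one_eq[OF tau] by (simp add: sum_distrib_left mult_ac)
qed

end

section \<open>The Li-Zamolodchikov metric\<close>

context vertex_operator_algebra
begin

abbreviation linear_form :: "('v \<Rightarrow> complex) \<Rightarrow> bool" where
  "linear_form \<equiv> Vector_Spaces.linear (smult V) (*)"

lemma linear_formI:
  assumes "\<And>x y. f (x + y) = f x + f y" and "\<And>c x. f (smult V c x) = c * f x"
  shows "linear_form f"
proof -
  have "vector_space ((*) :: complex \<Rightarrow> complex \<Rightarrow> complex)"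
    by unfold_locales (simp_all add: algebra_simps)
  then show ?thesis
    using assms vector_space by (simp add: Vector_Spaces.linear_iff)
qed

lemma form_add: "linear_form f \<Longrightarrow> f (x + y) = f x + f y"
  and form_scale: "linear_form f \<Longrightarrow> f (smult V c x) = c * f x"
  by (simp_all add: Vector_Spaces.linear_iff)

lemma form_zero: "linear_form f \<Longrightarrow> f 0 = 0"
  using form_add[of f 0 0] by simp

lemma form_neg: "linear_form f \<Longrightarrow> f (- x) = - f x"
  using form_add[of f x "- x"] form_zero[of f] by (simp add: add_eq_0_iff)

lemma form_diff: "linear_form f \<Longrightarrow> f (x - y) = f x - f y"
  using form_add[of f x "- y"] form_neg[of f y] by simp

lemma form_sum: "linear_form f \<Longrightarrow> f (sum g A) = (\<Sum>i\<in>A. f (g i))"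
  by (induction A rule: infinite_finite_induct) (simp_all add: form_add form_zero)

lemma form_span_zero:
  assumes "linear_form f" and "x \<in> vs.span T" and "\<And>t. t \<in> T \<Longrightarrow> f t = 0"
  shows "f x = 0"
  using assms(2)
  by (induction rule: vs.span_induct_alt)
    (simp_all add: form_zero[OF assms(1)] form_add[OF assms(1)] form_scale[OF assms(1)] assms(3))

text \<open>
  Nondegeneracy makes the map \<open>w \<mapsto> \<Sum> B(u',w) u'\<close> injective on the span of \<open>S\<close>. It therefore maps \<open>S\<close>
  to an independent set of the same size, which must span, and a preimage of \<open>u\<close> is the dual
  vector.
\<close>

lemma dual_vector_exists:
  assumes fin: "finite S" and ind: "vs.independent S"
    and B1: "\<And>v. linear_form (\<lambda>u. B u v)" and B2: "\<And>u. linear_form (B u)"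
    and nondeg: "\<And>w. w \<in> vs.span S \<Longrightarrow> (\<And>u. u \<in> S \<Longrightarrow> B u w = 0) \<Longrightarrow> w = 0"
    and u: "u \<in> S"
  shows "\<exists>!w. w \<in> vs.span S \<and> (\<forall>u'\<in>S. B u' w = (if u' = u then 1 else 0))"
proof -
  define T where "T w = (\<Sum>u'\<in>S. smult V (B u' w) u')" for w
  have T: "lin T"
    by (rule linI)
      (simp_all add: T_def form_add[OF B2] form_scale[OF B2] vs.scale_left_distrib sum.distrib vs.scale_sum_right)
  have coeffs: "\<forall>u'\<in>S. c u' = d u'" if "(\<Sum>u'\<in>S. smult V (c u') u') = (\<Sum>u'\<in>S. smult V (d u') u')" for c d
  proof -
    have "(\<Sum>u'\<in>S. smult V (c u' - d u') u') = 0"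
      using that by (simp add: vs.scale_left_diff_distrib sum_subtractf)
    then have "c u' - d u' = 0" if "u' \<in> S" for u'
      using that by (rule vs.independentD[OF ind fin order.refl])
    then show ?thesis by simp
  qed
  have hom: "module_hom (smult V) (smult V) T" using T by (simp add: module_hom_iff_linear)
  have T0: "w = 0" if "w \<in> vs.span S" "T w = 0" for w
  proof (rule nondeg[OF that(1)])
    fix u' assume "u' \<in> S"
    then show "B u' w = 0" using coeffs[of "\<lambda>u'. B u' w" "\<lambda>_. 0"] that(2) by (simp add: T_def)
  qed
  have inj: "inj_on T (vs.span S)"
  proof (rule inj_onI)
    fix x y assume "x \<in> vs.span S" "y \<in> vs.span S" "T x = T y"
    then have "x - y \<in> vs.span S" "T (x - y) = 0" by (simp_all add: vs.span_diff lin_diff[OF T])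
    then have "x - y = 0" by (rule T0)
    then show "x = y" by simp
  qed
  have indT: "vs.independent (T ` S)"
    by (rule module_hom.independent_injective_image[OF hom ind inj])
  have cardT: "card (T ` S) = card S"
    by (rule card_image) (rule inj_on_subset[OF inj vs.span_superset])
  have TS: "T w \<in> vs.span S" for w
    unfolding T_def by (intro vs.span_sum vs.span_scale vs.span_base)
  have "u \<in> vs.span (T ` S)"
  proof (rule ccontr)
    assume u': "u \<notin> vs.span (T ` S)"
    then have "vs.independent (insert u (T ` S))" using indT by (rule vs.independent_insertI)
    then have "card (insert u (T ` S)) \<le> card S"
      using vs.independent_span_bound[OF fin] TS u vs.span_base by blast
    moreover have "u \<notin> T ` S" using u' vs.span_base by blast
    ultimately show False using fin cardT by simp
  qed
  then obtain w where w: "w \<in> vs.span S" "T w = u"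
    unfolding module_hom.span_image[OF hom] by blast
  have "(\<Sum>u'\<in>S. smult V (B u' w) u') = (\<Sum>u'\<in>S. smult V (if u' = u then 1 else 0) u')"
  proof -
    have "(\<Sum>u'\<in>S. smult V (if u' = u then 1 else 0) u') = (\<Sum>u'\<in>S. if u' = u then u' else 0)"
      by (rule sum.cong) auto
    also have "\<dots> = u" using fin u by simp
    finally show ?thesis using w(2) by (simp add: T_def)
  qed
  then have Bw: "\<forall>u'\<in>S. B u' w = (if u' = u then 1 else 0)" by (rule coeffs)
  show ?thesis
  proof (rule ex1I[of _ w])
    show "w \<in> vs.span S \<and> (\<forall>u'\<in>S. B u' w = (if u' = u then 1 else 0))" using w Bw by simp
    fix x assume x: "x \<in> vs.span S \<and> (\<forall>u'\<in>S. B u' x = (if u' = u then 1 else 0))"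
    have "x - w = 0"
      by (rule nondeg) (use x w Bw in \<open>simp_all add: vs.span_diff form_diff[OF B2]\<close>)
    then show "x = w" by simp
  qed
qed

end

locale heisenberg_metric = heisenberg_voa V a
  for V :: "'v::ab_group_add vertex_structure" and a :: 'v +
  fixes B :: "'v \<Rightarrow> 'v \<Rightarrow> complex" and S :: "nat \<Rightarrow> 'v set"
  assumes metric: "is_LiZ_metric (square_bracket V) B"
    and basis: "is_basis_of V (sq_weight (int n)) (S n)"
begin

lemma B_right: "linear_form (B u)" and B_left: "linear_form (\<lambda>u. B u v)"
  using metric by (simp_all add: is_LiZ_metric_def square_bracket_def)

text \<open>
  The generator is primary of weight one, so only the term \<open>i = 0\<close> of the invariance condition
  survives, with the sign \<open>(-1)\<^sup>1\<close>.
\<close>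

lemma B_adjoint: "B (aq n u) v = - B u (aq (- n) v)"
proof -
  let ?L = "\<lambda>i. (Lop (square_bracket V) 1 ^^ i) a"
  have "B (mode (square_bracket V) a n u) v =
        Sum_any (\<lambda>i::nat. (-1) powi 1 / fact i * B u (mode (square_bracket V) (?L i) (2 * 1 - n - 2 - int i) v))"
    using metric generator_sq_weight unfolding is_LiZ_metric_def by blast
  also have "\<dots> = (\<Sum>i\<in>{0::nat}. (-1) powi 1 / fact i * B u (mode (square_bracket V) (?L i) (2 * 1 - n - 2 - int i) v))"
  proof (rule Sum_any.expand_superset)
    have L0: "?L (Suc i) = 0" for i
      by (induction i) (simp_all add: Lsq_def[symmetric] Lsq_1_a lin_zero[OF Lsq_lin])
    have "(Lop V 0 ^^ j) 0 = 0" for j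
      by (induction j) (simp_all add: lin_zero[OF Lop_lin])
    then have sq0: "sq_mode V 0 m v = 0" for m
      by (simp add: sq_mode_def)
    have "B u (mode (square_bracket V) (?L i) (2 * 1 - n - 2 - int i) v) = 0" if "i \<noteq> 0" for i
      using that L0[of "i - 1"] by (simp add: square_bracket_def[of V, THEN arg_cong[where f = mode]] sq0 form_zero[OF B_right])
    then show "{i. (-1) powi 1 / fact i * B u (mode (square_bracket V) (?L i) (2 * 1 - n - 2 - int i) v) \<noteq> 0} \<subseteq> {0}"
      by auto
  qed simp
  finally show ?thesis by (simp add: square_bracket_def)
qed

text \<open>
  Moving the creation operators of the first argument one by one to the second leaves the pairing
  of the vacuum with a vector of nonzero weight. That vector is a combination of vectors
  \<open>a[-l] w\<close>, and \<open>a[l]\<close> kills the vacuum.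
\<close>

lemma B_orthogonal_sq_fock:
  assumes "0 \<notin> set ns" and "v \<in> sq_weight k" and "int (sum_list ns) \<noteq> k"
  shows "B (sq_fock ns) v = 0"
  using assms
proof (induction ns arbitrary: v k)
  case Nil
  show ?case
  proof (rule form_span_zero[OF B_right sq_weight_span[OF Nil.prems(2)]])
    fix t assume "t \<in> sq_fock ` {ns. 0 \<notin> set ns \<and> int (sum_list ns) = k}"
    then obtain ms where ms: "t = sq_fock ms" "int (sum_list ms) = k" by auto
    then obtain l ls where "ms = l # ls" using Nil.prems(3) by (cases ms) auto
    then show "B (sq_fock []) t = 0"
      using B_adjoint[of "int l" "vacuum V" "sq_fock ls"] ms by (simp add: aq_vacuum form_zero[OF B_left])
  qed
next
  case (Cons n ns)
  have "B (sq_fock ns) (aq (int n) v) = 0"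
    by (rule Cons.IH[OF _ aq_weight[OF Cons.prems(2)]]) (use Cons.prems in auto)
  then show ?case using B_adjoint[of "- int n" "sq_fock ns" v] by simp
qed

lemma span_S: "vs.span (S n) = sq_weight (int n)" and independent_S: "vs.independent (S n)"
  using basis[of n] by (simp_all add: is_basis_of_def)

lemma finite_S: "finite (S n)"
proof -
  have "S n \<subseteq> vs.span (sq_fock ` {ns. 0 \<notin> set ns \<and> int (sum_list ns) = int n})"
    using sq_weight_span span_S vs.span_superset by blast
  then show ?thesis
    using vs.independent_span_bound[OF finite_imageI[OF finite_positive_lists] independent_S] by blast
qed

text \<open>
  Different weight spaces being orthogonal, nondegeneracy is inherited by each of them.
\<close>

lemma B_nondegenerate:
  assumes v: "v \<in> sq_weight (int n)" and 0: "\<And>u. u \<in> S n \<Longrightarrow> B u v = 0"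
  shows "v = 0"
proof -
  have n0: "B u v = 0" if "u \<in> sq_weight (int n)" for u
    using that 0 unfolding span_S[symmetric] by (rule form_span_zero[OF B_left])
  have "B u v = 0" for u
  proof (rule form_span_zero[OF B_left])
    show "u \<in> vs.span (sq_fock ` {ns. 0 \<notin> set ns})" by (simp add: sq_fock_span)
    fix t assume "t \<in> sq_fock ` {ns. 0 \<notin> set ns}"
    then obtain ns where ns: "t = sq_fock ns" "0 \<notin> set ns" by auto
    show "B t v = 0"
    proof (cases "sum_list ns = n")
      case True
      then show ?thesis using n0[of t] sq_fock_weight[of ns] ns by simp
    next
      case False
      then show ?thesis using B_orthogonal_sq_fock[OF ns(2) v] ns by simp
    qed
  qed
  then show ?thesis using metric by (simp add: is_LiZ_metric_def)
qed

abbreviation dual :: "nat \<Rightarrow> 'v \<Rightarrow> 'v" where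
  "dual n \<equiv> dual_vector V B (S n)"

lemma dual:
  assumes "u \<in> S n"
  shows "dual n u \<in> sq_weight (int n)" and "u' \<in> S n \<Longrightarrow> B u' (dual n u) = (if u' = u then 1 else 0)"
proof -
  have "w = 0" if "w \<in> vs.span (S n)" "\<And>u. u \<in> S n \<Longrightarrow> B u w = 0" for w
    by (rule B_nondegenerate[OF that(1)[unfolded span_S] that(2)])
  then have "\<exists>!w. w \<in> vs.span (S n) \<and> (\<forall>u'\<in>S n. B u' w = (if u' = u then 1 else 0))"
    by (rule dual_vector_exists[OF finite_S independent_S B_left B_right _ assms])
  then have "dual n u \<in> vs.span (S n) \<and> (\<forall>u'\<in>S n. B u' (dual n u) = (if u' = u then 1 else 0))"
    unfolding dual_vector_def by (rule theI')
  then show "dual n u \<in> sq_weight (int n)" and "u' \<in> S n \<Longrightarrow> B u' (dual n u) = (if u' = u then 1 else 0)"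
    by (simp_all add: span_S)
qed

lemma S_weight: "u \<in> S n \<Longrightarrow> u \<in> sq_weight (int n)"
  using span_S vs.span_base by blast

lemma basis_expansion:
  assumes "v \<in> sq_weight (int n)"
  shows "v = (\<Sum>u\<in>S n. smult V (B v (dual n u)) u)"
proof -
  let ?r = "vs.representation (S n) v"
  have v: "v = (\<Sum>u\<in>S n. smult V (?r u) u)"
    using assms independent_S finite_S by (intro vs.sum_representation_eq[symmetric]) (auto simp: span_S)
  have "B v (dual n u) = ?r u" if "u \<in> S n" for u
  proof -
    have "B v (dual n u) = B (\<Sum>u\<in>S n. smult V (?r u) u) (dual n u)"
      by (rule arg_cong[where f = "\<lambda>x. B x (dual n u)", OF v])
    also have "\<dots> = (\<Sum>u'\<in>S n. ?r u' * B u' (dual n u))"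
      by (simp only: form_sum[OF B_left] form_scale[OF B_left])
    also have "\<dots> = (\<Sum>u'\<in>S n. if u' = u then ?r u' else 0)"
      using that by (intro sum.cong refl) (simp add: dual(2))
    also have "\<dots> = ?r u" using that finite_S by simp
    finally show ?thesis .
  qed
  then have "(\<Sum>u\<in>S n. smult V (B v (dual n u)) u) = (\<Sum>u\<in>S n. smult V (?r u) u)"
    by (intro sum.cong refl) simp
  also have "\<dots> = v" by (rule v[symmetric])
  finally show ?thesis by simp
qed

lemma dual_expansion:
  assumes "v \<in> sq_weight (int n)"
  shows "v = (\<Sum>u\<in>S n. smult V (B u v) (dual n u))"
proof -
  let ?w = "\<Sum>u\<in>S n. smult V (B u v) (dual n u)"
  have "?w \<in> vs.span (S n)"
    by (intro vs.span_sum vs.span_scale) (simp add: span_S dual(1))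
  then have "v - ?w \<in> vs.span (S n)"
    using assms by (intro vs.span_diff) (simp_all add: span_S)
  then have "v - ?w \<in> sq_weight (int n)" by (simp only: span_S)
  moreover have "B u' (v - ?w) = 0" if "u' \<in> S n" for u'
  proof -
    have "B u' ?w = (\<Sum>u\<in>S n. B u v * B u' (dual n u))"
      by (simp only: form_sum[OF B_right] form_scale[OF B_right])
    also have "\<dots> = (\<Sum>u\<in>S n. if u = u' then B u v else 0)"
      using that by (intro sum.cong refl) (simp add: dual(2))
    also have "\<dots> = B u' v" using that finite_S by simp
    finally show ?thesis by (simp add: form_diff[OF B_right])
  qed
  ultimately have "v - ?w = 0" by (rule B_nondegenerate)
  then show ?thesis by simp
qed

section \<open>The Casimir element of the metric\<close>

definition casimir :: "nat \<Rightarrow> ('v \<Rightarrow> 'v \<Rightarrow> complex) \<Rightarrow> complex" where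
  "casimir n \<beta> = (\<Sum>u\<in>S n. \<beta> u (dual n u))"

text \<open>
  \<open>\<Sum> u \<otimes> dual u\<close> represents the identity, so an operator acting on one tensor factor may be
  replaced by its adjoint acting on the other. Taking \<open>k\<close> to be an integer covers both directions,
  from the second factor to the first and back.
\<close>

lemma casimir_move:
  assumes l: "\<And>y. linear_form (\<lambda>x. \<beta> x y)" and r: "\<And>x. linear_form (\<beta> x)"
    and m: "int m = int n + k"
  shows "casimir n (\<lambda>x y. \<beta> x (aq (- k) y)) = - casimir m (\<lambda>x y. \<beta> (aq k x) y)"
proof -
  have "casimir n (\<lambda>x y. \<beta> x (aq (- k) y))
     = (\<Sum>u\<in>S n. \<Sum>u'\<in>S m. B u' (aq (- k) (dual n u)) * \<beta> u (dual m u'))"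
    unfolding casimir_def
  proof (rule sum.cong[OF refl], goal_cases)
    case u: (1 u)
    have "aq (- k) (dual n u) \<in> sq_weight (int m)"
      using aq_weight[OF dual(1)[OF u], of "- k"] m by simp
    from dual_expansion[OF this]
    have "\<beta> u (aq (- k) (dual n u)) = \<beta> u (\<Sum>u'\<in>S m. smult V (B u' (aq (- k) (dual n u))) (dual m u'))"
      by (rule arg_cong)
    then show ?case by (simp only: form_sum[OF r] form_scale[OF r])
  qed
  also have "\<dots> = (\<Sum>u'\<in>S m. \<Sum>u\<in>S n. - (B (aq k u') (dual n u) * \<beta> u (dual m u')))"
    by (subst sum.swap) (simp add: B_adjoint)
  also have "\<dots> = (\<Sum>u'\<in>S m. - \<beta> (aq k u') (dual m u'))"
  proof (rule sum.cong[OF refl], goal_cases)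
    case u': (1 u')
    have "aq k u' \<in> sq_weight (int n)"
      using aq_weight[OF S_weight[OF u'], of k] m by simp
    from basis_expansion[OF this]
    have "\<beta> (aq k u') (dual m u') = \<beta> (\<Sum>u\<in>S n. smult V (B (aq k u') (dual n u)) u) (dual m u')"
      by (rule arg_cong)
    then show ?case by (simp only: form_sum[OF l] form_scale[OF l] sum_negf)
  qed
  finally show ?thesis by (simp add: casimir_def sum_negf)
qed

end

context heisenberg_voa
begin

text \<open>
  The operator \<open>\<Sum> a[-k] a[k]\<close> is a derivation of the algebra of creation operators which
  multiplies \<open>a[-m]\<close> by \<open>m\<close>.
\<close>

lemma number_operator_sq_fock:
  assumes "0 \<notin> set ns" and "sum_list ns \<le> n"
  shows "(\<Sum>k=1..n. aq (- int k) (aq (int k) (sq_fock ns))) = smult V (of_nat (sum_list ns)) (sq_fock ns)"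
  using assms
proof (induction ns)
  case Nil
  then show ?case by (simp add: aq_vacuum lin_zero[OF aq_lin])
next
  case (Cons m ns)
  have m: "m \<in> {1..n}" and ns: "0 \<notin> set ns" "sum_list ns \<le> n" using Cons.prems by auto
  have "(\<Sum>k=1..n. aq (- int k) (aq (int k) (aq (- int m) (sq_fock ns))))
     = (\<Sum>k=1..n. aq (- int m) (aq (- int k) (aq (int k) (sq_fock ns))) + (if k = m then smult V (of_nat m) (aq (- int m) (sq_fock ns)) else 0))"
  proof (rule sum.cong[OF refl], goal_cases)
    case k: (1 k)
    have "aq (- int k) (aq (int k) (aq (- int m) (sq_fock ns)))
      = aq (- int k) (aq (- int m) (aq (int k) (sq_fock ns))) + (if k = m then smult V (of_nat m) (aq (- int m) (sq_fock ns)) else 0)"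
      by (subst aq_commute[of "int k"]) (simp add: lin_add[OF aq_lin] lin_scale[OF aq_lin] lin_zero[OF aq_lin])
    also have "aq (- int k) (aq (- int m) (aq (int k) (sq_fock ns))) = aq (- int m) (aq (- int k) (aq (int k) (sq_fock ns)))"
      using k m by (subst aq_commute) simp
    finally show ?case .
  qed
  also have "\<dots> = aq (- int m) (\<Sum>k=1..n. aq (- int k) (aq (int k) (sq_fock ns))) + smult V (of_nat m) (aq (- int m) (sq_fock ns))"
    using m by (simp add: sum.distrib lin_sum[OF aq_lin])
  also have "\<dots> = smult V (of_nat (sum_list ns) + of_nat m) (aq (- int m) (sq_fock ns))"
    unfolding Cons.IH[OF ns] lin_scale[OF aq_lin] vs.scale_left_distrib ..
  finally show ?case by (simp add: add.commute)
qed

lemma number_operator: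
  assumes "v \<in> sq_weight (int n)"
  shows "(\<Sum>k=1..n. aq (- int k) (aq (int k) v)) = smult V (of_nat n) v"
  using sq_weight_span[OF assms]
proof (induction rule: vs.span_induct_alt)
  case base
  then show ?case by (simp add: lin_zero[OF aq_lin])
next
  case (step c x y)
  then obtain ns where ns: "x = sq_fock ns" "0 \<notin> set ns" "sum_list ns = n" by auto
  have "(\<Sum>k=1..n. aq (- int k) (aq (int k) (smult V c x + y)))
     = smult V c (\<Sum>k=1..n. aq (- int k) (aq (int k) x)) + (\<Sum>k=1..n. aq (- int k) (aq (int k) y))"
    by (simp add: lin_add[OF aq_lin] lin_scale[OF aq_lin] sum.distrib vs.scale_sum_right)
  also have "\<dots> = smult V (of_nat n) (smult V c x + y)"
    using number_operator_sq_fock[OF ns(2), of n] ns step.IH by (simp add: vs.scale_right_distrib mult.commute)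
  finally show ?case .
qed

end

section \<open>Walks with alternating edge labels\<close>

text \<open>
  The pairs are a node and the label of the edge leaving it, as in chequered cycles; labels one and
  two are exchanged by \<open>e \<mapsto> 3 - e\<close>.
\<close>

fun alternates :: "nat \<Rightarrow> (nat \<times> nat) list \<Rightarrow> bool" where
  "alternates e [] \<longleftrightarrow> True"
| "alternates e ((k, e') # ys) \<longleftrightarrow> k > 0 \<and> e' = e \<and> alternates (3 - e) ys"

text \<open>
  The walk \<open>ys\<close> ends at the node \<open>j\<close>. Node labels divide the weight at the inner nodes only, and
  powers of \<open>\<epsilon>\<close> are accounted for by \<open>label_sum\<close>; for a closed walk the result is the coefficient of
  the cycle weight times the label of the root, see \<open>walk_weight_closed\<close>.
\<close>

fun walk_weight :: "(nat \<Rightarrow> nat \<Rightarrow> nat \<Rightarrow> complex) \<Rightarrow> (nat \<times> nat) list \<Rightarrow> nat \<Rightarrow> complex" where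
  "walk_weight C [] j = 1"
| "walk_weight C [(k, e)] j = C e k j"
| "walk_weight C ((k, e) # (l, e') # ys) j = C e k l / of_nat l * walk_weight C ((l, e') # ys) j"

definition label_sum :: "(nat \<times> nat) list \<Rightarrow> nat" where
  "label_sum ys = sum_list (map fst ys)"

lemma label_sum_simps [simp]: "label_sum [] = 0" "label_sum ((k, e) # ys) = k + label_sum ys"
  by (simp_all add: label_sum_def)

text \<open>
  The parity of the length decides on which of the two tori the walk ends.
\<close>

definition walks :: "bool \<Rightarrow> nat \<Rightarrow> nat \<Rightarrow> (nat \<times> nat) list set" where
  "walks par e n = {ys. alternates e ys \<and> label_sum ys = n \<and> (even (length ys) \<longleftrightarrow> par)}"

lemma alternates_bounds:
  "alternates e ys \<Longrightarrow> e \<le> 3 \<Longrightarrow> length ys \<le> label_sum ys \<and> set ys \<subseteq> {..label_sum ys} \<times> {..3}"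
proof (induction e ys rule: alternates.induct)
  case (2 e k e' ys)
  then have "length ys \<le> label_sum ys" "set ys \<subseteq> {..label_sum ys} \<times> {..3}" by auto
  then show ?case using 2 by force
qed simp

lemma finite_walks: "e \<le> 3 \<Longrightarrow> finite (walks par e n)"
proof -
  assume "e \<le> 3"
  then have "walks par e n \<subseteq> {ys. set ys \<subseteq> {..n} \<times> {..3} \<and> length ys \<le> n}"
    unfolding walks_def using alternates_bounds by blast
  then show ?thesis by (rule finite_subset) (simp add: finite_lists_length_le)
qed

lemma walks_decompose:
  "walks par e n = (if par \<and> n = 0 then {[]} else {})
     \<union> (\<Union>l\<in>{1..n}. (\<lambda>ys. (l, e) # ys) ` walks (\<not> par) (3 - e) (n - l))"
  (is "?L = ?R")
proof (rule set_eqI)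
  fix xs
  show "xs \<in> ?L \<longleftrightarrow> xs \<in> ?R"
  proof (cases xs)
    case Nil
    then show ?thesis by (auto simp: walks_def)
  next
    case (Cons x ys)
    obtain l e' where x: "x = (l, e')" by (cases x)
    have "xs \<in> ?R \<longleftrightarrow> e' = e \<and> l \<in> {1..n} \<and> ys \<in> walks (\<not> par) (3 - e) (n - l)"
      unfolding Cons x by auto
    moreover have "xs \<in> ?L \<longleftrightarrow> e' = e \<and> l \<in> {1..n} \<and> ys \<in> walks (\<not> par) (3 - e) (n - l)"
      unfolding Cons x walks_def by auto
    ultimately show ?thesis by simp
  qed
qed

lemma sum_walks:
  assumes e: "e \<le> 3"
  shows "(\<Sum>ys\<in>walks par e n. h ys) = (if par \<and> n = 0 then h [] else (0 :: complex))
     + (\<Sum>l=1..n. \<Sum>ys\<in>walks (\<not> par) (3 - e) (n - l). h ((l, e) # ys))"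
proof -
  let ?A = "if par \<and> n = 0 then {[]} else ({} :: (nat \<times> nat) list set)"
  let ?F = "\<lambda>l. (\<lambda>ys. (l, e) # ys) ` walks (\<not> par) (3 - e) (n - l)"
  have "(\<Sum>ys\<in>walks par e n. h ys) = sum h ?A + sum h (\<Union>l\<in>{1..n}. ?F l)"
    unfolding walks_decompose[of par e n]
    by (rule sum.union_disjoint) (auto intro!: finite_imageI finite_walks)
  also have "sum h (\<Union>l\<in>{1..n}. ?F l) = (\<Sum>l=1..n. sum h (?F l))"
    by (rule sum.UNION_disjoint) (auto intro!: finite_imageI finite_walks)
  also have "\<dots> = (\<Sum>l=1..n. \<Sum>ys\<in>walks (\<not> par) (3 - e) (n - l). h ((l, e) # ys))"
    by (rule sum.cong[OF refl]) (simp add: sum.reindex inj_on_def)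
  finally show ?thesis by simp
qed

text \<open>
  The sum of the weights of all walks from \<open>k\<close> to \<open>j\<close> whose first edge has the label \<open>e\<close> and whose
  nodes between the two end points have total label \<open>n\<close>. The parity refers to the number of these
  inner nodes.
\<close>

definition walk_sum :: "(nat \<Rightarrow> nat \<Rightarrow> nat \<Rightarrow> complex) \<Rightarrow> bool \<Rightarrow> nat \<Rightarrow> nat \<Rightarrow> nat \<Rightarrow> nat \<Rightarrow> complex" where
  "walk_sum C par e j k n = (\<Sum>ys\<in>walks par (3 - e) n. walk_weight C ((k, e) # ys) j)"

lemma walk_sum_rec:
  assumes "e \<le> 3"
  shows "walk_sum C par e j k n = (if par \<and> n = 0 then C e k j else 0)
     + (\<Sum>l=1..n. C e k l / of_nat l * walk_sum C (\<not> par) (3 - e) j l (n - l))"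
proof -
  have e: "3 - (3 - e) = e" using assms by simp
  show ?thesis
    unfolding walk_sum_def by (subst sum_walks) (simp_all add: sum_distrib_left e)
qed

text \<open>
  The \<open>n\<close>-th coefficient of \<open>\<Sum> k\<^sub>1 \<zeta>(M)\<close> over the chequered cycles \<open>M\<close> with a chosen first node, where
  \<open>k\<^sub>1\<close> is the label of that node and the edge leaving it has the label \<open>e\<close>.
\<close>

definition cycle_sum :: "(nat \<Rightarrow> nat \<Rightarrow> nat \<Rightarrow> complex) \<Rightarrow> nat \<Rightarrow> nat \<Rightarrow> complex" where
  "cycle_sum C e n = (\<Sum>ys\<in>walks True e n. walk_weight C ys (fst (hd ys)))"

lemma cycle_sum_eq:
  assumes "e \<le> 3" and "n \<ge> 1"
  shows "cycle_sum C e n = (\<Sum>k=1..n. walk_sum C False e k k (n - k))"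
  unfolding cycle_sum_def walk_sum_def using assms by (subst sum_walks) simp_all

lemma sum_shift_swap:
  fixes f :: "nat \<Rightarrow> nat \<Rightarrow> complex"
  shows "(\<Sum>i\<le>n. \<Sum>l=1..i. f l (i - l)) = (\<Sum>l=1..n. \<Sum>i\<le>n-l. f l i)"
proof -
  have "(\<Sum>i\<le>n. \<Sum>l=1..i. f l (i - l)) = (\<Sum>(i, l)\<in>(SIGMA i:{..n}. {1..i}). f l (i - l))"
    by (rule sum.Sigma) auto
  also have "\<dots> = (\<Sum>(l, i)\<in>(SIGMA l:{1..n}. {..n-l}). f l i)"
    by (rule sum.reindex_bij_witness[of _ "\<lambda>(l, i). (i + l, l)" "\<lambda>(i, l). (l, i - l)"]) auto
  also have "\<dots> = (\<Sum>l=1..n. \<Sum>i\<le>n-l. f l i)"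
    by (rule sum.Sigma[symmetric]) auto
  finally show ?thesis .
qed

section \<open>Gaussian functionals paired by a Casimir element\<close>

context heisenberg_voa
begin

text \<open>
  The properties of the Casimir sum that the recursion uses. They are symmetric in the two arguments,
  which permits exchanging the two tori.
\<close>

definition casimir_functional :: "(nat \<Rightarrow> ('v \<Rightarrow> 'v \<Rightarrow> complex) \<Rightarrow> complex) \<Rightarrow> bool" where
  "casimir_functional \<Omega> \<longleftrightarrow>
     (\<forall>n \<beta> \<gamma>. (\<forall>x\<in>sq_weight (int n). \<forall>y\<in>sq_weight (int n). \<beta> x y = \<gamma> x y) \<longrightarrow> \<Omega> n \<beta> = \<Omega> n \<gamma>) \<and>
     (\<forall>n \<beta> \<gamma>. \<Omega> n (\<lambda>x y. \<beta> x y + \<gamma> x y) = \<Omega> n \<beta> + \<Omega> n \<gamma>) \<and>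
     (\<forall>n c \<beta>. \<Omega> n (\<lambda>x y. c * \<beta> x y) = c * \<Omega> n \<beta>) \<and>
     (\<forall>n k \<beta>. (\<forall>y. linear_form (\<lambda>x. \<beta> x y)) \<longrightarrow> (\<forall>x. linear_form (\<beta> x)) \<longrightarrow>
        \<Omega> n (\<lambda>x y. \<beta> x (aq (- int k) y)) = - \<Omega> (n + k) (\<lambda>x y. \<beta> (aq (int k) x) y) \<and>
        \<Omega> n (\<lambda>x y. \<beta> (aq (- int k) x) y) = - \<Omega> (n + k) (\<lambda>x y. \<beta> x (aq (int k) y)))"

lemma casimir_functional_flip:
  assumes "casimir_functional \<Omega>"
  shows "casimir_functional (\<lambda>n \<beta>. \<Omega> n (\<lambda>x y. \<beta> y x))"
  unfolding casimir_functional_def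
proof (intro conjI allI impI)
  fix n k \<beta> \<gamma> c
  have cong: "\<Omega> n \<beta> = \<Omega> n \<gamma>"
    if "\<And>x y. x \<in> sq_weight (int n) \<Longrightarrow> y \<in> sq_weight (int n) \<Longrightarrow> \<beta> x y = \<gamma> x y" for n \<beta> \<gamma>
    using assms that unfolding casimir_functional_def by blast
  have add: "\<Omega> n (\<lambda>x y. \<beta> x y + \<gamma> x y) = \<Omega> n \<beta> + \<Omega> n \<gamma>" for n \<beta> \<gamma>
    using assms unfolding casimir_functional_def by blast
  have scale: "\<Omega> n (\<lambda>x y. c * \<beta> x y) = c * \<Omega> n \<beta>" for n c \<beta>
    using assms unfolding casimir_functional_def by blast
  show "\<Omega> n (\<lambda>x y. \<beta> y x) = \<Omega> n (\<lambda>x y. \<gamma> y x)"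
    if "\<forall>x\<in>sq_weight (int n). \<forall>y\<in>sq_weight (int n). \<beta> x y = \<gamma> x y"
    by (rule cong) (use that in simp)
  show "\<Omega> n (\<lambda>x y. \<beta> y x + \<gamma> y x) = \<Omega> n (\<lambda>x y. \<beta> y x) + \<Omega> n (\<lambda>x y. \<gamma> y x)"
    by (rule add)
  show "\<Omega> n (\<lambda>x y. c * \<beta> y x) = c * \<Omega> n (\<lambda>x y. \<beta> y x)"
    by (rule scale)
next
  fix n k \<beta>
  assume l: "\<forall>y. linear_form (\<lambda>x. \<beta> x y)" and r: "\<forall>x. linear_form (\<beta> x)"
  have "\<forall>n k \<beta>. (\<forall>y. linear_form (\<lambda>x. \<beta> x y)) \<longrightarrow> (\<forall>x. linear_form (\<beta> x)) \<longrightarrow>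
        \<Omega> n (\<lambda>x y. \<beta> x (aq (- int k) y)) = - \<Omega> (n + k) (\<lambda>x y. \<beta> (aq (int k) x) y) \<and>
        \<Omega> n (\<lambda>x y. \<beta> (aq (- int k) x) y) = - \<Omega> (n + k) (\<lambda>x y. \<beta> x (aq (int k) y))"
    using assms unfolding casimir_functional_def by blast
  from this[rule_format, of "\<lambda>x y. \<beta> y x" n k] l r
  show "\<Omega> n (\<lambda>x y. \<beta> y (aq (- int k) x)) = - \<Omega> (n + k) (\<lambda>x y. \<beta> (aq (int k) y) x)"
    and "\<Omega> n (\<lambda>x y. \<beta> (aq (- int k) y) x) = - \<Omega> (n + k) (\<lambda>x y. \<beta> y (aq (int k) x))"
    by simp_all
qed

text \<open>
  Wick's theorem as a recursion: \<open>a[-n]\<close> is contracted with each of the other factors.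
\<close>

definition gaussian :: "(nat \<Rightarrow> nat \<Rightarrow> complex) \<Rightarrow> ('v \<Rightarrow> complex) \<Rightarrow> bool" where
  "gaussian C \<phi> \<longleftrightarrow> linear_form \<phi> \<and> (\<forall>n M v. n \<ge> 1 \<longrightarrow> (\<forall>m>M. aq (int m) v = 0) \<longrightarrow>
     \<phi> (aq (- int n) v) = (\<Sum>m=1..M. C n m / of_nat m * \<phi> (aq (int m) v)))"

lemma aq_large: "v \<in> sq_weight (int n) \<Longrightarrow> m > n \<Longrightarrow> aq (int m) v = 0"
  using sq_weight_negative[OF aq_weight, of v "int n" "int m"] by simp

text \<open>
  The weight operator \<open>\<Sum> a[-k] a[k]\<close> is inserted on the first side. Its annihilation operator is moved to
  the other side, where it becomes a creation operator and is contracted, by the Gaussian property,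
  into annihilation operators; one of these is moved back, and so on. On the first side a
  contraction may also hit the creation operator \<open>a[-k]\<close> that was left behind, which closes the
  walk. Thus the two-point functions \<open>R\<close> (both insertions on the first side) and \<open>Q\<close> (one on each
  side) satisfy the recursion of the walk sums.
\<close>

lemma casimir_recursion:
  assumes \<Omega>: "casimir_functional \<Omega>" and e: "e \<le> 3"
    and g1: "gaussian (C e) \<phi>" and g2: "gaussian (C (3 - e)) \<psi>"
    and n: "n \<ge> 1"
  defines "w \<equiv> \<lambda>n. \<Omega> n (\<lambda>x y. \<phi> x * \<psi> y)"
  shows "of_nat n * w n = (\<Sum>i=1..n. cycle_sum C (3 - e) i * w (n - i))"
proof -
  have cong: "\<Omega> n \<beta> = \<Omega> n \<gamma>"
    if "\<And>x y. x \<in> sq_weight (int n) \<Longrightarrow> y \<in> sq_weight (int n) \<Longrightarrow> \<beta> x y = \<gamma> x y" for n \<beta> \<gamma>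
    using \<Omega> that unfolding casimir_functional_def by blast
  have add: "\<Omega> n (\<lambda>x y. \<beta> x y + \<gamma> x y) = \<Omega> n \<beta> + \<Omega> n \<gamma>" for n \<beta> \<gamma>
    using \<Omega> unfolding casimir_functional_def by blast
  have scale: "\<Omega> n (\<lambda>x y. c * \<beta> x y) = c * \<Omega> n \<beta>" for n c \<beta>
    using \<Omega> unfolding casimir_functional_def by blast
  have zero: "\<Omega> n (\<lambda>x y. 0) = 0" for n using scale[of n 0 "\<lambda>x y. 0"] by simp
  have sum: "\<Omega> n (\<lambda>x y. \<Sum>i\<in>A. \<beta> i x y) = (\<Sum>i\<in>A. \<Omega> n (\<beta> i))" if "finite A" for n and \<beta> :: "nat \<Rightarrow> _" and A
    using that by (induction A) (simp_all add: zero add)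
  have \<phi>: "linear_form \<phi>" and \<psi>: "linear_form \<psi>" using g1 g2 by (simp_all add: gaussian_def)
  have form1: "linear_form (\<lambda>x. \<phi> x * c)" and form2: "linear_form (\<lambda>x. c * \<psi> x)"
    and form3: "linear_form (\<lambda>x. \<phi> (aq m x) * c)" and form4: "linear_form (\<lambda>x. c * \<psi> (aq m x))" for c m
    by (rule linear_formI; simp add: form_add[OF \<phi>] form_scale[OF \<phi>] form_add[OF \<psi>] form_scale[OF \<psi>]
        lin_add[OF aq_lin] lin_scale[OF aq_lin] algebra_simps)+
  have moves: "(\<forall>y. linear_form (\<lambda>x. \<beta> x y)) \<longrightarrow> (\<forall>x. linear_form (\<beta> x)) \<longrightarrow>
        \<Omega> n (\<lambda>x y. \<beta> x (aq (- int k) y)) = - \<Omega> (n + k) (\<lambda>x y. \<beta> (aq (int k) x) y) \<and>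
        \<Omega> n (\<lambda>x y. \<beta> (aq (- int k) x) y) = - \<Omega> (n + k) (\<lambda>x y. \<beta> x (aq (int k) y))" for n k \<beta>
    using \<Omega> unfolding casimir_functional_def by blast
  define R where "R j k n = \<Omega> n (\<lambda>x y. \<phi> (aq (- int j) (aq (- int k) x)) * \<psi> y)" for j k n
  define Q where "Q j l n = \<Omega> n (\<lambda>x y. \<phi> (aq (- int j) x) * \<psi> (aq (- int l) y))" for j l n
  have R_rec: "R j k n = C e k j * w n - (\<Sum>l=1..n. C e k l / of_nat l * Q j l (n - l))"
    if j: "j \<ge> 1" and k: "k \<ge> 1" for j k n
  proof -
    have "R j k n = \<Omega> n (\<lambda>x y. C e k j * (\<phi> x * \<psi> y)
        + (\<Sum>l=1..n. C e k l / of_nat l * (\<phi> (aq (- int j) (aq (int l) x)) * \<psi> y)))"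
      unfolding R_def
    proof (rule cong)
      fix x y assume x: "x \<in> sq_weight (int n)"
      let ?v = "aq (- int j) x"
      have v: "?v \<in> sq_weight (int (n + j))" using aq_weight[OF x, of "- int j"] by simp
      have "aq (- int j) (aq (- int k) x) = aq (- int k) ?v"
        using j k by (subst aq_commute) simp
      also have "\<phi> (aq (- int k) ?v) = (\<Sum>l=1..n+j. C e k l / of_nat l * \<phi> (aq (int l) ?v))"
        using g1 k aq_large[OF v] unfolding gaussian_def by blast
      also have "\<dots> = (\<Sum>l=1..n+j. C e k l / of_nat l * \<phi> (aq (- int j) (aq (int l) x)) + (if l = j then C e k j * \<phi> x else 0))"
        using j by (intro sum.cong refl, subst aq_commute)
          (auto simp: form_add[OF \<phi>] form_scale[OF \<phi>] form_zero[OF \<phi>] algebra_simps)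
      also have "\<dots> = (\<Sum>l=1..n+j. C e k l / of_nat l * \<phi> (aq (- int j) (aq (int l) x))) + C e k j * \<phi> x"
        using j by (simp add: sum.distrib)
      also have "(\<Sum>l=1..n+j. C e k l / of_nat l * \<phi> (aq (- int j) (aq (int l) x)))
          = (\<Sum>l=1..n. C e k l / of_nat l * \<phi> (aq (- int j) (aq (int l) x)))"
        by (rule sum.mono_neutral_right) (auto simp: aq_large[OF x] lin_zero[OF aq_lin] form_zero[OF \<phi>])
      finally show "\<phi> (aq (- int j) (aq (- int k) x)) * \<psi> y = C e k j * (\<phi> x * \<psi> y)
        + (\<Sum>l=1..n. C e k l / of_nat l * (\<phi> (aq (- int j) (aq (int l) x)) * \<psi> y))"
        by (simp add: sum_distrib_right distrib_right mult.assoc)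
    qed
    also have "\<dots> = C e k j * w n + (\<Sum>l=1..n. C e k l / of_nat l * \<Omega> n (\<lambda>x y. \<phi> (aq (- int j) (aq (int l) x)) * \<psi> y))"
      by (simp only: add scale sum finite_atLeastAtMost w_def)
    also have "(\<Sum>l=1..n. C e k l / of_nat l * \<Omega> n (\<lambda>x y. \<phi> (aq (- int j) (aq (int l) x)) * \<psi> y))
      = (\<Sum>l=1..n. - (C e k l / of_nat l * Q j l (n - l)))"
    proof (rule sum.cong[OF refl], goal_cases)
      case l: (1 l)
      have "Q j l (n - l) = - \<Omega> (n - l + l) (\<lambda>x y. \<phi> (aq (- int j) (aq (int l) x)) * \<psi> y)"
        unfolding Q_def
        using moves[of "\<lambda>x y. \<phi> (aq (- int j) x) * \<psi> y" "n - l" l] form3 form2 by blast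
      then show ?case
        using l by simp
    qed
    finally show ?thesis by (simp add: sum_negf)
  qed
  have Q_rec: "Q j l n = - (\<Sum>k=1..n. C (3 - e) l k / of_nat k * R j k (n - k))"
    if l: "l \<ge> 1" for j l n
  proof -
    have "Q j l n = \<Omega> n (\<lambda>x y. \<Sum>k=1..n. C (3 - e) l k / of_nat k * (\<phi> (aq (- int j) x) * \<psi> (aq (int k) y)))"
      unfolding Q_def
    proof (rule cong)
      fix x y assume y: "y \<in> sq_weight (int n)"
      have "\<psi> (aq (- int l) y) = (\<Sum>k=1..n. C (3 - e) l k / of_nat k * \<psi> (aq (int k) y))"
        using g2 l aq_large[OF y] unfolding gaussian_def by blast
      then show "\<phi> (aq (- int j) x) * \<psi> (aq (- int l) y)
        = (\<Sum>k=1..n. C (3 - e) l k / of_nat k * (\<phi> (aq (- int j) x) * \<psi> (aq (int k) y)))"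
        by (simp add: sum_distrib_left mult_ac)
    qed
    also have "\<dots> = (\<Sum>k=1..n. C (3 - e) l k / of_nat k * \<Omega> n (\<lambda>x y. \<phi> (aq (- int j) x) * \<psi> (aq (int k) y)))"
      by (simp only: scale sum finite_atLeastAtMost)
    also have "\<dots> = (\<Sum>k=1..n. - (C (3 - e) l k / of_nat k * R j k (n - k)))"
    proof (rule sum.cong[OF refl], goal_cases)
      case k: (1 k)
      have "R j k (n - k) = - \<Omega> (n - k + k) (\<lambda>x y. \<phi> (aq (- int j) x) * \<psi> (aq (int k) y))"
        unfolding R_def
        using moves[of "\<lambda>x y. \<phi> (aq (- int j) x) * \<psi> y" "n - k" k] form3 form2 by blast
      then show ?case
        using k by simp
    qed
    finally show ?thesis by (simp add: sum_negf)
  qed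
  have walk: "(\<Sum>i\<le>n. walk_sum C par f j k i * w (n - i)) = (if par then C f k j * w n else 0)
      + (\<Sum>l=1..n. C f k l / of_nat l * (\<Sum>i\<le>n-l. walk_sum C (\<not> par) (3 - f) j l i * w (n - l - i)))"
    if f: "f \<le> 3" for par f j k n
  proof -
    have "(\<Sum>i\<le>n. walk_sum C par f j k i * w (n - i))
      = (\<Sum>i\<le>n. (if par \<and> i = 0 then C f k j * w n else 0))
        + (\<Sum>i\<le>n. \<Sum>l=1..i. C f k l / of_nat l * walk_sum C (\<not> par) (3 - f) j l (i - l) * w (n - l - (i - l)))"
      unfolding sum.distrib [symmetric]
    proof (rule sum.cong[OF refl], goal_cases)
      case (1 i)
      have "(\<Sum>l=1..i. C f k l / of_nat l * walk_sum C (\<not> par) (3 - f) j l (i - l) * w (n - i))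
        = (\<Sum>l=1..i. C f k l / of_nat l * walk_sum C (\<not> par) (3 - f) j l (i - l) * w (n - l - (i - l)))"
        by (intro sum.cong refl) simp
      then show ?case
        by (simp add: walk_sum_rec[OF f, of C par j k i] distrib_right sum_distrib_right)
    qed
    also have "(\<Sum>i\<le>n. (if par \<and> i = 0 then C f k j * w n else 0)) = (if par then C f k j * w n else 0)"
      by (cases par) simp_all
    also have "(\<Sum>i\<le>n. \<Sum>l=1..i. C f k l / of_nat l * walk_sum C (\<not> par) (3 - f) j l (i - l) * w (n - l - (i - l)))
      = (\<Sum>l=1..n. \<Sum>i\<le>n-l. C f k l / of_nat l * walk_sum C (\<not> par) (3 - f) j l i * w (n - l - i))"
      by (rule sum_shift_swap)
    finally show ?thesis by (simp add: sum_distrib_left mult.assoc)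
  qed
  have sol: "(\<forall>j\<ge>1. \<forall>k\<ge>1. R j k n = (\<Sum>i\<le>n. walk_sum C True e j k i * w (n - i)))
     \<and> (\<forall>j\<ge>1. \<forall>k\<ge>1. Q j k n = - (\<Sum>i\<le>n. walk_sum C False (3 - e) j k i * w (n - i)))" for n
  proof (induction n rule: less_induct)
    case (less n)
    have e3: "3 - (3 - e) = e" using e by simp
    have "R j k n = (\<Sum>i\<le>n. walk_sum C True e j k i * w (n - i))" if "j \<ge> 1" "k \<ge> 1" for j k
    proof -
      have "(\<Sum>l=1..n. C e k l / of_nat l * Q j l (n - l))
        = (\<Sum>l=1..n. - (C e k l / of_nat l * (\<Sum>i\<le>n-l. walk_sum C False (3 - e) j l i * w (n - l - i))))"
      proof (rule sum.cong[OF refl], goal_cases)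
        case (1 l)
        then have "Q j l (n - l) = - (\<Sum>i\<le>n-l. walk_sum C False (3 - e) j l i * w (n - l - i))"
          using less[of "n - l"] that by auto
        then show ?case
          by (simp only: mult_minus_right)
      qed
      then show ?thesis
        unfolding R_rec[OF that] walk[OF e] by (simp add: sum_negf)
    qed
    moreover have "Q j k n = - (\<Sum>i\<le>n. walk_sum C False (3 - e) j k i * w (n - i))" if "j \<ge> 1" "k \<ge> 1" for j k
    proof -
      have "(\<Sum>l=1..n. C (3 - e) k l / of_nat l * R j l (n - l))
        = (\<Sum>l=1..n. C (3 - e) k l / of_nat l * (\<Sum>i\<le>n-l. walk_sum C True e j l i * w (n - l - i)))"
      proof (rule sum.cong[OF refl], goal_cases)
        case (1 l)
        then have "R j l (n - l) = (\<Sum>i\<le>n-l. walk_sum C True e j l i * w (n - l - i))"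
          using less[of "n - l"] that by auto
        then show ?case
          by (simp only:)
      qed
      then show ?thesis
        unfolding Q_rec[OF that(2)] by (subst walk) (simp_all add: e3)
    qed
    ultimately show ?case by blast
  qed
  have "of_nat n * w n = \<Omega> n (\<lambda>x y. \<Sum>k=1..n. \<phi> (aq (- int k) (aq (int k) x)) * \<psi> y)"
    unfolding w_def scale[symmetric]
  proof (rule cong)
    fix x y assume x: "x \<in> sq_weight (int n)"
    have "of_nat n * \<phi> x = \<phi> (\<Sum>k=1..n. aq (- int k) (aq (int k) x))"
      unfolding number_operator[OF x] form_scale[OF \<phi>] ..
    then show "of_nat n * (\<phi> x * \<psi> y) = (\<Sum>k=1..n. \<phi> (aq (- int k) (aq (int k) x)) * \<psi> y)"
      by (simp add: form_sum[OF \<phi>] sum_distrib_right mult.assoc [symmetric])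
  qed
  also have "\<dots> = (\<Sum>k=1..n. - Q k k (n - k))"
    unfolding sum[OF finite_atLeastAtMost]
  proof (rule sum.cong[OF refl], goal_cases)
    case k: (1 k)
    have "Q k k (n - k) = - \<Omega> (n - k + k) (\<lambda>x y. \<phi> (aq (- int k) (aq (int k) x)) * \<psi> y)"
      unfolding Q_def
      using moves[of "\<lambda>x y. \<phi> (aq (- int k) x) * \<psi> y" "n - k" k] form3 form2 by blast
    then show ?case
      using k by simp
  qed
  also have "\<dots> = (\<Sum>k=1..n. \<Sum>i\<le>n-k. walk_sum C False (3 - e) k k i * w (n - (i + k)))"
    using sol by (intro sum.cong refl) (simp add: diff_diff_left add.commute)
  also have "\<dots> = (\<Sum>i\<le>n. \<Sum>k=1..i. walk_sum C False (3 - e) k k (i - k) * w (n - (i - k + k)))"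
    by (rule sum_shift_swap[symmetric])
  also have "\<dots> = (\<Sum>i\<le>n. \<Sum>k=1..i. walk_sum C False (3 - e) k k (i - k) * w (n - i))"
    by (intro sum.cong refl) simp
  also have "\<dots> = (\<Sum>i=1..n. \<Sum>k=1..i. walk_sum C False (3 - e) k k (i - k) * w (n - i))"
    by (rule sum.mono_neutral_right) (auto simp: not_le)
  also have "\<dots> = (\<Sum>i=1..n. cycle_sum C (3 - e) i * w (n - i))"
    by (intro sum.cong refl) (simp add: cycle_sum_eq sum_distrib_right)
  finally show ?thesis .
qed

end

context heisenberg_metric
begin

lemma casimir_functional_casimir: "casimir_functional casimir"
  unfolding casimir_functional_def
proof (intro conjI allI impI)
  fix n k \<beta> \<gamma> c
  show "casimir n \<beta> = casimir n \<gamma>"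
    if "\<forall>x\<in>sq_weight (int n). \<forall>y\<in>sq_weight (int n). \<beta> x y = \<gamma> x y"
    unfolding casimir_def using that S_weight dual(1) by (intro sum.cong refl) blast
  show "casimir n (\<lambda>x y. \<beta> x y + \<gamma> x y) = casimir n \<beta> + casimir n \<gamma>"
    by (simp add: casimir_def sum.distrib)
  show "casimir n (\<lambda>x y. c * \<beta> x y) = c * casimir n \<beta>"
    by (simp add: casimir_def sum_distrib_left)
next
  fix n k \<beta>
  assume "\<forall>y. linear_form (\<lambda>x. \<beta> x y)" and "\<forall>x. linear_form (\<beta> x)"
  then show "casimir n (\<lambda>x y. \<beta> x (aq (- int k) y)) = - casimir (n + k) (\<lambda>x y. \<beta> (aq (int k) x) y)"
    and "casimir n (\<lambda>x y. \<beta> (aq (- int k) x) y) = - casimir (n + k) (\<lambda>x y. \<beta> x (aq (int k) y))"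
    using casimir_move[of \<beta> "n + k" n "int k"] casimir_move[of \<beta> n "n + k" "- int k"] by simp_all
qed

text \<open>
  The weight zero space is spanned by the vacuum, whose norm is one.
\<close>

lemma casimir_0:
  assumes \<phi>: "linear_form \<phi>" and \<psi>: "linear_form \<psi>"
  shows "casimir 0 (\<lambda>x y. \<phi> x * \<psi> y) = \<phi> (vacuum V) * \<psi> (vacuum V)"
proof -
  let ?o = "vacuum V"
  have oo: "B ?o ?o = 1" using metric by (simp add: is_LiZ_metric_def square_bracket_def)
  have o: "?o \<in> sq_weight (int 0)" using sq_fock_weight[of "[]"] by simp
  have x: "x = smult V (B ?o x) ?o" if "x \<in> sq_weight (int 0)" for x
  proof -
    have "{ns. 0 \<notin> set ns \<and> int (sum_list ns) = int 0} \<subseteq> {[]}"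
    proof
      fix ns assume "ns \<in> {ns. 0 \<notin> set ns \<and> int (sum_list ns) = int 0}"
      then show "ns \<in> {[]}" by (cases ns) auto
    qed
    then have "vs.span (sq_fock ` {ns. 0 \<notin> set ns \<and> int (sum_list ns) = int 0}) \<subseteq> vs.span (sq_fock ` {[]})"
      by (intro vs.span_mono image_mono)
    then have "x \<in> vs.span {?o}" using sq_weight_span[OF that] by auto
    then obtain c where c: "x = smult V c ?o" by (auto simp: vs.span_singleton)
    then show ?thesis by (simp add: form_scale[OF B_right] oo)
  qed
  have "casimir 0 (\<lambda>x y. \<phi> x * \<psi> y) = (\<Sum>u\<in>S 0. (B ?o (dual 0 u) * B ?o u) * (\<phi> ?o * \<psi> ?o))"
    unfolding casimir_def
  proof (rule sum.cong[OF refl], goal_cases)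
    case u: (1 u)
    have "\<phi> u = B ?o u * \<phi> ?o"
      by (subst x[OF S_weight[OF u]]) (rule form_scale[OF \<phi>])
    moreover have "\<psi> (dual 0 u) = B ?o (dual 0 u) * \<psi> ?o"
      by (subst x[OF dual(1)[OF u]]) (rule form_scale[OF \<psi>])
    ultimately show ?case
      by simp
  qed
  also have "\<dots> = B ?o (\<Sum>u\<in>S 0. smult V (B ?o (dual 0 u)) u) * (\<phi> ?o * \<psi> ?o)"
    by (simp add: form_sum[OF B_right] form_scale[OF B_right] sum_distrib_right)
  also have "(\<Sum>u\<in>S 0. smult V (B ?o (dual 0 u)) u) = ?o"
    by (rule basis_expansion[OF o, symmetric])
  finally show ?thesis by (simp add: oo)
qed

lemma gaussian_genus_one:
  assumes "Im \<tau> > 0"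
  shows "gaussian (\<lambda>k l. C_coeff k l \<tau>) (\<lambda>v. genus_one V v \<tau>)"
  unfolding gaussian_def
proof (intro conjI allI impI)
  show "linear_form (\<lambda>v. genus_one V v \<tau>)"
    by (rule linear_formI) (simp_all add: genus_one_add genus_one_scale assms)
  fix n M :: nat and v assume "n \<ge> 1" "\<forall>m>M. aq (int m) v = 0"
  then show "genus_one V (aq (- int n) v) \<tau> = (\<Sum>m=1..M. C_coeff n m \<tau> / of_nat m * genus_one V (aq (int m) v) \<tau>)"
    by (intro genus_one_zhu assms) simp_all
qed

lemma genus_two_eq_casimir:
  "genus_two_partition V B S \<tau>\<^sub>1 \<tau>\<^sub>2 = Abs_fps (\<lambda>n. casimir n (\<lambda>x y. genus_one V x \<tau>\<^sub>1 * genus_one V y \<tau>\<^sub>2))"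
  by (simp add: genus_two_partition_def casimir_def)

text \<open>
  Adding the recursions obtained by inserting the weight operator on the first and on the second torus
  gives \<open>2 \<epsilon> d/d\<epsilon> Z\<^sup>(\<^sup>2\<^sup>)\<close> as a sum over rooted cycles with first edge of either label.
\<close>

lemma genus_two_ode:
  assumes "Im \<tau>\<^sub>1 > 0" and "Im \<tau>\<^sub>2 > 0"
  defines "W \<equiv> genus_two_partition V B S \<tau>\<^sub>1 \<tau>\<^sub>2"
    and "C \<equiv> \<lambda>e k l. C_coeff k l (if e = 1 then \<tau>\<^sub>1 else \<tau>\<^sub>2)"
  shows "fps_const 2 * (fps_X * fps_deriv W) = Abs_fps (\<lambda>n. if n = 0 then 0 else cycle_sum C 1 n + cycle_sum C 2 n) * W"
    and "fps_nth W 0 = genus_one_partition V \<tau>\<^sub>1 * genus_one_partition V \<tau>\<^sub>2"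
proof -
  have C1: "gaussian (C 1) (\<lambda>v. genus_one V v \<tau>\<^sub>1)" and C2: "gaussian (C 2) (\<lambda>v. genus_one V v \<tau>\<^sub>2)"
    using gaussian_genus_one assms by (simp_all add: C_def)
  have Wn: "fps_nth W n = casimir n (\<lambda>x y. genus_one V x \<tau>\<^sub>1 * genus_one V y \<tau>\<^sub>2)" for n
    by (simp add: W_def genus_two_eq_casimir)
  show "fps_nth W 0 = genus_one_partition V \<tau>\<^sub>1 * genus_one_partition V \<tau>\<^sub>2"
    unfolding Wn genus_one_partition_def
    by (rule casimir_0) (use C1 C2 in \<open>simp_all add: gaussian_def\<close>)
  have r1: "of_nat n * fps_nth W n = (\<Sum>i=1..n. cycle_sum C 2 i * fps_nth W (n - i))" if "n \<ge> 1" for n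
    using casimir_recursion[OF casimir_functional_casimir, of 1 C, OF _ C1 _ that] C2 by (simp add: Wn)
  have r2: "of_nat n * fps_nth W n = (\<Sum>i=1..n. cycle_sum C 1 i * fps_nth W (n - i))" if "n \<ge> 1" for n
    using casimir_recursion[OF casimir_functional_flip[OF casimir_functional_casimir], of 2 C, OF _ C2 _ that] C1
    by (simp add: Wn mult.commute)
  show "fps_const 2 * (fps_X * fps_deriv W) = Abs_fps (\<lambda>n. if n = 0 then 0 else cycle_sum C 1 n + cycle_sum C 2 n) * W"
  proof (rule fps_ext)
    fix n
    show "fps_nth (fps_const 2 * (fps_X * fps_deriv W)) n
      = fps_nth (Abs_fps (\<lambda>n. if n = 0 then 0 else cycle_sum C 1 n + cycle_sum C 2 n) * W) n"
    proof (cases "n = 0")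
      case False
      then have n: "n \<ge> 1" by simp
      have "fps_nth (fps_const 2 * (fps_X * fps_deriv W)) n = of_nat n * fps_nth W n + of_nat n * fps_nth W n"
        using False by (cases n) simp_all
      also have "\<dots> = (\<Sum>i=1..n. (cycle_sum C 1 i + cycle_sum C 2 i) * fps_nth W (n - i))"
        by (subst (1) r2[OF n], subst r1[OF n]) (simp add: sum.distrib distrib_right)
      also have "\<dots> = fps_nth (Abs_fps (\<lambda>n. if n = 0 then 0 else cycle_sum C 1 n + cycle_sum C 2 n) * W) n"
        by (simp add: fps_mult_nth sum.atLeast_Suc_atMost[of 0])
      finally show ?thesis .
    qed (simp add: fps_mult_nth)
  qed
qed

end

section \<open>Cyclic words and their primitive roots\<close>

text \<open>
  A cyclic word is studied through its periodic extension: rotations become shifts, and a word and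
  its powers have the same extension.
\<close>

definition periodic_ext :: "'b list \<Rightarrow> nat \<Rightarrow> 'b" where
  "periodic_ext xs i = xs ! (i mod length xs)"

lemma periodic_ext_nth: "i < length xs \<Longrightarrow> periodic_ext xs i = xs ! i"
  by (simp add: periodic_ext_def)

lemma periodic_ext_add_length [simp]: "periodic_ext xs (i + length xs) = periodic_ext xs i"
  by (simp add: periodic_ext_def)

lemma periodic_ext_Suc: "periodic_ext xs (Suc i) = xs ! (Suc (i mod length xs) mod length xs)"
  by (simp add: periodic_ext_def mod_Suc_eq)

lemma periodic_ext_in_set: "xs \<noteq> [] \<Longrightarrow> periodic_ext xs i \<in> set xs"
  by (simp add: periodic_ext_def)

lemma periodic_ext_rotate:
  "xs \<noteq> [] \<Longrightarrow> periodic_ext (rotate r xs) i = periodic_ext xs (r + i)"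
  by (simp add: periodic_ext_def nth_rotate mod_add_right_eq)

lemma list_eqI_periodic_ext:
  assumes "length xs = length ys" and "\<And>i. periodic_ext xs i = periodic_ext ys i"
  shows "xs = ys"
  by (rule nth_equalityI) (use assms in \<open>metis periodic_ext_nth\<close>)+

lemma rotate_eq_iff_period:
  assumes "xs \<noteq> []"
  shows "rotate r xs = xs \<longleftrightarrow> (\<forall>i. periodic_ext xs (r + i) = periodic_ext xs i)"
proof
  assume "rotate r xs = xs"
  then show "\<forall>i. periodic_ext xs (r + i) = periodic_ext xs i"
    using periodic_ext_rotate[OF assms, of r] by simp
next
  assume "\<forall>i. periodic_ext xs (r + i) = periodic_ext xs i"
  then show "rotate r xs = xs"
    by (intro list_eqI_periodic_ext) (simp_all add: periodic_ext_rotate[OF assms])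
qed

abbreviation list_power :: "nat \<Rightarrow> 'b list \<Rightarrow> 'b list" where
  "list_power r xs \<equiv> concat (replicate r xs)"

lemma length_list_power: "length (list_power r xs) = r * length xs"
  by (induction r) simp_all

lemma list_power_nth: "i < r * length xs \<Longrightarrow> list_power r xs ! i = xs ! (i mod length xs)"
proof (induction r arbitrary: i)
  case (Suc r)
  show ?case
  proof (cases "i < length xs")
    case False
    then have "list_power (Suc r) xs ! i = list_power r xs ! (i - length xs)"
      by (simp add: nth_append)
    also have "\<dots> = xs ! ((i - length xs) mod length xs)"
      using Suc False by (intro Suc.IH) auto
    finally show ?thesis using False by (simp add: le_mod_geq)
  qed (simp add: nth_append)
qed simp

lemma periodic_ext_list_power:
  assumes "r > 0" and "xs \<noteq> []"
  shows "periodic_ext (list_power r xs) i = periodic_ext xs i"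
proof -
  have "i mod (r * length xs) < r * length xs" using assms by simp
  then have "periodic_ext (list_power r xs) i = xs ! (i mod (r * length xs) mod length xs)"
    by (simp add: periodic_ext_def length_list_power list_power_nth)
  then show ?thesis by (simp add: periodic_ext_def mod_mod_cancel)
qed

lemma period_multiple:
  fixes f :: "nat \<Rightarrow> 'b"
  assumes "\<And>i. f (d + i) = f i"
  shows "f (d * q + i) = f i"
  by (induction q) (simp_all add: assms add.assoc)

text \<open>
  Cut the word at the least period of its extension. The least period divides the length, since the
  remainder of the length modulo the least period would be a smaller period.
\<close>

lemma primitive_root:
  fixes xs :: "(nat \<times> nat) list"
  assumes "xs \<noteq> []"
  obtains r ys where "r > 0" "ys \<noteq> []" "rotationless ys" "xs = list_power r ys"
proof -
  let ?f = "periodic_ext xs" and ?l = "length xs"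
  define period where "period d \<longleftrightarrow> 0 < d \<and> (\<forall>i. ?f (d + i) = ?f i)" for d
  define d where "d = (LEAST d. period d)"
  have "period ?l" using assms periodic_ext_add_length[of xs] by (simp add: period_def add.commute)
  then have d: "period d" unfolding d_def by (rule LeastI)
  have least: "d \<le> e" if "period e" for e unfolding d_def using that by (rule Least_le)
  have d0: "d > 0" and fd: "\<And>i. ?f (d + i) = ?f i" using d by (auto simp: period_def)
  have "?l mod d = 0"
  proof (rule ccontr)
    assume nz: "?l mod d \<noteq> 0"
    have "?f (?l mod d + i) = ?f i" for i
    proof -
      have "?f (?l mod d + i) = ?f (d * (?l div d) + (?l mod d + i))"
        by (rule period_multiple[where f = ?f, OF fd, symmetric])
      also have "d * (?l div d) + (?l mod d + i) = i + ?l"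
        by (metis add.assoc add.commute mult_div_mod_eq)
      finally show ?thesis by simp
    qed
    then have "period (?l mod d)" using nz by (simp add: period_def)
    then have "d \<le> ?l mod d" by (rule least)
    then show False using d0 by (metis mod_less_divisor not_le)
  qed
  then have "d dvd ?l" by (simp add: dvd_eq_mod_eq_0)
  then obtain r where r: "?l = r * d" by (metis dvd_def mult.commute)
  define ys where "ys = take d xs"
  have r0: "r > 0" using r assms by (cases r) auto
  then have "d \<le> ?l" unfolding r by simp
  then have ly: "length ys = d" by (simp add: ys_def)
  have yn: "ys ! i = ?f i" if "i < d" for i
    using that \<open>d \<le> ?l\<close> by (simp add: ys_def periodic_ext_nth)
  have ye: "periodic_ext ys i = ?f i" for i
  proof -
    have "periodic_ext ys i = ?f (i mod d)" using d0 by (simp add: periodic_ext_def ly yn)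
    also have "\<dots> = ?f (d * (i div d) + i mod d)" by (rule period_multiple[where f = ?f, OF fd, symmetric])
    finally show ?thesis by simp
  qed
  have yne: "ys \<noteq> []" using ly d0 by auto
  have "rotationless ys"
    unfolding rotationless_def
  proof (intro allI impI)
    fix e assume e: "0 < e \<and> e < length ys"
    show "rotate e ys \<noteq> ys"
    proof
      assume "rotate e ys = ys"
      then have "period e" using e by (simp add: rotate_eq_iff_period[OF yne] ye period_def)
      then show False using least[of e] e ly by simp
    qed
  qed
  moreover have "xs = list_power r ys"
    by (rule list_eqI_periodic_ext) (simp_all add: length_list_power ly r periodic_ext_list_power[OF r0 yne] ye)
  ultimately show ?thesis using that r0 yne by blast
qed

text \<open>
  The length of a rotationless word is the least period of its extension.
\<close>

lemma rotationless_eqI: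
  assumes "rotationless xs" "rotationless ys" "xs \<noteq> []" "ys \<noteq> []"
    and eq: "\<And>i. periodic_ext xs i = periodic_ext ys i"
  shows "xs = ys"
proof -
  have le: "length ys \<le> length xs"
    if "rotationless ys" "xs \<noteq> []" "ys \<noteq> []" "\<And>i. periodic_ext xs i = periodic_ext ys i"
    for xs ys :: "(nat \<times> nat) list"
  proof (rule ccontr)
    assume "\<not> length ys \<le> length xs"
    moreover have "rotate (length xs) ys = ys"
      unfolding rotate_eq_iff_period[OF that(3)] that(4)[symmetric]
      by (metis add.commute periodic_ext_add_length)
    ultimately show False using that unfolding rotationless_def by auto
  qed
  have "length xs = length ys"
    using le[OF assms(2,3,4) eq] le[OF assms(1,4,3) eq[symmetric]] by simp
  then show ?thesis using eq by (rule list_eqI_periodic_ext)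
qed

context comm_monoid_set
begin

lemma periodic_multiple:
  fixes l :: nat
  assumes "\<And>i. h (i + l) = h i"
  shows "F h {..<r * l} = F (\<lambda>_. F h {..<l}) {..<r}"
proof -
  have "F h {m * l..<m * l + l} = F h {..<l}" for m
  proof -
    have "F h {m * l..<m * l + l} = F (\<lambda>i. h (i + m * l)) {0..<l}"
      using shift_bounds_nat_ivl[of h 0 "m * l" l] by (simp add: add.commute)
    also have "\<dots> = F h {0..<l}"
      using period_multiple[of h l m] assms by (intro cong refl) (simp add: add.commute mult.commute)
    finally show ?thesis by (simp add: atLeast0LessThan)
  qed
  then show ?thesis by (simp add: nat_group[symmetric])
qed

lemma periodic_shift:
  fixes l r :: nat
  assumes "\<And>i. h (i + l) = h i"
  shows "F (\<lambda>i. h (r + i)) {..<l} = F h {..<l}"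
proof (induction r)
  case (Suc r)
  have "F (\<lambda>i. h (Suc r + i)) {..<l} = F (\<lambda>i. h (r + i)) {..<l}"
  proof (cases l)
    case (Suc l')
    have "h (Suc r + l') = h r" using assms[of r] by (simp add: Suc)
    then have "F (\<lambda>i. h (Suc r + i)) {..<l} = F (\<lambda>i. h (Suc r + i)) {..<l'} \<^bold>* h r"
      by (simp add: Suc)
    also have "\<dots> = F (\<lambda>i. h (r + i)) {..<l}"
      unfolding Suc lessThan_Suc_shift by (simp add: commute)
    finally show ?thesis .
  qed simp
  with Suc show ?case by simp
qed simp

end

section \<open>Chequered cycles\<close>

lemma chequered_iff:
  "chequered_cycle M \<longleftrightarrow> M \<noteq> [] \<and> even (length M) \<and>
     (\<forall>i. fst (periodic_ext M i) > 0 \<and> snd (periodic_ext M i) \<in> {1, 2}) \<and>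
     (\<forall>i. snd (periodic_ext M i) \<noteq> snd (periodic_ext M (Suc i)))"
  (is "?L \<longleftrightarrow> ?R")
proof
  assume L: ?L
  then have ne: "M \<noteq> []" by (simp add: chequered_cycle_def)
  have "fst (periodic_ext M i) > 0 \<and> snd (periodic_ext M i) \<in> {1, 2}" for i
    using L periodic_ext_in_set[OF ne, of i] unfolding chequered_cycle_def by (cases "periodic_ext M i") force
  moreover have "snd (periodic_ext M i) \<noteq> snd (periodic_ext M (Suc i))" for i
  proof -
    have "i mod length M < length M" using ne by simp
    then show ?thesis
      using L unfolding chequered_cycle_def periodic_ext_Suc periodic_ext_def[of M i] by blast
  qed
  ultimately show ?R using L by (simp add: chequered_cycle_def)
next
  assume R: ?R
  have "k > 0 \<and> e \<in> {1, 2}" if "(k, e) \<in> set M" for k e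
  proof -
    from that obtain i where "i < length M" "M ! i = (k, e)" by (auto simp: in_set_conv_nth)
    then show ?thesis using R periodic_ext_nth[of i M] by (metis fst_conv snd_conv)
  qed
  moreover have "snd (M ! i) \<noteq> snd (M ! (Suc i mod length M))" if "i < length M" for i
    using R that periodic_ext_nth[OF that] periodic_ext_Suc[of M i] by (metis mod_less)
  ultimately show ?L using R unfolding chequered_cycle_def by blast
qed

lemma label_sum_eq: "label_sum M = (\<Sum>i<length M. fst (periodic_ext M i))"
  by (simp add: label_sum_def sum_list_sum_nth atLeast0LessThan periodic_ext_nth)

text \<open>
  The coefficient of the cycle weight. The square roots in the two edge weights at a node combine to
  its label.
\<close>

definition cycle_coeff :: "(nat \<Rightarrow> nat \<Rightarrow> nat \<Rightarrow> complex) \<Rightarrow> (nat \<times> nat) list \<Rightarrow> complex" where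
  "cycle_coeff C M = (\<Prod>i<length M. C (snd (periodic_ext M i)) (fst (periodic_ext M i)) (fst (periodic_ext M (Suc i)))
     / of_nat (fst (periodic_ext M i)))"

lemma label_sum_list_power:
  assumes "r > 0" "M \<noteq> []"
  shows "label_sum (list_power r M) = r * label_sum M"
  unfolding label_sum_eq length_list_power periodic_ext_list_power[OF assms]
  by (subst sum.periodic_multiple) simp_all

lemma cycle_coeff_list_power:
  assumes "r > 0" "M \<noteq> []"
  shows "cycle_coeff C (list_power r M) = cycle_coeff C M ^ r"
  unfolding cycle_coeff_def length_list_power periodic_ext_list_power[OF assms]
  by (subst prod.periodic_multiple) (simp_all del: add_Suc add: add_Suc[symmetric])

lemma label_sum_rotate: "M \<noteq> [] \<Longrightarrow> label_sum (rotate r M) = label_sum M"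
  unfolding label_sum_eq length_rotate
  by (simp add: periodic_ext_rotate, rule sum.periodic_shift) simp

lemma cycle_coeff_rotate: "M \<noteq> [] \<Longrightarrow> cycle_coeff C (rotate r M) = cycle_coeff C M"
proof -
  assume ne: "M \<noteq> []"
  let ?h = "\<lambda>i. C (snd (periodic_ext M i)) (fst (periodic_ext M i)) (fst (periodic_ext M (Suc i))) / of_nat (fst (periodic_ext M i))"
  have "cycle_coeff C (rotate r M) = (\<Prod>i<length M. ?h (r + i))"
    by (simp add: cycle_coeff_def periodic_ext_rotate[OF ne])
  also have "\<dots> = (\<Prod>i<length M. ?h i)"
    by (rule prod.periodic_shift) (simp del: add_Suc add: add_Suc[symmetric])
  finally show ?thesis by (simp add: cycle_coeff_def)
qed

lemma chequered_rotate: "chequered_cycle M \<Longrightarrow> chequered_cycle (rotate r M)"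
  unfolding chequered_iff by (auto simp: periodic_ext_rotate)

lemma chequered_list_power:
  assumes "r > 0"
  shows "chequered_cycle M \<Longrightarrow> chequered_cycle (list_power r M)"
proof -
  assume M: "chequered_cycle M"
  then have ne: "M \<noteq> []" by (simp add: chequered_iff)
  then have "length (list_power r M) \<noteq> 0" unfolding length_list_power using assms by simp
  then have "list_power r M \<noteq> []" by fastforce
  then show ?thesis
    using M unfolding chequered_iff periodic_ext_list_power[OF assms ne] length_list_power by simp
qed

text \<open>
  The only condition that does not pass directly to the root is the parity of its length: as the two
  edge labels alternate, a period must be even.
\<close>

lemma chequered_root:
  assumes "r > 0" "M \<noteq> []" and c: "chequered_cycle (list_power r M)"
  shows "chequered_cycle M"
proof -
  let ?f = "periodic_ext M"
  have c': "snd (?f i) \<in> {1, 2}" "snd (?f i) \<noteq> snd (?f (Suc i))" for i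
    using c unfolding chequered_iff periodic_ext_list_power[OF assms(1,2)] by auto
  \<comment> \<open>two labels alternate, so an odd shift changes the label\<close>
  have "snd (?f i) = (if even i then snd (?f 0) else 3 - snd (?f 0))" for i
  proof (induction i)
    case (Suc i)
    then show ?case using c'(1)[of 0] c'(1)[of "Suc i"] c'(2)[of i] by (auto split: if_splits)
  qed simp
  from this[of "length M"] have "even (length M)"
    using periodic_ext_add_length[of M 0] c'(1)[of 0] by (auto split: if_splits)
  then show ?thesis
    using c assms(2) unfolding chequered_iff periodic_ext_list_power[OF assms(1,2)] by blast
qed

lemma finite_chequered: "finite {M. chequered_cycle M \<and> label_sum M \<le> n}"
proof -
  have "length M \<le> n \<and> set M \<subseteq> {..n} \<times> {1, 2}" if M: "chequered_cycle M" "label_sum M \<le> n" for M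
  proof
    have pos: "fst (periodic_ext M i) > 0" for i using M by (simp add: chequered_iff)
    have "length M = (\<Sum>i<length M. 1)" by simp
    also have "\<dots> \<le> (\<Sum>i<length M. fst (periodic_ext M i))"
      by (rule sum_mono) (use pos in \<open>simp add: Suc_leI\<close>)
    finally show "length M \<le> n" using M by (simp add: label_sum_eq)
    show "set M \<subseteq> {..n} \<times> {1, 2}"
    proof
      fix x assume x: "x \<in> set M"
      then have "fst x \<le> label_sum M" unfolding label_sum_def by (intro member_le_sum_list) auto
      moreover have "snd x \<in> {1, 2}" using M x by (cases x) (auto simp: chequered_cycle_def)
      ultimately show "x \<in> {..n} \<times> {1, 2}" using M by (cases x) auto
    qed
  qed
  then have "{M. chequered_cycle M \<and> label_sum M \<le> n} \<subseteq> {M. set M \<subseteq> {..n} \<times> {1, 2} \<and> length M \<le> n}"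
    by auto
  then show ?thesis by (rule finite_subset) (simp add: finite_lists_length_le)
qed

lemma chequered_label_sum_pos: "chequered_cycle M \<Longrightarrow> label_sum M > 0"
proof -
  assume M: "chequered_cycle M"
  then obtain x xs where x: "M = x # xs" by (cases M) (auto simp: chequered_cycle_def)
  then have "fst x > 0" using M by (cases x) (auto simp: chequered_cycle_def)
  then show ?thesis using x by (simp add: label_sum_def)
qed

section \<open>Closed walks are rooted chequered cycles\<close>

lemma alternates_iff:
  assumes "e \<in> {1, 2}"
  shows "alternates e M \<longleftrightarrow> (\<forall>i<length M. fst (M ! i) > 0 \<and> snd (M ! i) = (if even i then e else 3 - e))"
  using assms
proof (induction M arbitrary: e)
  case (Cons x M)
  obtain k e' where x: "x = (k, e')" by (cases x)
  have e: "3 - e \<in> {1, 2}" "3 - (3 - e) = e" using Cons.prems by auto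
  show ?case
    unfolding x length_Cons All_less_Suc2 alternates.simps Cons.IH[OF e(1)] e(2) by auto
qed simp

lemma chequered_eq_walks:
  assumes "n \<ge> 1"
  shows "{M. chequered_cycle M \<and> label_sum M = n} = walks True 1 n \<union> walks True 2 n" (is "?L = ?R")
proof (rule set_eqI)
  fix M
  show "M \<in> ?L \<longleftrightarrow> M \<in> ?R"
  proof
    assume "M \<in> ?L"
    then have M: "chequered_cycle M" "label_sum M = n" by auto
    then have ne: "M \<noteq> []" by (simp add: chequered_iff)
    let ?f = "periodic_ext M"
    have c: "fst (?f i) > 0" "snd (?f i) \<in> {1, 2}" "snd (?f i) \<noteq> snd (?f (Suc i))" for i
      using M unfolding chequered_iff by auto
    have "snd (?f i) = (if even i then snd (?f 0) else 3 - snd (?f 0))" for i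
    proof (induction i)
      case (Suc i)
      then show ?case using c(2)[of 0] c(2)[of "Suc i"] c(3)[of i] by (auto split: if_splits)
    qed simp
    then have "alternates (snd (?f 0)) M"
      unfolding alternates_iff[OF c(2)] using c(1) periodic_ext_nth[of _ M] by metis
    then show "M \<in> ?R"
      using M c(2)[of 0] unfolding walks_def chequered_cycle_def by auto
  next
    assume "M \<in> ?R"
    then obtain e where e: "e \<in> {1, 2}" and M: "M \<in> walks True e n" by auto
    then have alt: "\<forall>i<length M. fst (M ! i) > 0 \<and> snd (M ! i) = (if even i then e else 3 - e)"
      and ev: "even (length M)" and n: "label_sum M = n"
      unfolding walks_def by (auto simp: alternates_iff)
    have ne: "M \<noteq> []" using n assms by auto
    have lab: "\<forall>(k, e')\<in>set M. k > 0 \<and> e' \<in> {1, 2}"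
    proof (intro ballI)
      fix x assume "x \<in> set M"
      then obtain i where "i < length M" "M ! i = x" by (auto simp: in_set_conv_nth)
      then have "fst x > 0 \<and> snd x = (if even i then e else 3 - e)" using alt by blast
      then show "case x of (k, e') \<Rightarrow> k > 0 \<and> e' \<in> {1, 2}" using e by (cases x) (auto split: if_splits)
    qed
    have adj: "snd (M ! i) \<noteq> snd (M ! (Suc i mod length M))" if i: "i < length M" for i
    proof (cases "Suc i < length M")
      case True
      then show ?thesis using alt i e by (auto split: if_splits)
    next
      case False
      then have l: "length M = Suc i" using i by simp
      then have "odd i" using ev by simp
      then show ?thesis using alt i e l ne by (auto split: if_splits)
    qed
    show "M \<in> ?L" using ne ev lab adj n unfolding chequered_cycle_def by blast
  qed
qed

lemma walk_weight_eq:
  assumes "M \<noteq> []" and "\<forall>x\<in>set M. fst x > 0"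
  shows "walk_weight C M j = of_nat (fst (hd M)) * (\<Prod>i<length M.
     C (snd (M ! i)) (fst (M ! i)) (if Suc i < length M then fst (M ! Suc i) else j) / of_nat (fst (M ! i)))"
  using assms
proof (induction C M j rule: walk_weight.induct)
  case (3 C k e l e' ys j)
  let ?M = "(l, e') # ys"
  have IH: "walk_weight C ?M j = of_nat l * (\<Prod>i<length ?M.
     C (snd (?M ! i)) (fst (?M ! i)) (if Suc i < length ?M then fst (?M ! Suc i) else j) / of_nat (fst (?M ! i)))"
    using 3 by simp
  have pos: "k > 0" "l > 0" using 3 by auto
  have "(\<Prod>i<length ((k, e) # ?M). C (snd (((k, e) # ?M) ! i)) (fst (((k, e) # ?M) ! i))
      (if Suc i < length ((k, e) # ?M) then fst (((k, e) # ?M) ! Suc i) else j) / of_nat (fst (((k, e) # ?M) ! i)))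
    = C e k l / of_nat k * (\<Prod>i<length ?M.
     C (snd (?M ! i)) (fst (?M ! i)) (if Suc i < length ?M then fst (?M ! Suc i) else j) / of_nat (fst (?M ! i)))"
    unfolding length_Cons[of _ ?M] prod.lessThan_Suc_shift by simp
  then show ?case
    unfolding walk_weight.simps IH using pos by simp
qed auto

text \<open>
  In a closed walk the root is not an inner node: its label is missing from the denominator.
\<close>

lemma walk_weight_closed:
  assumes "chequered_cycle M"
  shows "walk_weight C M (fst (hd M)) = of_nat (fst (hd M)) * cycle_coeff C M"
proof -
  have ne: "M \<noteq> []" and pos: "\<forall>x\<in>set M. fst x > 0"
    using assms by (auto simp: chequered_cycle_def)
  have nxt: "(if Suc i < length M then fst (M ! Suc i) else fst (hd M)) = fst (periodic_ext M (Suc i))"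
    if "i < length M" for i
  proof (cases "Suc i < length M")
    case False
    then have "length M = Suc i" using that by simp
    then show ?thesis using ne by (simp add: periodic_ext_def hd_conv_nth)
  qed (simp add: periodic_ext_nth)
  show ?thesis
    unfolding walk_weight_eq[OF ne pos] cycle_coeff_def
    by (intro arg_cong2[where f = "(*)"] prod.cong refl) (simp only: lessThan_iff nxt periodic_ext_nth)
qed

text \<open>
  A closed walk with an even number of edges is a chequered cycle with a chosen first node.
\<close>

lemma cycle_sum_chequered:
  assumes "n \<ge> 1"
  shows "cycle_sum C 1 n + cycle_sum C 2 n
    = (\<Sum>M | chequered_cycle M \<and> label_sum M = n. of_nat (fst (hd M)) * cycle_coeff C M)"
proof -
  have disj: "walks True 1 n \<inter> walks True 2 n = {}"
  proof (rule ccontr)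
    assume "\<not> ?thesis"
    then obtain M where M: "M \<in> walks True 1 n" "M \<in> walks True 2 n" by blast
    then have "M \<noteq> []" using assms by (auto simp: walks_def)
    then show False using M by (cases M) (auto simp: walks_def)
  qed
  have "(\<Sum>M | chequered_cycle M \<and> label_sum M = n. of_nat (fst (hd M)) * cycle_coeff C M)
     = (\<Sum>M | chequered_cycle M \<and> label_sum M = n. walk_weight C M (fst (hd M)))"
    by (intro sum.cong refl) (simp add: walk_weight_closed)
  also have "\<dots> = cycle_sum C 1 n + cycle_sum C 2 n"
    unfolding chequered_eq_walks[OF assms] cycle_sum_def
    by (rule sum.union_disjoint[OF _ _ disj]) (simp_all add: finite_walks)
  finally show ?thesis by simp
qed

text \<open>
  Every chequered cycle with a first node is a power of exactly one rotationless one, and the latter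
  starts at a node of the same label.
\<close>

lemma sum_over_roots:
  assumes n: "n \<ge> 1"
  shows "(\<Sum>M | chequered_cycle M \<and> label_sum M = n. of_nat (fst (hd M)) * cycle_coeff C M)
    = (\<Sum>P | chequered_cycle P \<and> rotationless P \<and> label_sum P dvd n.
        of_nat (fst (hd P)) * cycle_coeff C P ^ (n div label_sum P))"
proof -
  let ?D = "{P. chequered_cycle P \<and> rotationless P \<and> label_sum P dvd n}"
  let ?T = "{M. chequered_cycle M \<and> label_sum M = n}"
  let ?F = "\<lambda>P. list_power (n div label_sum P) P"
  have D: "P \<noteq> []" "n div label_sum P > 0" "n div label_sum P * label_sum P = n" if "P \<in> ?D" for P
  proof -
    show "P \<noteq> []" using that by (simp add: chequered_cycle_def)
    show e: "n div label_sum P * label_sum P = n" using that by simp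
    show "n div label_sum P > 0" using e n by (metis gr0I mult_is_0 not_one_le_zero)
  qed
  have "bij_betw ?F ?D ?T"
    unfolding bij_betw_def
  proof
    show "inj_on ?F ?D"
    proof (rule inj_onI)
      fix P Q assume P: "P \<in> ?D" and Q: "Q \<in> ?D" and eq: "?F P = ?F Q"
      have "periodic_ext P i = periodic_ext Q i" for i
        using periodic_ext_list_power[OF D(2,1)[OF P], of i] periodic_ext_list_power[OF D(2,1)[OF Q], of i] eq by simp
      then show "P = Q" using P Q D(1) by (intro rotationless_eqI) auto
    qed
    show "?F ` ?D = ?T"
    proof
      show "?F ` ?D \<subseteq> ?T"
      proof
        fix M assume "M \<in> ?F ` ?D"
        then obtain P where P: "P \<in> ?D" and M: "M = ?F P" by blast
        show "M \<in> ?T"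
          unfolding M using P chequered_list_power[OF D(2)[OF P], of P] label_sum_list_power[OF D(2,1)[OF P]] D(3)[OF P]
          by simp
      qed
      show "?T \<subseteq> ?F ` ?D"
      proof
        fix M assume "M \<in> ?T"
        then have M: "chequered_cycle M" "label_sum M = n" by auto
        then have "M \<noteq> []" by (simp add: chequered_cycle_def)
        then obtain r P where P: "r > 0" "P \<noteq> []" "rotationless P" "M = list_power r P"
          by (rule primitive_root)
        have cP: "chequered_cycle P" using chequered_root[OF P(1,2)] M P(4) by simp
        have lP: "n = r * label_sum P" using label_sum_list_power[OF P(1,2)] M P(4) by simp
        then have "n div label_sum P = r" using chequered_label_sum_pos[OF cP] by simp
        then have "M = ?F P" using P(4) by simp
        moreover have "P \<in> ?D" using cP P(3) lP by simp
        ultimately show "M \<in> ?F ` ?D" by blast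
      qed
    qed
  qed
  then have "(\<Sum>M\<in>?T. of_nat (fst (hd M)) * cycle_coeff C M) = (\<Sum>P\<in>?D. of_nat (fst (hd (?F P))) * cycle_coeff C (?F P))"
    by (rule sum.reindex_bij_betw[symmetric])
  also have "\<dots> = (\<Sum>P\<in>?D. of_nat (fst (hd P)) * cycle_coeff C P ^ (n div label_sum P))"
  proof (rule sum.cong[OF refl], goal_cases)
    case P: (1 P)
    have "hd (?F P) = hd P"
      using D(1,2)[OF P] by (cases "n div label_sum P") (auto simp: hd_append)
    then show ?case
      by (simp add: cycle_coeff_list_power[OF D(2,1)[OF P]])
  qed
  finally show ?thesis .
qed

section \<open>Classes of rotationless chequered cycles\<close>

lemma equiv_cycle_iso: "equiv UNIV cycle_iso"
proof (rule equivI)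
  show "refl cycle_iso" by (rule refl_onI) (auto simp: cycle_iso_def intro: exI[of _ 0])
  show "sym cycle_iso"
  proof (rule symI)
    fix M N :: "(nat \<times> nat) list" assume "(M, N) \<in> cycle_iso"
    then obtain r where N: "N = rotate r M" by (auto simp: cycle_iso_def)
    show "(N, M) \<in> cycle_iso"
    proof (cases "M = []")
      case False
      then have "r \<le> r * length M" by (cases M) auto
      then have "rotate (r * length M - r) N = rotate (r * length M) M"
        by (simp add: N rotate_rotate)
      also have "\<dots> = M" by (subst rotate_conv_mod) simp
      finally have "M = rotate (r * length M - r) N" by (rule sym)
      then show ?thesis unfolding cycle_iso_def by blast
    qed (simp add: N cycle_iso_def)
  qed
  show "trans cycle_iso"
    by (rule transI) (auto simp: cycle_iso_def rotate_rotate)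
qed auto

definition class_size :: "(nat \<times> nat) list set \<Rightarrow> nat" where
  "class_size \<N> = the_elem (label_sum ` \<N>)"

definition class_coeff :: "(nat \<Rightarrow> nat \<Rightarrow> nat \<Rightarrow> complex) \<Rightarrow> (nat \<times> nat) list set \<Rightarrow> complex" where
  "class_coeff C \<N> = the_elem (cycle_coeff C ` \<N>)"

lemma the_elem_image_const:
  assumes "x \<in> A" and "\<And>y. y \<in> A \<Longrightarrow> f y = f x"
  shows "the_elem (f ` A) = f x"
proof -
  have "f ` A = {f x}" using assms by blast
  then show ?thesis by simp
qed

lemma rotationless_classE:
  assumes "\<N> \<in> rotationless_classes"
  obtains P where "chequered_cycle P" "rotationless P" "P \<noteq> []" "\<N> = {N. \<exists>r. N = rotate r P}"
  using assms unfolding rotationless_classes_def quotient_def cycle_iso_def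
  by (auto simp: chequered_cycle_def Image_def)

lemma inj_rotate: "inj (rotate n :: 'b list \<Rightarrow> 'b list)"
proof (induction n)
  case (Suc n)
  have "inj (rotate1 \<circ> rotate n :: 'b list \<Rightarrow> 'b list)" by (rule inj_compose[OF inj_rotate1 Suc])
  then show ?case by (simp add: rotate_def o_def)
qed (simp add: rotate_def)

lemma rotationless_rotate:
  assumes "rotationless P" "P \<noteq> []"
  shows "rotationless (rotate r P)"
  unfolding rotationless_def
proof (intro allI impI notI)
  fix s assume s: "0 < s \<and> s < length (rotate r P)" and eq: "rotate s (rotate r P) = rotate r P"
  then have "rotate r (rotate s P) = rotate r P" by (simp add: rotate_rotate add.commute)
  then have "rotate s P = P" by (rule injD[OF inj_rotate])
  then show False using assms s by (simp add: rotationless_def)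
qed

lemma class_member:
  assumes "\<N> \<in> rotationless_classes" and "M \<in> \<N>"
  shows "chequered_cycle M" "rotationless M" "label_sum M = class_size \<N>" "cycle_coeff C M = class_coeff C \<N>"
proof -
  obtain P where P: "chequered_cycle P" "rotationless P" "P \<noteq> []" "\<N> = {N. \<exists>r. N = rotate r P}"
    using rotationless_classE[OF assms(1)] .
  obtain r where M: "M = rotate r P" using assms(2) P(4) by auto
  have PN: "P \<in> \<N>" unfolding P(4) by (auto intro: exI[of _ 0])
  show "chequered_cycle M" "rotationless M"
    unfolding M using P chequered_rotate rotationless_rotate by auto
  have "class_size \<N> = label_sum P"
    unfolding class_size_def by (rule the_elem_image_const[OF PN]) (auto simp: P(4) label_sum_rotate[OF P(3)])
  then show "label_sum M = class_size \<N>" by (simp add: M label_sum_rotate[OF P(3)])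
  have "class_coeff C \<N> = cycle_coeff C P"
    unfolding class_coeff_def by (rule the_elem_image_const[OF PN]) (auto simp: P(4) cycle_coeff_rotate[OF P(3)])
  then show "cycle_coeff C M = class_coeff C \<N>" by (simp add: M cycle_coeff_rotate[OF P(3)])
qed

lemma class_nonempty: "\<N> \<in> rotationless_classes \<Longrightarrow> \<exists>M. M \<in> \<N>"
  by (erule rotationless_classE) blast

lemma class_size_pos: "\<N> \<in> rotationless_classes \<Longrightarrow> class_size \<N> > 0"
proof -
  assume N: "\<N> \<in> rotationless_classes"
  then obtain M where M: "M \<in> \<N>" using class_nonempty by blast
  show ?thesis using chequered_label_sum_pos[OF class_member(1)[OF N M]] class_member(3)[OF N M] by simp
qed

lemma class_of_member:
  assumes "chequered_cycle M" "rotationless M"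
  shows "\<exists>\<N>\<in>rotationless_classes. M \<in> \<N>"
proof -
  have "cycle_iso `` {M} \<in> rotationless_classes"
    unfolding rotationless_classes_def by (rule quotientI) (use assms in simp)
  moreover have "M \<in> cycle_iso `` {M}" by (auto simp: cycle_iso_def intro: exI[of _ 0])
  ultimately show ?thesis by blast
qed

lemma class_as_image:
  assumes "rotationless P" "P \<noteq> []"
  shows "{N. \<exists>r. N = rotate r P} = (\<lambda>i. rotate i P) ` {..<length P}"
    and "inj_on (\<lambda>i. rotate i P) {..<length P}"
proof -
  show "{N. \<exists>r. N = rotate r P} = (\<lambda>i. rotate i P) ` {..<length P}"
  proof
    show "{N. \<exists>r. N = rotate r P} \<subseteq> (\<lambda>i. rotate i P) ` {..<length P}"
    proof
      fix N assume "N \<in> {N. \<exists>r. N = rotate r P}"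
      then obtain r where "N = rotate r P" by auto
      then have "N = rotate (r mod length P) P" using rotate_conv_mod by metis
      then show "N \<in> (\<lambda>i. rotate i P) ` {..<length P}" using assms(2) by auto
    qed
  qed auto
  show "inj_on (\<lambda>i. rotate i P) {..<length P}"
  proof (rule linorder_inj_onI)
    fix i j assume ij: "i < j" "i \<in> {..<length P}" "j \<in> {..<length P}"
    show "rotate i P \<noteq> rotate j P"
    proof
      assume "rotate i P = rotate j P"
      also have "rotate j P = rotate i (rotate (j - i) P)" using ij by (simp add: rotate_rotate)
      finally have "rotate (j - i) P = P" by (rule injD[OF inj_rotate, symmetric])
      then show False using assms ij by (auto simp: rotationless_def)
    qed
  qed auto
qed

text \<open>
  A rotationless cycle has as many rotations as nodes, and each node is the first one exactly once.
\<close>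

lemma sum_hd_class:
  assumes "\<N> \<in> rotationless_classes"
  shows "(\<Sum>M\<in>\<N>. of_nat (fst (hd M))) = (of_nat (class_size \<N>) :: complex)" and "finite \<N>"
proof -
  obtain P where P: "chequered_cycle P" "rotationless P" "P \<noteq> []" "\<N> = {N. \<exists>r. N = rotate r P}"
    using rotationless_classE[OF assms] .
  have "P \<in> \<N>" unfolding P(4) by (auto intro: exI[of _ 0])
  then have "class_size \<N> = label_sum P" using class_member(3)[OF assms] by simp
  note image = class_as_image[OF P(2,3)]
  show "finite \<N>" unfolding P(4) image(1) by simp
  have "(\<Sum>M\<in>\<N>. of_nat (fst (hd M))) = (\<Sum>i<length P. of_nat (fst (hd (rotate i P))))"
    unfolding P(4) image(1) by (simp add: sum.reindex[OF image(2)])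
  also have "\<dots> = (\<Sum>i<length P. of_nat (fst (periodic_ext P i)))"
    using P(3) by (intro sum.cong refl) (simp add: hd_rotate_conv_nth periodic_ext_def)
  finally show "(\<Sum>M\<in>\<N>. of_nat (fst (hd M))) = (of_nat (class_size \<N>) :: complex)"
    by (simp add: \<open>class_size \<N> = label_sum P\<close> label_sum_eq)
qed

lemma finite_classes: "finite {\<N>\<in>rotationless_classes. class_size \<N> \<le> n}"
proof -
  have "{\<N>\<in>rotationless_classes. class_size \<N> \<le> n}
    \<subseteq> (\<lambda>P. {N. \<exists>r. N = rotate r P}) ` {M. chequered_cycle M \<and> label_sum M \<le> n}"
  proof
    fix \<N> assume N: "\<N> \<in> {\<N>\<in>rotationless_classes. class_size \<N> \<le> n}"
    then have "\<N> \<in> rotationless_classes" by simp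
    then obtain P where P: "chequered_cycle P" "\<N> = {N. \<exists>r. N = rotate r P}"
      by (rule rotationless_classE)
    then have "P \<in> \<N>" by (auto intro: exI[of _ 0])
    then have "label_sum P \<le> n" using N class_member(3)[of \<N> P] by simp
    then show "\<N> \<in> (\<lambda>P. {N. \<exists>r. N = rotate r P}) ` {M. chequered_cycle M \<and> label_sum M \<le> n}"
      using P by blast
  qed
  then show ?thesis using finite_chequered finite_surj by blast
qed

text \<open>
  The combinatorial core: summed over rooted cycles with the label of the root as factor, the
  powers \<open>\<zeta>(N)\<^sup>r\<close> of each class acquire the factor \<open>class_size\<close>, the exponent of \<open>\<epsilon>\<close> in \<open>\<zeta>(N)\<close>. The
  result is the \<open>n\<close>-th coefficient of \<open>- \<epsilon> d/d\<epsilon> \<Sum> log (1 - \<zeta>(N))\<close>.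
\<close>

lemma sum_over_classes:
  assumes n: "n \<ge> 1"
  shows "(\<Sum>M | chequered_cycle M \<and> label_sum M = n. of_nat (fst (hd M)) * cycle_coeff C M)
    = (\<Sum>\<N> | \<N> \<in> rotationless_classes \<and> class_size \<N> dvd n.
        of_nat (class_size \<N>) * class_coeff C \<N> ^ (n div class_size \<N>))"
proof -
  let ?D = "{P. chequered_cycle P \<and> rotationless P \<and> label_sum P dvd n}"
  let ?K = "{\<N>. \<N> \<in> rotationless_classes \<and> class_size \<N> dvd n}"
  have "?D = \<Union> ?K"
  proof
    show "?D \<subseteq> \<Union> ?K"
    proof
      fix P assume P: "P \<in> ?D"
      then obtain \<N> where "\<N> \<in> rotationless_classes" "P \<in> \<N>" using class_of_member by blast
      then show "P \<in> \<Union> ?K" using P class_member(3)[of \<N> P] by auto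
    qed
    show "\<Union> ?K \<subseteq> ?D"
    proof
      fix P assume "P \<in> \<Union> ?K"
      then obtain \<N> where "\<N> \<in> rotationless_classes" "class_size \<N> dvd n" "P \<in> \<N>" by blast
      then show "P \<in> ?D" using class_member[of \<N> P] by simp
    qed
  qed
  moreover have "(\<Sum>P\<in>\<Union> ?K. of_nat (fst (hd P)) * cycle_coeff C P ^ (n div label_sum P))
     = (\<Sum>\<N>\<in>?K. \<Sum>P\<in>\<N>. of_nat (fst (hd P)) * cycle_coeff C P ^ (n div label_sum P))"
  proof (subst sum.Union_disjoint)
    show "\<forall>A\<in>?K. finite A" using sum_hd_class(2) by blast
    show "\<forall>A\<in>?K. \<forall>B\<in>?K. A \<noteq> B \<longrightarrow> A \<inter> B = {}"
    proof (intro ballI impI)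
      fix A B assume "A \<in> ?K" "B \<in> ?K" "A \<noteq> B"
      then have "A \<in> UNIV // cycle_iso" "B \<in> UNIV // cycle_iso"
        unfolding rotationless_classes_def quotient_def by auto
      then show "A \<inter> B = {}" using quotient_disj[OF equiv_cycle_iso] \<open>A \<noteq> B\<close> by blast
    qed
  qed simp
  moreover have "(\<Sum>\<N>\<in>?K. \<Sum>P\<in>\<N>. of_nat (fst (hd P)) * cycle_coeff C P ^ (n div label_sum P))
     = (\<Sum>\<N>\<in>?K. of_nat (class_size \<N>) * class_coeff C \<N> ^ (n div class_size \<N>))"
  proof (rule sum.cong[OF refl])
    fix \<N> assume N: "\<N> \<in> ?K"
    then have NR: "\<N> \<in> rotationless_classes" by simp
    have "(\<Sum>P\<in>\<N>. of_nat (fst (hd P)) * cycle_coeff C P ^ (n div label_sum P))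
      = (\<Sum>P\<in>\<N>. of_nat (fst (hd P)) * class_coeff C \<N> ^ (n div class_size \<N>))"
      by (intro sum.cong refl) (simp only: class_member[OF NR])
    then show "(\<Sum>P\<in>\<N>. of_nat (fst (hd P)) * cycle_coeff C P ^ (n div label_sum P))
      = of_nat (class_size \<N>) * class_coeff C \<N> ^ (n div class_size \<N>)"
      using N sum_hd_class(1)[of \<N>] by (simp add: sum_distrib_right [symmetric])
  qed
  ultimately show ?thesis unfolding sum_over_roots[OF n] by simp
qed

section \<open>Logarithmic derivatives of infinite products\<close>

text \<open>
  The chain rule applied to the differential equation \<open>(1 + X) b' = b/2\<close> of the binomial series.
\<close>

lemma sqrt_one_minus_ode:
  assumes "fps_nth \<zeta> 0 = 0"
  shows "(1 - \<zeta>) * fps_deriv (sqrt_one_minus \<zeta>) = fps_const (-1/2) * (fps_deriv \<zeta> * sqrt_one_minus \<zeta>)"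
proof -
  let ?b = "fps_binomial (1/2) :: complex fps"
  have m0: "fps_nth (- \<zeta>) 0 = 0" using assms by simp
  have "fps_deriv ?b * (1 + fps_X) = fps_const (1/2) * ?b"
    unfolding fps_binomial_deriv by (simp add: fps_divide_unit mult.assoc inverse_mult_eq_1)
  then have "(fps_deriv ?b oo - \<zeta>) * ((1 + fps_X) oo - \<zeta>) = fps_const (1/2) * (?b oo - \<zeta>)"
    by (metis fps_compose_mult_distrib[OF m0] fps_const_compose)
  moreover have "(1 + fps_X) oo - \<zeta> = 1 - \<zeta>"
    using assms by (simp add: fps_compose_add_distrib fps_X_fps_compose_startby0)
  ultimately have e: "(fps_deriv ?b oo - \<zeta>) * (1 - \<zeta>) = fps_const (1/2) * (?b oo - \<zeta>)" by simp
  have "fps_deriv (sqrt_one_minus \<zeta>) = (fps_deriv ?b oo - \<zeta>) * (- fps_deriv \<zeta>)"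
    by (simp add: sqrt_one_minus_def fps_compose_deriv[OF m0])
  then have "(1 - \<zeta>) * fps_deriv (sqrt_one_minus \<zeta>) = - ((fps_deriv ?b oo - \<zeta>) * (1 - \<zeta>)) * fps_deriv \<zeta>"
    by (simp add: algebra_simps)
  also have "\<dots> = - (fps_const (1/2) * (?b oo - \<zeta>)) * fps_deriv \<zeta>" unfolding e ..
  also have "\<dots> = fps_const (-1/2) * (fps_deriv \<zeta> * sqrt_one_minus \<zeta>)"
    by (simp add: sqrt_one_minus_def ac_simps fps_const_neg [symmetric] del: fps_const_neg)
  finally show ?thesis .
qed

text \<open>
  \<open>X \<zeta>' / (1 - \<zeta>)\<close> for \<open>\<zeta> = c X\<^sup>s\<close>
\<close>

definition log_fps :: "nat \<Rightarrow> complex \<Rightarrow> complex fps" where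
  "log_fps s c = Abs_fps (\<lambda>i. if i > 0 \<and> s dvd i then of_nat s * c ^ (i div s) else 0)"

lemma log_fps_mult:
  assumes "s > 0"
  shows "(1 - fps_const c * fps_X ^ s) * log_fps s c = fps_X * fps_deriv (fps_const c * fps_X ^ s)"
proof (rule fps_ext)
  fix i
  have "fps_nth ((1 - fps_const c * fps_X ^ s) * log_fps s c) i
     = fps_nth (log_fps s c) i - c * (if i < s then 0 else fps_nth (log_fps s c) (i - s))"
    by (simp add: left_diff_distrib mult.assoc fps_X_power_mult_nth)
  also have "\<dots> = (if i = s then of_nat s * c else 0)"
  proof (cases "i > s")
    case True
    then show ?thesis
      using assms by (auto simp: log_fps_def dvd_minus_self le_div_geq)
  next
    case False
    then show ?thesis using assms by (auto simp: log_fps_def dest: dvd_imp_le)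
  qed
  also have "\<dots> = fps_nth (fps_X * fps_deriv (fps_const c * fps_X ^ s)) i"
    using assms by (cases i) (auto simp: fps_X_power_nth)
  finally show "fps_nth ((1 - fps_const c * fps_X ^ s) * log_fps s c) i
    = fps_nth (fps_X * fps_deriv (fps_const c * fps_X ^ s)) i" .
qed

lemma sqrt_factor_ode:
  fixes c :: complex
  assumes "s > 0"
  defines "f \<equiv> sqrt_one_minus (fps_const c * fps_X ^ s)"
  shows "fps_X * fps_deriv f = fps_const (-1/2) * log_fps s c * f" and "fps_nth f 0 = 1"
proof -
  let ?z = "fps_const c * fps_X ^ s"
  have z0: "fps_nth ?z 0 = 0" using assms(1) by (simp add: fps_X_power_nth)
  have "(1 - ?z) * (fps_X * fps_deriv f) = fps_X * ((1 - ?z) * fps_deriv f)" by (simp only: ac_simps)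
  also have "\<dots> = fps_const (-1/2) * (fps_X * fps_deriv ?z) * f"
    unfolding f_def sqrt_one_minus_ode[OF z0] by (simp only: ac_simps)
  also have "\<dots> = (1 - ?z) * (fps_const (-1/2) * log_fps s c * f)"
    unfolding log_fps_mult[OF assms(1), symmetric] by (simp only: ac_simps)
  finally have "(1 - ?z) * (fps_X * fps_deriv f) = (1 - ?z) * (fps_const (-1/2) * log_fps s c * f)" .
  moreover have "1 - ?z \<noteq> 0"
  proof
    assume "1 - ?z = 0"
    then have "fps_nth (1 - ?z) 0 = 0" by (simp only: fps_zero_nth)
    then show False using z0 by simp
  qed
  ultimately show "fps_X * fps_deriv f = fps_const (-1/2) * log_fps s c * f"
    by (simp only: mult_cancel_left) simp
  show "fps_nth f 0 = 1" by (simp add: f_def sqrt_one_minus_def)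
qed

lemma prod_log_ode:
  fixes f L :: "'i \<Rightarrow> complex fps"
  assumes "finite F" and "\<And>i. i \<in> F \<Longrightarrow> fps_X * fps_deriv (f i) = L i * f i"
  shows "fps_X * fps_deriv (prod f F) = sum L F * prod f F"
  using assms
proof (induction F)
  case (insert i F)
  have "fps_X * fps_deriv (prod f (insert i F)) = (fps_X * fps_deriv (f i)) * prod f F + f i * (fps_X * fps_deriv (prod f F))"
    using insert.hyps by (simp add: algebra_simps)
  also have "\<dots> = (L i + sum L F) * (f i * prod f F)"
    using insert.prems insert.IH by (simp add: algebra_simps)
  finally show ?case using insert.hyps by simp
qed simp

lemma log_ode_unique:
  fixes f g A B :: "complex fps"
  assumes f: "fps_X * fps_deriv f = A * f" and g: "fps_X * fps_deriv g = B * g"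
    and 0: "fps_nth A 0 = 0" and AB: "\<And>i. i \<le> n \<Longrightarrow> fps_nth A i = fps_nth B i"
    and fg: "fps_nth f 0 = fps_nth g 0" and "m \<le> n"
  shows "fps_nth f m = fps_nth g m"
  using assms(6)
proof (induction m rule: less_induct)
  case (less m)
  have rec: "of_nat m * fps_nth h m = (\<Sum>i=1..m. fps_nth D i * fps_nth h (m - i))"
    if "fps_X * fps_deriv h = D * h" "fps_nth D 0 = 0" for h D :: "complex fps"
  proof -
    have "of_nat m * fps_nth h m = fps_nth (fps_X * fps_deriv h) m" by (cases m) simp_all
    then show ?thesis unfolding that(1) fps_mult_nth using that(2) by (simp add: sum.atLeast_Suc_atMost)
  qed
  have B0: "fps_nth B 0 = 0" using AB[of 0] 0 by simp
  show ?case
  proof (cases "m = 0")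
    case False
    have "(\<Sum>i=1..m. fps_nth A i * fps_nth f (m - i)) = (\<Sum>i=1..m. fps_nth B i * fps_nth g (m - i))"
      by (intro sum.cong refl) (use less AB in simp)
    then have "of_nat m * fps_nth f m = of_nat m * fps_nth g m"
      unfolding rec[OF f 0] rec[OF g B0] .
    then show ?thesis using False by simp
  qed (simp add: fg)
qed

text \<open>
  \<open>P = exp \<integral> A/X dX\<close>
\<close>

lemma log_ode_exists:
  fixes A :: "complex fps"
  assumes "fps_nth A 0 = 0"
  obtains P where "fps_X * fps_deriv P = A * P" "fps_nth P 0 = 1"
proof
  define h where "h = Abs_fps (\<lambda>n. fps_nth A n / of_nat n)"
  have h0: "fps_nth h 0 = 0" by (simp add: h_def)
  have "fps_X * fps_deriv h = A"
  proof (rule fps_ext)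
    fix n show "fps_nth (fps_X * fps_deriv h) n = fps_nth A n"
      using assms by (cases n) (simp_all add: h_def del: of_nat_Suc)
  qed
  then show "fps_X * fps_deriv (fps_exp 1 oo h) = A * (fps_exp 1 oo h)"
    by (simp add: fps_compose_deriv[OF h0] mult.left_commute mult.commute)
  show "fps_nth (fps_exp 1 oo h) 0 = 1" by simp
qed

text \<open>
  The coefficients of a power series up to order \<open>n\<close> are determined by its constant term and those of its logarithmic
  derivative up to order \<open>n\<close>. Only the factors with \<open>deg i \<le> n\<close> contribute to the latter, so the
  coefficients of finite partial products stabilise.
\<close>

lemma infprod_fps_log_ode:
  fixes f L :: "'i \<Rightarrow> complex fps" and deg :: "'i \<Rightarrow> nat"
  assumes ode: "\<And>i. i \<in> I \<Longrightarrow> fps_X * fps_deriv (f i) = L i * f i" and f0: "\<And>i. i \<in> I \<Longrightarrow> fps_nth (f i) 0 = 1"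
    and fin: "\<And>n. finite {i \<in> I. deg i \<le> n}"
    and L: "\<And>i n. i \<in> I \<Longrightarrow> n < deg i \<Longrightarrow> fps_nth (L i) n = 0"
    and A: "\<And>n. fps_nth A n = (\<Sum>i | i \<in> I \<and> deg i \<le> n. fps_nth (L i) n)"
    and A0: "fps_nth A 0 = 0"
    and P: "fps_X * fps_deriv P = A * P" "fps_nth P 0 = 1"
  shows "infprod_fps f I = P"
proof -
  have "eventually (\<lambda>F. fps_nth (prod f F) n = fps_nth P n) (finite_subsets_at_top I)" for n
    unfolding eventually_finite_subsets_at_top
  proof (intro exI[of _ "{i \<in> I. deg i \<le> n}"] conjI allI impI)
    fix F assume F: "finite F \<and> {i \<in> I. deg i \<le> n} \<subseteq> F \<and> F \<subseteq> I"
    have ode_F: "fps_X * fps_deriv (prod f F) = sum L F * prod f F"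
      by (rule prod_log_ode) (use F ode in auto)
    have "fps_nth A m = fps_nth (sum L F) m" if "m \<le> n" for m
    proof -
      have "fps_nth (L i) m = 0" if "i \<in> F" "\<not> deg i \<le> m" for i
        by (rule L) (use that F in auto)
      note L0 = this
      have "fps_nth (sum L F) m = (\<Sum>i\<in>F. fps_nth (L i) m)" by (rule fps_sum_nth)
      also have "\<dots> = (\<Sum>i | i \<in> I \<and> deg i \<le> m. fps_nth (L i) m)"
        by (rule sum.mono_neutral_right) (use F that L0 in auto)
      finally show ?thesis by (simp add: A)
    qed
    moreover have "fps_nth (prod f F) 0 = 1"
    proof -
      have "fps_nth (prod f F) 0 = (\<Prod>i\<in>F. fps_nth (f i) 0)"
        by (induction F rule: infinite_finite_induct) simp_all
      also have "\<dots> = 1" by (rule prod.neutral) (use F f0 in auto)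
      finally show ?thesis .
    qed
    ultimately show "fps_nth (prod f F) n = fps_nth P n"
      by (intro log_ode_unique[OF P(1) ode_F A0, symmetric, of n]) (simp_all add: P(2))
  qed (use fin in auto)
  then have "(prod f \<longlongrightarrow> P) (finite_subsets_at_top I)" by (rule tendsto_fpsI)
  then show ?thesis
    unfolding infprod_fps_def by (intro tendsto_Lim) simp_all
qed

section \<open>Weights of classes and the genus two partition function\<close>

lemma fps_const_prod: "(\<Prod>i\<in>A. fps_const (f i)) = fps_const (\<Prod>i\<in>A. f i :: complex)"
  by (induction A rule: infinite_finite_induct) simp_all

text \<open>
  A node of label \<open>k\<close> lies on two edges, and each of them contributes \<open>\<epsilon>\<^sup>k\<^sup>/\<^sup>2\<close> and \<open>k\<^sup>-\<^sup>1\<^sup>/\<^sup>2\<close>; hence the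
  product is a monomial in \<open>\<epsilon>\<close>. Substituting \<open>X\<^sup>2\<close> is injective.
\<close>

lemma cycle_weight_eq:
  fixes \<tau>\<^sub>1 \<tau>\<^sub>2 :: complex
  assumes "chequered_cycle M"
  defines "C \<equiv> \<lambda>e k l. C_coeff k l (if e = 1 then \<tau>\<^sub>1 else \<tau>\<^sub>2)"
  shows "cycle_weight \<tau>\<^sub>1 \<tau>\<^sub>2 M = fps_const (cycle_coeff C M) * fps_X ^ label_sum M"
proof -
  let ?f = "periodic_ext M" and ?l = "length M"
  let ?k = "\<lambda>i. fst (?f i)"
  have pos: "?k i > 0" for i using assms(1) by (simp add: chequered_iff)
  have "(\<Prod>i<?l. edge_weight \<tau>\<^sub>1 \<tau>\<^sub>2 (snd (M ! i)) (fst (M ! i)) (fst (M ! (Suc i mod ?l))))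
     = (\<Prod>i<?l. fps_const (C (snd (?f i)) (?k i) (?k (Suc i)) / of_real (sqrt (real (?k i * ?k (Suc i))))) * fps_X ^ (?k i + ?k (Suc i)))"
  proof (rule prod.cong[OF refl], goal_cases)
    case (1 i)
    then have "M ! i = ?f i" "M ! (Suc i mod ?l) = ?f (Suc i)" by (simp_all add: periodic_ext_def)
    then show ?case
      by (simp add: edge_weight_def C_def)
  qed
  also have "\<dots> = fps_const (\<Prod>i<?l. C (snd (?f i)) (?k i) (?k (Suc i)) / of_real (sqrt (real (?k i * ?k (Suc i)))))
      * fps_X ^ (\<Sum>i<?l. ?k i + ?k (Suc i))"
    by (simp only: prod.distrib power_sum fps_const_prod)
  also have "(\<Sum>i<?l. ?k i + ?k (Suc i)) = 2 * label_sum M"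
    using sum.periodic_shift[of ?k ?l 1] by (simp add: sum.distrib label_sum_eq)
  also have "(\<Prod>i<?l. C (snd (?f i)) (?k i) (?k (Suc i)) / of_real (sqrt (real (?k i * ?k (Suc i))))) = cycle_coeff C M"
  proof -
    let ?s = "\<lambda>i. sqrt (real (?k i))"
    have "(\<Prod>i<?l. sqrt (real (?k i * ?k (Suc i)))) = (\<Prod>i<?l. ?s i) * (\<Prod>i<?l. ?s (Suc i))"
      by (simp add: real_sqrt_mult prod.distrib)
    also have "(\<Prod>i<?l. ?s (Suc i)) = (\<Prod>i<?l. ?s i)"
      using prod.periodic_shift[of ?s ?l 1] by simp
    also have "(\<Prod>i<?l. ?s i) * (\<Prod>i<?l. ?s i) = (\<Prod>i<?l. real (?k i))"
      by (simp add: prod.distrib [symmetric])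
    finally have "complex_of_real (\<Prod>i<?l. sqrt (real (?k i * ?k (Suc i)))) = complex_of_real (\<Prod>i<?l. real (?k i))"
      by (rule arg_cong)
    then have "(\<Prod>i<?l. complex_of_real (sqrt (real (?k i * ?k (Suc i))))) = (\<Prod>i<?l. of_nat (?k i))"
      by (simp only: of_real_prod of_real_of_nat_eq)
    then show ?thesis by (simp add: cycle_coeff_def prod_dividef)
  qed
  finally have weight: "(\<Prod>i<?l. edge_weight \<tau>\<^sub>1 \<tau>\<^sub>2 (snd (M ! i)) (fst (M ! i)) (fst (M ! (Suc i mod ?l))))
     = fps_const (cycle_coeff C M) * fps_X ^ (2 * label_sum M)" .
  have x0: "fps_nth (fps_X ^ 2 :: complex fps) 0 = 0" by (simp add: fps_X_power_nth)
  have inj: "f = g" if "f oo fps_X ^ 2 = g oo fps_X ^ 2" for f g :: "complex fps"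
  proof (rule fps_ext)
    fix n
    have "fps_nth (h oo fps_X ^ 2) (2 * n) = fps_nth h n" for h :: "complex fps"
    proof -
      have "fps_nth (h oo fps_X ^ 2) (2 * n) = (\<Sum>i=0..2*n. fps_nth h i * (if i = n then 1 else 0))"
        unfolding fps_compose_nth power_mult [symmetric] fps_X_power_nth by (intro sum.cong refl) auto
      then show ?thesis by (simp add: if_distrib[of "\<lambda>c. _ * c"] cong: if_cong)
    qed
    then show "fps_nth f n = fps_nth g n" using that by metis
  qed
  have sub: "(fps_const (cycle_coeff C M) * fps_X ^ label_sum M) oo fps_X ^ 2 = fps_const (cycle_coeff C M) * fps_X ^ (2 * label_sum M)"
    by (simp add: fps_compose_mult_distrib[OF x0] fps_X_power_compose[OF x0] power_mult)
  show ?thesis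
    unfolding cycle_weight_def weight by (rule the_equality) (use sub inj in auto)
qed

lemma class_weight_eq:
  fixes \<tau>\<^sub>1 \<tau>\<^sub>2 :: complex
  assumes N: "\<N> \<in> rotationless_classes"
  defines "C \<equiv> \<lambda>e k l. C_coeff k l (if e = 1 then \<tau>\<^sub>1 else \<tau>\<^sub>2)"
  shows "class_weight \<tau>\<^sub>1 \<tau>\<^sub>2 \<N> = fps_const (class_coeff C \<N>) * fps_X ^ class_size \<N>"
proof -
  have w: "cycle_weight \<tau>\<^sub>1 \<tau>\<^sub>2 M = fps_const (class_coeff C \<N>) * fps_X ^ class_size \<N>" if "M \<in> \<N>" for M
    unfolding cycle_weight_eq[OF class_member(1)[OF N that]] C_def[symmetric]
    by (simp only: class_member[OF N that])
  obtain M where M: "M \<in> \<N>" using class_nonempty[OF N] by blast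
  have "class_weight \<tau>\<^sub>1 \<tau>\<^sub>2 \<N> = cycle_weight \<tau>\<^sub>1 \<tau>\<^sub>2 M"
    unfolding class_weight_def by (rule the_elem_image_const[OF M]) (simp only: w M)
  then show ?thesis by (simp only: w[OF M])
qed

theorem theorem6p6:
  fixes M :: "'v::ab_group_add vertex_structure" and a :: 'v
    and B :: "'v \<Rightarrow> 'v \<Rightarrow> complex" and S :: "nat \<Rightarrow> 'v set"
    and \<tau>\<^sub>1 \<tau>\<^sub>2 :: complex
  assumes "heisenberg_voa M a"
    and "is_LiZ_metric (square_bracket M) B"
    and "\<And>n. is_basis_of M (weight_space (square_bracket M) (int n)) (S n)"
    and "Im \<tau>\<^sub>1 > 0" and "Im \<tau>\<^sub>2 > 0"
  shows "genus_two_partition M B S \<tau>\<^sub>1 \<tau>\<^sub>2 =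
    fps_const (genus_one_partition M \<tau>\<^sub>1 * genus_one_partition M \<tau>\<^sub>2) /
      infprod_fps (\<lambda>\<N>. sqrt_one_minus (class_weight \<tau>\<^sub>1 \<tau>\<^sub>2 \<N>)) rotationless_classes"
proof -
  interpret heisenberg_metric M a B S
    unfolding heisenberg_metric_def heisenberg_metric_axioms_def using assms by blast
  define C where "C = (\<lambda>e k l. C_coeff k l (if e = (1::nat) then \<tau>\<^sub>1 else \<tau>\<^sub>2))"
  define G where "G = Abs_fps (\<lambda>n. if n = 0 then 0 else cycle_sum C 1 n + cycle_sum C 2 n)"
  define W where "W = genus_two_partition M B S \<tau>\<^sub>1 \<tau>\<^sub>2"
  define c where "c = genus_one_partition M \<tau>\<^sub>1 * genus_one_partition M \<tau>\<^sub>2"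
  have W: "fps_const 2 * (fps_X * fps_deriv W) = G * W" and W0: "fps_nth W 0 = c"
    unfolding W_def G_def C_def c_def by (rule genus_two_ode[OF assms(4,5)])+
  define A where "A = fps_const (-1/2) * G"
  have A0: "fps_nth A 0 = 0" by (simp add: A_def G_def)
  obtain P where P: "fps_X * fps_deriv P = A * P" "fps_nth P 0 = 1"
    using log_ode_exists[OF A0] by blast
  let ?L = "\<lambda>\<N>. fps_const (-1/2) * log_fps (class_size \<N>) (class_coeff C \<N>)"
  have A_eq: "fps_nth A n = (\<Sum>\<N> | \<N> \<in> rotationless_classes \<and> class_size \<N> \<le> n. fps_nth (?L \<N>) n)" for n
  proof (cases "n = 0")
    case True
    then show ?thesis by (simp add: A0 log_fps_def)
  next
    case False
    then have n: "n \<ge> 1" by simp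
    have "fps_nth A n = - (1/2) * (\<Sum>\<N> | \<N> \<in> rotationless_classes \<and> class_size \<N> dvd n.
        of_nat (class_size \<N>) * class_coeff C \<N> ^ (n div class_size \<N>))"
      using False unfolding A_def G_def sum_over_classes[OF n, symmetric] cycle_sum_chequered[OF n, symmetric] by simp
    also have "\<dots> = (\<Sum>\<N> | \<N> \<in> rotationless_classes \<and> class_size \<N> dvd n. fps_nth (?L \<N>) n)"
      unfolding sum_distrib_left using n by (intro sum.cong refl) (simp add: log_fps_def)
    also have "\<dots> = (\<Sum>\<N> | \<N> \<in> rotationless_classes \<and> class_size \<N> \<le> n. fps_nth (?L \<N>) n)"
      by (rule sum.mono_neutral_left) (use n finite_classes[of n] in \<open>auto simp: log_fps_def dest: dvd_imp_le\<close>)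
    finally show ?thesis .
  qed
  have "infprod_fps (\<lambda>\<N>. sqrt_one_minus (class_weight \<tau>\<^sub>1 \<tau>\<^sub>2 \<N>)) rotationless_classes = P"
  proof (rule infprod_fps_log_ode[where L = ?L and deg = class_size, OF _ _ finite_classes _ A_eq A0 P])
    fix \<N> assume N: "\<N> \<in> rotationless_classes"
    note ode = sqrt_factor_ode[OF class_size_pos[OF N], of "class_coeff C \<N>"]
    have w: "class_weight \<tau>\<^sub>1 \<tau>\<^sub>2 \<N> = fps_const (class_coeff C \<N>) * fps_X ^ class_size \<N>"
      unfolding C_def by (rule class_weight_eq[OF N])
    show "fps_X * fps_deriv (sqrt_one_minus (class_weight \<tau>\<^sub>1 \<tau>\<^sub>2 \<N>)) = ?L \<N> * sqrt_one_minus (class_weight \<tau>\<^sub>1 \<tau>\<^sub>2 \<N>)"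
      unfolding w by (rule ode(1))
    show "fps_nth (sqrt_one_minus (class_weight \<tau>\<^sub>1 \<tau>\<^sub>2 \<N>)) 0 = 1"
      unfolding w by (rule ode(2))
    show "fps_nth (?L \<N>) n = 0" if "n < class_size \<N>" for n
      using that by (auto simp: log_fps_def dest: dvd_imp_le)
  qed
  \<comment> \<open>The logarithmic derivatives of \<open>W\<close> and \<open>P\<close> are opposite to each other.\<close>
  moreover have "W * P = fps_const c"
  proof (rule fps_ext)
    fix n
    have "fps_const 2 * (fps_X * fps_deriv (W * P)) = (fps_const 2 * (fps_X * fps_deriv W)) * P + fps_const 2 * (W * (fps_X * fps_deriv P))"
      by (simp add: algebra_simps)
    also have "\<dots> = (1 + fps_const 2 * fps_const (-1/2)) * (G * W * P)"
      unfolding W P(1) A_def by (simp only: distrib_left mult_1_right mult_1_left ac_simps)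
    also have "\<dots> = 0" by simp
    finally have "fps_X * fps_deriv (W * P) = 0" by simp
    then have "fps_nth (fps_X * fps_deriv (W * P)) n = 0" by simp
    then show "fps_nth (W * P) n = fps_nth (fps_const c) n"
      by (cases n) (simp_all add: W0 P(2) del: fps_deriv_mult of_nat_Suc)
  qed
  moreover have "P \<noteq> 0" using P(2) by auto
  ultimately show ?thesis
    unfolding W_def[symmetric] c_def[symmetric] by (metis nonzero_mult_div_cancel_right)
qed

end
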